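(* Let $n\ge2$ and let $S_n$ act on $\{0,1\}^n$ by $(g\cdot x)_i=x_{g^{-1}(i)}$, with dual Burnside kernel $Q$ on $S_n$. Let $\varepsilon\in(0,1)$. Set $$\lambda_m:=\left(\frac{\binom{2m}m}{2^{2m}}\right)^2\qquad(0\le m\le\lfloor n/2\rfloor).$$ Then: (a) $\mathrm{Spec}_{\ne0}(Q)=\{\lambda_m:0\le m\le\lfloor n/2\rfloor\}$, with multiplicities $\mathrm{mult}_Q(\lambda_m)=\binom n{2m}$, and $\mathrm{mult}_Q(0)=n!-2^{n-1}$. Thus $0\in\mathrm{Spec}(Q)$ iff $n\ge3$. (b) For integers $t\ge1$, $$d_Q(t)\le\frac12\sqrt{(n+1)\binom n{\lfloor n/2\rfloor}}\left(\frac14\right)^{t-1}.$$ (c) If $g$ is an $n$-cycle, then, for integers $t\ge1$, $$d_Q(g,t)\le4\left(\frac14\right)^{t-1},\qquad t_{\mathrm{mix}}(Q;g,\varepsilon)\le2+\left\lceil\log_4\frac1\varepsilon\right\rceil.$$ (d) For integers $t\ge0$, $$d_Q(t)\ge4^{-(t+2)},\qquad t_{\mathrm{mix}}(Q;\varepsilon)\ge\left\lceil\log_4\frac1\varepsilon\right\rceil-2.$$ (e) For integers $t\ge1$, with $e$ the identity permutation, $$d_Q(e,t)\le\frac12\sqrt{\frac{n+1}{4^n}\binom{2n}n-1}\left(\frac14\right)^{t-1}\le\frac12\left(\frac n\pi\right)^{1/4}\left(\frac14\right)^{t-1}.$$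
   Context: For the action of $G=S_n$ on $X=\{0,1\}^n$: $X_g=\{x\in X:g\cdot x=x\}$, $G_x=\{g\in G:g\cdot x=x\}$; every $X_g$ is nonempty. The dual Burnside kernel on $S_n$ is $Q(g,h)=\frac1{|X_g|}\sum_{x\in X_g\cap X_h}\frac1{|G_x|}$, with stationary law $\pi_Q(g)=2^{c(g)}/(n+1)!$, where $c(g)$ is the number of cycles of $g$ (including fixed points). $\mathrm{Spec}_{\ne0}(Q)$ denotes the set of nonzero eigenvalues and $\mathrm{mult}_Q$ the algebraic multiplicity (with $\mathrm{mult}_Q(0)=0$ meaning $0$ is not an eigenvalue). $d_Q(g,t):=\|Q^t(g,\cdot)-\pi_Q\|_{\mathrm{TV}}$ with $\|\mu-\nu\|_{\mathrm{TV}}=\frac12\sum_s|\mu(s)-\nu(s)|$; $d_Q(t):=\max_gd_Q(g,t)$; $t_{\mathrm{mix}}(Q;g,\varepsilon):=\min\{t\ge0:d_Q(g,t)\le\varepsilon\}$; $t_{\mathrm{mix}}(Q;\varepsilon):=\min\{t\ge0:d_Q(t)\le\varepsilon\}$ (integer $t$). *)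

theory Defs
  imports
    Complex_Main
    "HOL-Library.FuncSet"
    "HOL-Combinatorics.Orbits"
    "HOL-Algebra.Group_Action"
    "HOL-Algebra.Sym_Groups"
    "Jordan_Normal_Form.Spectral_Radius"
begin

section \<open>The action of the symmetric group on binary words\<close>

definition binary_cube :: "nat \<Rightarrow> (nat \<Rightarrow> nat) set"
  where "binary_cube n = {1..n} \<rightarrow>\<^sub>E {0, 1}"

definition perm_act :: "nat \<Rightarrow> (nat \<Rightarrow> nat) \<Rightarrow> (nat \<Rightarrow> nat) \<Rightarrow> (nat \<Rightarrow> nat)"
  where "perm_act n g = (\<lambda>x\<in>binary_cube n. \<lambda>i\<in>{1..n}. x ((inv\<^bsub>sym_group n\<^esub> g) i))"

lemma perm_act_closed:
  assumes g: "g \<in> carrier (sym_group n)" and x: "x \<in> binary_cube n"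
  shows "perm_act n g x \<in> binary_cube n"
proof -
  have "inv' g permutes {1..n}"
    using g by (simp add: sym_group_carrier permutes_inv)
  then show ?thesis
    using x permutes_in_image[of "inv' g" "{1..n}"]
    unfolding perm_act_def sym_group_inv_equality[OF g] binary_cube_def
    by (auto simp: PiE_iff)
qed

lemma perm_act_mult:
  assumes g: "g \<in> carrier (sym_group n)" and h: "h \<in> carrier (sym_group n)"
    and x: "x \<in> binary_cube n"
  shows "perm_act n (g \<circ> h) x = perm_act n g (perm_act n h x)"
proof -
  have gp: "g permutes {1..n}" and hp: "h permutes {1..n}"
    using g h by (simp_all add: sym_group_carrier)
  have gh: "g \<circ> h \<in> carrier (sym_group n)"
    using gp hp by (simp add: sym_group_carrier permutes_compose)
  have "inv' (g \<circ> h) = inv' h \<circ> inv' g"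
    using gp hp by (simp add: o_inv_distrib permutes_bij)
  moreover have "inv' g permutes {1..n}"
    using gp by (rule permutes_inv)
  ultimately show ?thesis
    using x perm_act_closed[OF h x] permutes_in_image[of "inv' g" "{1..n}"]
    unfolding perm_act_def sym_group_inv_equality[OF g] sym_group_inv_equality[OF h]
      sym_group_inv_equality[OF gh]
    by (auto simp: fun_eq_iff restrict_def)
qed

lemma group_action_perm_act:
  "group_action (sym_group n) (binary_cube n) (perm_act n)"
proof -
  interpret G: group "sym_group n" by (rule sym_group_is_group)
  have idc: "id \<in> carrier (sym_group n)"
    by (simp add: sym_group_carrier permutes_id)
  have id_act: "perm_act n id x = x" if "x \<in> binary_cube n" for x
    using that unfolding perm_act_def sym_group_inv_equality[OF idc] binary_cube_def
    by (auto simp: fun_eq_iff PiE_def extensional_def)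
  have inv1: "perm_act n (inv' g) (perm_act n g x) = x"
    and inv2: "perm_act n g (perm_act n (inv' g) x) = x"
    if g: "g \<in> carrier (sym_group n)" and x: "x \<in> binary_cube n" for g x
  proof -
    have gp: "g permutes {1..n}" using g by (simp add: sym_group_carrier)
    note gi = sym_group_inv_closed[OF g]
    show "perm_act n (inv' g) (perm_act n g x) = x"
      using perm_act_mult[OF gi g x] id_act[OF x] permutes_inv_o(2)[OF gp] by simp
    show "perm_act n g (perm_act n (inv' g) x) = x"
      using perm_act_mult[OF g gi x] id_act[OF x] permutes_inv_o(1)[OF gp] by simp
  qed
  have bij: "perm_act n g \<in> Bij (binary_cube n)" if g: "g \<in> carrier (sym_group n)" for g
  proof -
    have "bij_betw (perm_act n g) (binary_cube n) (binary_cube n)"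
      by (rule bij_betw_byWitness[where f' = "perm_act n (inv' g)"])
        (use inv1[OF g] inv2[OF g] perm_act_closed[OF g]
          perm_act_closed[OF sym_group_inv_closed[OF g]] in auto)
    then show ?thesis by (simp add: Bij_def perm_act_def)
  qed
  show ?thesis
    unfolding group_action_def group_hom_def group_hom_axioms_def
  proof (intro conjI homI)
    show "perm_act n (g \<otimes>\<^bsub>sym_group n\<^esub> h)
        = perm_act n g \<otimes>\<^bsub>BijGroup (binary_cube n)\<^esub> perm_act n h"
      if "g \<in> carrier (sym_group n)" "h \<in> carrier (sym_group n)" for g h
    proof
      fix x
      show "perm_act n (g \<otimes>\<^bsub>sym_group n\<^esub> h) x
        = (perm_act n g \<otimes>\<^bsub>BijGroup (binary_cube n)\<^esub> perm_act n h) x"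
      proof (cases "x \<in> binary_cube n")
        case True
        then show ?thesis
          using that bij perm_act_mult[OF that True]
          by (simp add: BijGroup_def sym_group_mult compose_def)
      next
        case False
        then show ?thesis
          using that bij by (simp add: BijGroup_def compose_def perm_act_def)
      qed
    qed
  qed (use bij in \<open>auto simp: BijGroup_def sym_group_is_group group_BijGroup[unfolded BijGroup_def]\<close>)
qed


section \<open>Kernels on a finite set\<close>

fun kernel_pow :: "'a set \<Rightarrow> ('a \<Rightarrow> 'a \<Rightarrow> real) \<Rightarrow> nat \<Rightarrow> 'a \<Rightarrow> 'a \<Rightarrow> real"
  where
    "kernel_pow S K 0 g h = (if g = h then 1 else 0)"
  | "kernel_pow S K (Suc t) g h = (\<Sum>s\<in>S. K g s * kernel_pow S K t s h)"

definition tv_dist :: "'a set \<Rightarrow> ('a \<Rightarrow> real) \<Rightarrow> ('a \<Rightarrow> real) \<Rightarrow> real"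
  where "tv_dist S \<mu> \<nu> = 1 / 2 * (\<Sum>s\<in>S. \<bar>\<mu> s - \<nu> s\<bar>)"

text \<open>
  To use the matrix library, whose matrices are indexed by natural numbers, the
  state space is enumerated. By \<open>char_poly_kernel_mat_enum\<close> and
  \<open>spectrum_kernel_mat_enum\<close> below, neither the characteristic polynomial nor the
  spectrum depends on the enumeration chosen. The entries are taken in
  the complex numbers, so that all eigenvalues are accounted for.
\<close>

definition kernel_mat_enum :: "(nat \<Rightarrow> 'a) \<Rightarrow> 'a set \<Rightarrow> ('a \<Rightarrow> 'a \<Rightarrow> real) \<Rightarrow> complex mat"
  where "kernel_mat_enum e S K =
    mat (card S) (card S) (\<lambda>(i, j). complex_of_real (K (e i) (e j)))"

definition kernel_mat :: "'a set \<Rightarrow> ('a \<Rightarrow> 'a \<Rightarrow> real) \<Rightarrow> complex mat"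
  where "kernel_mat S K = kernel_mat_enum (SOME e. bij_betw e {..<card S} S) S K"

text \<open>Algebraic multiplicity: it is \<open>0\<close> iff \<open>z\<close> is not an eigenvalue.\<close>

definition alg_mult :: "complex mat \<Rightarrow> complex \<Rightarrow> nat"
  where "alg_mult A z = order z (char_poly A)"

lemma kernel_mat_enum_carrier: "kernel_mat_enum e S K \<in> carrier_mat (card S) (card S)"
  by (simp add: kernel_mat_enum_def)

lemma similar_kernel_mat_enum:
  assumes e: "bij_betw e {..<card S} S" and f: "bij_betw f {..<card S} S"
  shows "similar_mat (kernel_mat_enum e S K) (kernel_mat_enum f S K)"
proof -
  define N where "N = card S"
  define u where "u i = inv_into {..<N} f (e i)" for i
  have fb: "bij_betw f {..<N} S" and eb: "bij_betw e {..<N} S"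
    using e f by (simp_all add: N_def)
  have u: "u i < N" "f (u i) = e i" if "i < N" for i
  proof -
    have "e i \<in> f ` {..<N}"
      using that fb eb bij_betwE[OF eb] by (auto simp: bij_betw_imp_surj_on)
    then show "u i < N" "f (u i) = e i"
      unfolding u_def using inv_into_into[of "e i" f "{..<N}"] f_inv_into_f[of "e i" f "{..<N}"]
      by auto
  qed
  have u_inj: "u i = u j \<longleftrightarrow> i = j" if "i < N" "j < N" for i j
  proof
    assume "u i = u j"
    then have "e i = e j"
      using u(2)[OF that(1)] u(2)[OF that(2)] by simp
    then show "i = j"
      using that eb by (auto dest: bij_betw_imp_inj_on inj_onD)
  qed simp
  define P where "P = mat N N (\<lambda>(i, j). if j = u i then 1 else 0 :: complex)"
  define R where "R = mat N N (\<lambda>(i, j). if i = u j then 1 else 0 :: complex)"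
  let ?A = "kernel_mat_enum e S K" and ?B = "kernel_mat_enum f S K"
  have carr: "?A \<in> carrier_mat N N" "?B \<in> carrier_mat N N"
    "P \<in> carrier_mat N N" "R \<in> carrier_mat N N"
    by (simp_all add: kernel_mat_enum_def P_def R_def N_def)
  have PR: "P * R = 1\<^sub>m N"
  proof (rule eq_matI)
    fix i j assume ij: "i < dim_row (1\<^sub>m N)" "j < dim_col (1\<^sub>m N)"
    then have "(P * R) $$ (i, j) = (\<Sum>k<N. if k = u i then (if k = u j then 1 else 0) else 0)"
      by (simp add: P_def R_def scalar_prod_def lessThan_atLeast0 if_distrib cong: if_cong)
    also have "\<dots> = (if u i = u j then 1 else 0)"
      using ij u by (simp add: sum.delta)
    also have "\<dots> = (if i = j then 1 else 0)"
      using ij u_inj by simp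
    finally show "(P * R) $$ (i, j) = 1\<^sub>m N $$ (i, j)" using ij by simp
  qed (simp_all add: P_def R_def)
  then have RP: "R * P = 1\<^sub>m N"
    using mat_mult_left_right_inverse carr by blast
  have PB: "P * ?B = mat N N (\<lambda>(i, j). complex_of_real (K (e i) (f j)))"
  proof (rule eq_matI)
    fix i j assume ij: "i < dim_row (mat N N (\<lambda>(i, j). complex_of_real (K (e i) (f j))))"
      "j < dim_col (mat N N (\<lambda>(i, j). complex_of_real (K (e i) (f j))))"
    then have "(P * ?B) $$ (i, j)
        = (\<Sum>k<N. if k = u i then complex_of_real (K (f k) (f j)) else 0)"
      by (simp add: P_def kernel_mat_enum_def N_def[symmetric] scalar_prod_def
          lessThan_atLeast0 if_distrib[of "\<lambda>x. x * _"] cong: if_cong)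
    then show "(P * ?B) $$ (i, j)
        = mat N N (\<lambda>(i, j). complex_of_real (K (e i) (f j))) $$ (i, j)"
      using ij u by (simp add: sum.delta)
  qed (simp_all add: P_def kernel_mat_enum_def N_def)
  have "?A = P * ?B * R"
  proof (rule eq_matI)
    fix i j assume "i < dim_row (P * ?B * R)" "j < dim_col (P * ?B * R)"
    then have ij: "i < N" "j < N" by (simp_all add: P_def R_def)
    then have "(P * ?B * R) $$ (i, j)
        = (\<Sum>k<N. if k = u j then complex_of_real (K (e i) (f k)) else 0)"
      unfolding PB
      by (simp add: R_def scalar_prod_def
          lessThan_atLeast0 if_distrib[of "\<lambda>x. _ * x"] cong: if_cong)
    then show "?A $$ (i, j) = (P * ?B * R) $$ (i, j)"
      using ij u by (simp add: sum.delta kernel_mat_enum_def N_def[symmetric])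
  qed (simp_all add: P_def R_def kernel_mat_enum_def N_def)
  with carr PR RP have "similar_mat_wit ?A ?B P R"
    by (intro similar_mat_witI[of P R N]) auto
  then show ?thesis unfolding similar_mat_def by blast
qed

lemma char_poly_kernel_mat_enum:
  assumes "finite S" and e: "bij_betw e {..<card S} S"
  shows "char_poly (kernel_mat S K) = char_poly (kernel_mat_enum e S K)"
  unfolding kernel_mat_def
  using char_poly_similar[OF similar_kernel_mat_enum[OF someI[where P = "\<lambda>e. bij_betw e {..<card S} S", OF e] e]] .

lemma spectrum_kernel_mat_enum:
  assumes "finite S" and "bij_betw e {..<card S} S"
  shows "spectrum (kernel_mat S K) = spectrum (kernel_mat_enum e S K)"
proof -
  have "kernel_mat S K \<in> carrier_mat (card S) (card S)"
    unfolding kernel_mat_def by (rule kernel_mat_enum_carrier)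
  then show ?thesis
    using char_poly_kernel_mat_enum[OF assms, of K]
    by (simp only: spectrum_root_char_poly[of _ "card S"] kernel_mat_enum_carrier)
qed


section \<open>The dual Burnside process\<close>

definition dual_burnside ::
  "('g, 'm) monoid_scheme \<Rightarrow> 'x set \<Rightarrow> ('g \<Rightarrow> 'x \<Rightarrow> 'x) \<Rightarrow> 'g \<Rightarrow> 'g \<Rightarrow> real"
  where "dual_burnside G X \<phi> g h =
    1 / real (card (invariants X \<phi> g)) *
      (\<Sum>x \<in> invariants X \<phi> g \<inter> invariants X \<phi> h. 1 / real (card (stabilizer G \<phi> x)))"

definition Q_kernel :: "nat \<Rightarrow> (nat \<Rightarrow> nat) \<Rightarrow> (nat \<Rightarrow> nat) \<Rightarrow> real"
  where "Q_kernel n = dual_burnside (sym_group n) (binary_cube n) (perm_act n)"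

definition Q_mat :: "nat \<Rightarrow> complex mat"
  where "Q_mat n = kernel_mat (carrier (sym_group n)) (Q_kernel n)"

definition num_cycles :: "nat \<Rightarrow> (nat \<Rightarrow> nat) \<Rightarrow> nat"
  where "num_cycles n g = card ((\<lambda>i. Orbits.orbit g i) ` {1..n})"

definition pi_Q :: "nat \<Rightarrow> (nat \<Rightarrow> nat) \<Rightarrow> real"
  where "pi_Q n g = 2 ^ num_cycles n g / fact (n + 1)"

definition d_Q_from :: "nat \<Rightarrow> (nat \<Rightarrow> nat) \<Rightarrow> nat \<Rightarrow> real"
  where "d_Q_from n g t =
    tv_dist (carrier (sym_group n)) (kernel_pow (carrier (sym_group n)) (Q_kernel n) t g) (pi_Q n)"

definition d_Q :: "nat \<Rightarrow> nat \<Rightarrow> real"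
  where "d_Q n t = Max ((\<lambda>g. d_Q_from n g t) ` carrier (sym_group n))"

definition t_mix_from :: "nat \<Rightarrow> (nat \<Rightarrow> nat) \<Rightarrow> real \<Rightarrow> nat"
  where "t_mix_from n g \<epsilon> = (LEAST t. d_Q_from n g t \<le> \<epsilon>)"

definition t_mix :: "nat \<Rightarrow> real \<Rightarrow> nat"
  where "t_mix n \<epsilon> = (LEAST t. d_Q n t \<le> \<epsilon>)"

definition eig :: "nat \<Rightarrow> real"
  where "eig m = (real ((2 * m) choose m) / 2 ^ (2 * m)) ^ 2"

end

theory Submission
  imports Defs "HOL-Analysis.Gamma_Function"
begin

text \<open>
  Identify a binary word with the set \<open>Y\<close> of positions of its ones. The dual kernel factors as \<open>Q = AB\<close>,
  where \<open>A\<close> averages over the sets fixed by a permutation and \<open>B\<close> averages over the stabilizer of a set,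
  so \<open>Q\<close> has the same nonzero spectrum as the Burnside operator \<open>P = BA\<close> on functions of sets.
  Inserting the elements of the ground set one at a time (\<open>p \<mapsto> (a b) \<circ> p\<close>) gives
  \<open>P \<chi>\<^sub>T (Y) = m(|T \<inter> Y|) m(|T - Y|)\<close> for the Walsh functions \<open>\<chi>\<^sub>T\<close>, where \<open>m(2k) = C(2k, k) / 4^k\<close> and \<open>m\<close>
  vanishes on odd numbers. As this depends only on \<open>T \<inter> Y\<close>, \<open>P\<close> is triangular in the Walsh basis ordered by
  cardinality, with diagonal \<open>m(|T|)^2\<close>; this is the spectrum.

  \<open>P\<close> is self-adjoint for the orbit-uniform law \<open>\<pi>\<close>. Triangularity bounds the growth of \<open>P^t f\<close> for \<open>f\<close>
  orthogonal to the constants, and log-convexity of \<open>t \<mapsto> \<parallel>P^t f\<parallel>\<^sup>2\<close> turns this into \<open>\<parallel>P f\<parallel> \<le> \<parallel>f\<parallel> / 4\<close>. Together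
  with \<open>Q^(t+1) = A P^t B\<close> and Cauchy-Schwarz this gives the upper bounds. The lower bound uses the
  eigenfunction \<open>\<chi>\<^sub>T - 1/3\<close> with \<open>|T| = 2\<close>, of eigenvalue 1/4. For a long cycle the density of the start is
  expanded in discrete Chebyshev polynomials, whose squared norms are at least \<open>1 / (2d + 1)\<close>, so that two steps of \<open>P\<close>
  bring the \<open>L\<^sup>2\<close> distance below a constant independent of \<open>n\<close>.
\<close>

section \<open>Permutations preserving a set\<close>

text \<open>The obstacle is that two inner products are in play: Walsh functions are orthogonal for
  counting measure, whereas \<open>P\<close> is self-adjoint for the orbit-uniform law.
  Triangularity therefore yields eigenvalues but no orthonormal eigenbasis, and only a decay
  \<open>C * r ^ t\<close> with \<open>r > 1/4\<close> and \<open>C\<close> depending on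
  \<open>f\<close>. Log-convexity removes \<open>C\<close>: the ratios of consecutive squared norms
  never decrease, so a first ratio above 1/16 would persist for all times and outgrow that decay.

  The numbers \<open>m(k)\<close> have a probabilistic origin. Averaging a Walsh function of
  \<open>T\<close> over the sets fixed by \<open>p\<close> gives 0 if some cycle of \<open>p\<close>
  meets \<open>T\<close> in an odd number of points, and 1 otherwise; \<open>m(k)\<close> is the
  probability that a uniform permutation of \<open>k\<close> points has even cycles only.

  A long cycle fixes only the empty set and the whole ground set, so its starting density has
  squared norm of order \<open>n\<close>, and the gap alone would leave a factor
  \<open>sqrt n\<close>. That factor is removed by computing the effect of the first two steps
  exactly.\<close>

definition fixed_sets :: "'a set \<Rightarrow> ('a \<Rightarrow> 'a) \<Rightarrow> 'a set set" where
  "fixed_sets S p = {Y \<in> Pow S. \<forall>i\<in>S. p i \<in> Y \<longleftrightarrow> i \<in> Y}"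

text \<open>\<open>Z\<close> need not lie in \<open>S\<close>, so that it can stay the same while
  the ground set \<open>S\<close> grows point by point.\<close>

definition stab_perms :: "'a set \<Rightarrow> 'a set \<Rightarrow> ('a \<Rightarrow> 'a) set" where
  "stab_perms S Z = {p. p permutes S \<and> (\<forall>i\<in>S. p i \<in> Z \<longleftrightarrow> i \<in> Z)}"

definition walsh :: "'a set \<Rightarrow> 'a set \<Rightarrow> real" where
  "walsh T Y = (\<Prod>i\<in>T. if i \<in> Y then - 1 else 1)"

definition avg :: "'a set \<Rightarrow> ('a set \<Rightarrow> real) \<Rightarrow> ('a \<Rightarrow> 'a) \<Rightarrow> real" where
  "avg S f p = (\<Sum>Y\<in>fixed_sets S p. f Y) / card (fixed_sets S p)"

text \<open>\<open>P\<close> applied to a Walsh function, before division by the order of the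
  stabilizer; without that denominator the insertion recursions are clean.\<close>

definition stab_sum :: "'a set \<Rightarrow> 'a set \<Rightarrow> 'a set \<Rightarrow> real" where
  "stab_sum S Z T = (\<Sum>p\<in>stab_perms S Z. avg S (walsh T) p)"

section \<open>Fixed sets and stabilizers under insertion of one point\<close>

lemma finite_fixed_sets [simp]: "finite S \<Longrightarrow> finite (fixed_sets S p)"
  by (simp add: fixed_sets_def)

lemma empty_in_fixed_sets [simp]: "{} \<in> fixed_sets S p"
  by (simp add: fixed_sets_def)

lemma card_fixed_sets_pos [simp]: "finite S \<Longrightarrow> 0 < card (fixed_sets S p)"
  by (metis card_gt_0_iff empty_iff empty_in_fixed_sets finite_fixed_sets)

lemma fixed_sets_nonempty [simp]: "fixed_sets S p \<noteq> {}"
  using empty_in_fixed_sets by blast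

text \<open>Here \<open>p\<close> fixes \<open>a\<close>, so \<open>{a}\<close> is a cycle of its
  own and membership of \<open>a\<close> is free.\<close>

lemma fixed_sets_insert_same:
  assumes "a \<notin> S" "p permutes S"
  shows "fixed_sets (insert a S) p = fixed_sets S p \<union> insert a ` fixed_sets S p"
proof -
  have pa: "p a = a" using assms by (auto dest: permutes_not_in)
  have pS: "p i \<in> S" if "i \<in> S" for i using assms that by (simp add: permutes_in_image)
  have "Y \<in> fixed_sets S p \<union> insert a ` fixed_sets S p" if Y: "Y \<in> fixed_sets (insert a S) p" for Y
  proof -
    have *: "Y - {a} \<in> fixed_sets S p"
      using Y assms(1) pS unfolding fixed_sets_def by auto
    show ?thesis
    proof (cases "a \<in> Y")
      case True
      then have "Y = insert a (Y - {a})" by auto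
      with * show ?thesis by blast
    qed (use * in simp)
  qed
  moreover have "fixed_sets S p \<union> insert a ` fixed_sets S p \<subseteq> fixed_sets (insert a S) p"
    using assms(1) pa pS by (auto simp: fixed_sets_def)
  ultimately show ?thesis by blast
qed

text \<open>The composite splices \<open>a\<close> into the cycle of \<open>b\<close>, directly
  before \<open>b\<close>, so membership of \<open>a\<close> is dictated by
  \<open>b\<close>.\<close>

lemma fixed_sets_insert_transpose:
  assumes "a \<notin> S" "p permutes S" "b \<in> S"
  shows "fixed_sets (insert a S) (Transposition.transpose a b \<circ> p) = (\<lambda>Y. if b \<in> Y then insert a Y else Y) ` fixed_sets S p"
proof -
  have pa: "p a = a" using assms by (auto dest: permutes_not_in)
  have pS: "p i \<in> S" if "i \<in> S" for i using assms that by (simp add: permutes_in_image)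
  have pna: "p i \<noteq> a" if "i \<in> S" for i using pS[OF that] assms(1) by auto
  have "Y \<in> (\<lambda>Y. if b \<in> Y then insert a Y else Y) ` fixed_sets S p"
    if Y: "Y \<in> fixed_sets (insert a S) (Transposition.transpose a b \<circ> p)" for Y
  proof -
    have ab: "b \<in> Y \<longleftrightarrow> a \<in> Y" and Ysub: "Y \<subseteq> insert a S"
      using Y pa by (auto simp: fixed_sets_def)
    have "p i \<in> Y - {a} \<longleftrightarrow> i \<in> Y - {a}" if i: "i \<in> S" for i
    proof (cases "p i = b")
      case True
      then have "a \<in> Y \<longleftrightarrow> i \<in> Y" using Y i by (auto simp: fixed_sets_def)
      then show ?thesis using True ab i assms by auto
    next
      case False
      then have "p i \<in> Y \<longleftrightarrow> i \<in> Y"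
        using Y i pna[OF i] by (auto simp: fixed_sets_def Transposition.transpose_def)
      then show ?thesis using i pna[OF i] assms(1) by auto
    qed
    then have "Y - {a} \<in> fixed_sets S p" using Ysub by (auto simp: fixed_sets_def)
    moreover have "Y = (if b \<in> Y - {a} then insert a (Y - {a}) else Y - {a})"
      using ab assms by auto
    ultimately show ?thesis by (rule rev_image_eqI)
  qed
  moreover have "(if b \<in> Y then insert a Y else Y) \<in> fixed_sets (insert a S) (Transposition.transpose a b \<circ> p)"
    if Y: "Y \<in> fixed_sets S p" for Y
    using Y assms(1,3) pa pS pna by (auto simp: fixed_sets_def Transposition.transpose_def)
  ultimately show ?thesis by blast
qed

lemma notin_fixed_sets: "a \<notin> S \<Longrightarrow> Y \<in> fixed_sets S p \<Longrightarrow> a \<notin> Y"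
  by (auto simp: fixed_sets_def)

lemma card_fixed_sets_insert_same:
  assumes "finite S" "a \<notin> S" "p permutes S"
  shows "card (fixed_sets (insert a S) p) = 2 * card (fixed_sets S p)"
proof -
  have "inj_on (insert a) (fixed_sets S p)"
    using notin_fixed_sets[OF assms(2)] by (intro inj_onI) (metis insert_ident)
  moreover have "fixed_sets S p \<inter> insert a ` fixed_sets S p = {}"
    using notin_fixed_sets[OF assms(2)] by blast
  ultimately show ?thesis
    using assms by (simp add: fixed_sets_insert_same card_Un_disjoint card_image)
qed

lemma sum_fixed_sets_insert_same:
  assumes "finite S" "a \<notin> S" "p permutes S"
  shows "(\<Sum>Y\<in>fixed_sets (insert a S) p. f Y) = (\<Sum>Y\<in>fixed_sets S p. f Y + f (insert a Y))"
proof -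
  have "inj_on (insert a) (fixed_sets S p)"
    using notin_fixed_sets[OF assms(2)] by (intro inj_onI) (metis insert_ident)
  moreover have "fixed_sets S p \<inter> insert a ` fixed_sets S p = {}"
    using notin_fixed_sets[OF assms(2)] by blast
  ultimately show ?thesis
    using assms by (simp add: fixed_sets_insert_same sum.union_disjoint sum.reindex sum.distrib)
qed

lemma inj_on_fixed_sets_transpose:
  assumes "a \<notin> S"
  shows "inj_on (\<lambda>Y. if b \<in> Y then insert a Y else Y) (fixed_sets S p)"
proof (rule inj_onI)
  fix Y Z assume YZ: "Y \<in> fixed_sets S p" "Z \<in> fixed_sets S p"
    and eq: "(if b \<in> Y then insert a Y else Y) = (if b \<in> Z then insert a Z else Z)"
  have "a \<notin> Y" "a \<notin> Z" using YZ notin_fixed_sets[OF assms] by blast+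
  then show "Y = Z" using eq by (auto split: if_splits)
qed

lemma card_fixed_sets_insert_transpose:
  assumes "a \<notin> S" "p permutes S" "b \<in> S"
  shows "card (fixed_sets (insert a S) (Transposition.transpose a b \<circ> p)) = card (fixed_sets S p)"
  unfolding fixed_sets_insert_transpose[OF assms]
  by (rule card_image[OF inj_on_fixed_sets_transpose[OF assms(1)]])

lemma sum_fixed_sets_insert_transpose:
  assumes "a \<notin> S" "p permutes S" "b \<in> S"
  shows "(\<Sum>Y\<in>fixed_sets (insert a S) (Transposition.transpose a b \<circ> p). f Y)
    = (\<Sum>Y\<in>fixed_sets S p. f (if b \<in> Y then insert a Y else Y))"
  unfolding fixed_sets_insert_transpose[OF assms]
  by (simp only: sum.reindex[OF inj_on_fixed_sets_transpose[OF assms(1)]] o_def)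

lemma walsh_insert:
  assumes "finite T" "a \<notin> T"
  shows "walsh (insert a T) Y = (if a \<in> Y then - walsh T Y else walsh T Y)"
  using assms by (simp add: walsh_def)

lemma walsh_insert_arg: "a \<notin> T \<Longrightarrow> walsh T (insert a Y) = walsh T Y"
  unfolding walsh_def by (rule prod.cong) auto

text \<open>The composite sends \<open>a\<close> to \<open>b\<close>, so it can preserve
  \<open>Z\<close> only if both lie on the same side; the transposition then preserves
  \<open>Z\<close> as well and drops out.\<close>

lemma stab_perms_insert_iff:
  assumes "a \<notin> S" "p permutes S" "b \<in> insert a S"
  shows "Transposition.transpose a b \<circ> p \<in> stab_perms (insert a S) Z \<longleftrightarrow> p \<in> stab_perms S Z \<and> (b \<in> Z \<longleftrightarrow> a \<in> Z)"
proof -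
  have pa: "p a = a" using assms by (auto dest: permutes_not_in)
  have pS: "p i \<in> S" if "i \<in> S" for i using assms that by (simp add: permutes_in_image)
  have pna: "p i \<noteq> a" if "i \<in> S" for i using pS[OF that] assms(1) by auto
  have perm: "Transposition.transpose a b \<circ> p permutes insert a S"
    using assms by (intro permutes_compose permutes_swap_id) (auto intro: permutes_subset)
  show ?thesis
  proof
    assume *: "Transposition.transpose a b \<circ> p \<in> stab_perms (insert a S) Z"
    then have ab: "b \<in> Z \<longleftrightarrow> a \<in> Z" using pa by (auto simp: stab_perms_def)
    have "p i \<in> Z \<longleftrightarrow> i \<in> Z" if i: "i \<in> S" for i
    proof -
      have "Transposition.transpose a b (p i) \<in> Z \<longleftrightarrow> i \<in> Z" using * i by (auto simp: stab_perms_def)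
      then show ?thesis using ab pna[OF i] by (auto simp: Transposition.transpose_def split: if_splits)
    qed
    with ab assms(2) show "p \<in> stab_perms S Z \<and> (b \<in> Z \<longleftrightarrow> a \<in> Z)" by (auto simp: stab_perms_def)
  next
    assume "p \<in> stab_perms S Z \<and> (b \<in> Z \<longleftrightarrow> a \<in> Z)"
    with perm pa show "Transposition.transpose a b \<circ> p \<in> stab_perms (insert a S) Z"
      by (auto simp: stab_perms_def Transposition.transpose_def)
  qed
qed

lemma sum_stab_perms_insert:
  assumes "finite S" "a \<notin> S"
  shows "(\<Sum>p\<in>stab_perms (insert a S) Z. f p)
    = (\<Sum>b\<in>{b \<in> insert a S. b \<in> Z \<longleftrightarrow> a \<in> Z}. \<Sum>p\<in>stab_perms S Z. f (Transposition.transpose a b \<circ> p))"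
proof -
  \<comment> \<open>Sums are extended by zero to all permutations, where
    \<open>(a b) \<circ> p\<close> parametrizes the permutations of the larger set.\<close>
  have filt: "(\<Sum>p\<in>stab_perms U Z. h p) = (\<Sum>p | p permutes U. if p \<in> stab_perms U Z then h p else 0)"
    if "finite U" for U and h :: "_ \<Rightarrow> 'b"
    by (rule sum.mono_neutral_cong_left) (use that in \<open>auto simp: finite_permutations stab_perms_def\<close>)
  have "(\<Sum>p\<in>stab_perms (insert a S) Z. f p)
    = (\<Sum>p | p permutes insert a S. if p \<in> stab_perms (insert a S) Z then f p else 0)"
    using assms by (intro filt) simp
  also have "\<dots> = (\<Sum>b\<in>insert a S. \<Sum>p | p permutes S.
      if Transposition.transpose a b \<circ> p \<in> stab_perms (insert a S) Z then f (Transposition.transpose a b \<circ> p) else 0)"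
    by (rule sum_over_permutations_insert) (use assms in auto)
  also have "\<dots> = (\<Sum>b\<in>insert a S. if b \<in> Z \<longleftrightarrow> a \<in> Z then
      (\<Sum>p | p permutes S. if p \<in> stab_perms S Z then f (Transposition.transpose a b \<circ> p) else 0) else 0)"
    using assms by (intro sum.cong refl) (auto simp: stab_perms_insert_iff cong: if_cong intro!: sum.cong sum.neutral)
  also have "\<dots> = (\<Sum>b\<in>{b \<in> insert a S. b \<in> Z \<longleftrightarrow> a \<in> Z}.
      \<Sum>p | p permutes S. if p \<in> stab_perms S Z then f (Transposition.transpose a b \<circ> p) else 0)"
    using assms by (subst sum.inter_filter) auto
  also have "\<dots> = (\<Sum>b\<in>{b \<in> insert a S. b \<in> Z \<longleftrightarrow> a \<in> Z}. \<Sum>p\<in>stab_perms S Z. f (Transposition.transpose a b \<circ> p))"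
    using assms by (simp add: filt)
  finally show ?thesis .
qed

text \<open>No insertion changes the average of a Walsh function blind to \<open>a\<close>: a new
  fixed point doubles numerator and denominator, and splicing changes neither. Only the number of
  admissible images of \<open>a\<close> remains.\<close>

lemma stab_sum_insert:
  assumes "finite S" "a \<notin> S" "T \<subseteq> S"
  shows "stab_sum (insert a S) Z T = real (card {b \<in> insert a S. b \<in> Z \<longleftrightarrow> a \<in> Z}) * stab_sum S Z T"
proof -
  have aT: "a \<notin> T" using assms by auto
  have "avg (insert a S) (walsh T) (Transposition.transpose a b \<circ> p) = avg S (walsh T) p"
    if b: "b \<in> insert a S" and p: "p \<in> stab_perms S Z" for b p
  proof (cases "b = a")
    case True
    have pp: "p permutes S" using p by (simp add: stab_perms_def)
    have "(\<Sum>Y\<in>fixed_sets (insert a S) p. walsh T Y) = 2 * (\<Sum>Y\<in>fixed_sets S p. walsh T Y)"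
      using sum_fixed_sets_insert_same[OF assms(1,2) pp, of "walsh T"]
      by (simp add: walsh_insert_arg[OF aT] sum_distrib_left flip: mult_2)
    then show ?thesis
      using True card_fixed_sets_insert_same[OF assms(1,2) pp] by (simp add: avg_def)
  next
    case False
    have pp: "p permutes S" using p by (simp add: stab_perms_def)
    from False b have bS: "b \<in> S" by simp
    have "walsh T (if b \<in> Y then insert a Y else Y) = walsh T Y" for Y
      by (simp add: walsh_insert_arg[OF aT])
    then show ?thesis
      using sum_fixed_sets_insert_transpose[OF assms(2) pp bS, of "walsh T"]
        card_fixed_sets_insert_transpose[OF assms(2) pp bS] by (simp add: avg_def)
  qed
  then have "stab_sum (insert a S) Z T
      = (\<Sum>b\<in>{b \<in> insert a S. b \<in> Z \<longleftrightarrow> a \<in> Z}. stab_sum S Z T)"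
    unfolding stab_sum_def sum_stab_perms_insert[OF assms(1,2)] by (intro sum.cong) auto
  then show ?thesis by simp
qed

text \<open>If \<open>a\<close> is a new fixed point, the contributions of \<open>Y\<close> and
  \<open>insert a Y\<close> cancel. If \<open>a\<close> is spliced in before \<open>b\<close>, the
  signs of \<open>a\<close> and \<open>b\<close> agree and multiply to 1, so both leave the index
  set.\<close>

lemma stab_sum_insert_both:
  assumes "finite S" "a \<notin> S"
  shows "stab_sum (insert a S) Z (insert a S)
    = (\<Sum>b\<in>{b \<in> S. b \<in> Z \<longleftrightarrow> a \<in> Z}. stab_sum S Z (S - {b}))"
proof -
  have eqa: "avg (insert a S) (walsh (insert a S)) (Transposition.transpose a a \<circ> p) = 0"
    if p: "p \<in> stab_perms S Z" for p
  proof -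
    have pp: "p permutes S" using p by (simp add: stab_perms_def)
    have "walsh (insert a S) Y + walsh (insert a S) (insert a Y) = 0" if "Y \<in> fixed_sets S p" for Y
      using notin_fixed_sets[OF assms(2) that] assms by (simp add: walsh_insert walsh_insert_arg)
    then have "(\<Sum>Y\<in>fixed_sets (insert a S) p. walsh (insert a S) Y) = 0"
      using sum_fixed_sets_insert_same[OF assms pp, of "walsh (insert a S)"] by simp
    then show ?thesis by (simp add: avg_def)
  qed
  have neq: "avg (insert a S) (walsh (insert a S)) (Transposition.transpose a b \<circ> p) = avg S (walsh (S - {b})) p"
    if b: "b \<in> S" and p: "p \<in> stab_perms S Z" for b p
  proof -
    have pp: "p permutes S" using p by (simp add: stab_perms_def)
    have "walsh (insert a S) (if b \<in> Y then insert a Y else Y) = walsh (S - {b}) Y"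
      if "Y \<in> fixed_sets S p" for Y
    proof -
      have "walsh S Y = (if b \<in> Y then - walsh (S - {b}) Y else walsh (S - {b}) Y)"
        using walsh_insert[of "S - {b}" b Y] b assms(1) by (simp add: insert_absorb)
      then show ?thesis
        using notin_fixed_sets[OF assms(2) that] assms by (simp add: walsh_insert walsh_insert_arg)
    qed
    then show ?thesis
      using sum_fixed_sets_insert_transpose[OF assms(2) pp b, of "walsh (insert a S)"]
        card_fixed_sets_insert_transpose[OF assms(2) pp b] by (simp add: avg_def)
  qed
  have split: "{b \<in> insert a S. b \<in> Z \<longleftrightarrow> a \<in> Z} = insert a {b \<in> S. b \<in> Z \<longleftrightarrow> a \<in> Z}"
    by auto
  show ?thesis
    unfolding stab_sum_def sum_stab_perms_insert[OF assms] split
    using assms eqa neq by (subst sum.insert) (auto intro!: sum.cong)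
qed

text \<open>For even \<open>k\<close> this is the square of the double factorial
  \<open>(k - 1)!!\<close>, the number of permutations of \<open>k\<close> points with even cycles
  only.\<close>

fun even_sum :: "nat \<Rightarrow> real" where
  "even_sum 0 = 1"
| "even_sum (Suc 0) = 0"
| "even_sum (Suc (Suc k)) = (real (Suc k))\<^sup>2 * even_sum k"

lemma stab_sum_empty [simp]: "stab_sum {} (Z :: 'a set) {} = 1"
proof -
  have "stab_perms {} Z = {id :: 'a \<Rightarrow> 'a}" by (auto simp: stab_perms_def)
  moreover have "fixed_sets {} (id :: 'a \<Rightarrow> 'a) = {{}}" by (auto simp: fixed_sets_def)
  ultimately show ?thesis by (simp add: stab_sum_def avg_def walsh_def)
qed

text \<open>Each step removes two points on the same side of \<open>Z\<close>: first
  \<open>a\<close>, paired with some \<open>b\<close> in \<open>C\<close>, and then \<open>b\<close>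
  itself, which no longer belongs to the index set. Each removal contributes a factor
  \<open>card C\<close>, whence the square in \<open>even_sum\<close>.\<close>

lemma stab_sum_self:
  assumes "finite T"
  shows "stab_sum T Z T = even_sum (card (T \<inter> Z)) * even_sum (card (T - Z))"
  using assms
proof (induction "card T" arbitrary: T rule: less_induct)
  case less
  show ?case
  proof (cases "T = {}")
    case True
    then show ?thesis by simp
  next
    case False
    then obtain a S where T: "T = insert a S" "a \<notin> S" by (meson ex_in_conv mk_disjoint_insert)
    have fS: "finite S" using less.prems T by simp
    define C where "C = {b \<in> S. b \<in> Z \<longleftrightarrow> a \<in> Z}"
    define D where "D = {b \<in> S. b \<in> Z \<longleftrightarrow> a \<notin> Z}"
    have fC: "finite C" "finite D" using fS by (auto simp: C_def D_def)
    have step: "stab_sum S Z (S - {b}) = real (card C) * (even_sum (card C - 1) * even_sum (card D))"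
      if b: "b \<in> C" for b
    proof -
      have bS: "b \<in> S" using b by (simp add: C_def)
      have Sb: "S = insert b (S - {b})" using bS by auto
      have "stab_sum S Z (S - {b}) = real (card {b' \<in> S. b' \<in> Z \<longleftrightarrow> b \<in> Z}) * stab_sum (S - {b}) Z (S - {b})"
        using stab_sum_insert[of "S - {b}" b "S - {b}" Z] fS bS by (simp add: insert_absorb)
      also have "{b' \<in> S. b' \<in> Z \<longleftrightarrow> b \<in> Z} = C" using b by (auto simp: C_def)
      also have "stab_sum (S - {b}) Z (S - {b})
          = even_sum (card ((S - {b}) \<inter> Z)) * even_sum (card ((S - {b}) - Z))"
        using bS fS T by (intro less.hyps) (auto intro: psubset_card_mono)
      also have "\<dots> = even_sum (card C - 1) * even_sum (card D)"
      proof (cases "a \<in> Z")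
        case True
        then have "(S - {b}) \<inter> Z = C - {b}" "(S - {b}) - Z = D"
          using b by (auto simp: C_def D_def)
        then show ?thesis using b fC by simp
      next
        case False
        then have "(S - {b}) \<inter> Z = D" "(S - {b}) - Z = C - {b}"
          using b by (auto simp: C_def D_def)
        then show ?thesis using b fC by simp
      qed
      finally show ?thesis .
    qed
    have "stab_sum T Z T = (\<Sum>b\<in>C. real (card C) * (even_sum (card C - 1) * even_sum (card D)))"
      unfolding T(1) stab_sum_insert_both[OF fS T(2)] C_def[symmetric]
      using step by (intro sum.cong) auto
    also have "\<dots> = (real (card C))\<^sup>2 * even_sum (card C - 1) * even_sum (card D)"
      by (simp add: power2_eq_square)
    \<comment> \<open>If \<open>C\<close> is empty, both sides vanish because
      \<open>even_sum 1 = 0\<close>; this also takes care of the truncated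
      \<open>card C - 1\<close>.\<close>
    also have "\<dots> = even_sum (Suc (card C)) * even_sum (card D)"
      by (cases "card C") auto
    also have "\<dots> = even_sum (card (T \<inter> Z)) * even_sum (card (T - Z))"
    proof (cases "a \<in> Z")
      case True
      then have "T \<inter> Z = insert a C" "T - Z = D" "a \<notin> C"
        using T by (auto simp: C_def D_def)
      then show ?thesis using fC by simp
    next
      case False
      then have "T \<inter> Z = D" "T - Z = insert a C" "a \<notin> C"
        using T by (auto simp: C_def D_def)
      then show ?thesis using fC by simp
    qed
    finally show ?thesis .
  qed
qed

text \<open>The probability that a uniform permutation of \<open>k\<close> points has even cycles
  only.\<close>

definition even_moment :: "nat \<Rightarrow> real" where
  "even_moment k = even_sum k / fact k"

text \<open>The points outside \<open>T\<close> are adjoined one at a time. Each multiplies the sum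
  by the number of points on its side of \<open>Z\<close>, itself included, and so builds up the two
  factorials.\<close>

lemma stab_sum_eq:
  assumes "finite S" "T \<subseteq> S"
  shows "stab_sum S Z T = even_moment (card (T \<inter> Z)) * even_moment (card (T - Z))
    * fact (card (S \<inter> Z)) * fact (card (S - Z))"
proof -
  have fT: "finite T" using assms finite_subset by blast
  have "finite R \<Longrightarrow> R \<inter> T = {} \<Longrightarrow> stab_sum (T \<union> R) Z T
    = even_moment (card (T \<inter> Z)) * even_moment (card (T - Z))
      * fact (card ((T \<union> R) \<inter> Z)) * fact (card ((T \<union> R) - Z))" for R
  proof (induction rule: finite_induct)
    case empty
    then show ?case using fT by (simp add: stab_sum_self even_moment_def)
  next
    case (insert a R)
    let ?S = "T \<union> R"
    have a: "a \<notin> ?S" and fS: "finite ?S" using insert fT by auto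
    have "stab_sum (insert a ?S) Z T = real (card {b \<in> insert a ?S. b \<in> Z \<longleftrightarrow> a \<in> Z}) * stab_sum ?S Z T"
      by (rule stab_sum_insert) (use a fS in auto)
    also have "real (card {b \<in> insert a ?S. b \<in> Z \<longleftrightarrow> a \<in> Z}) * stab_sum ?S Z T
      = even_moment (card (T \<inter> Z)) * even_moment (card (T - Z))
      * fact (card ((insert a ?S) \<inter> Z)) * fact (card ((insert a ?S) - Z))"
    proof (cases "a \<in> Z")
      case True
      have "{b \<in> insert a ?S. b \<in> Z \<longleftrightarrow> a \<in> Z} = insert a (?S \<inter> Z)"
        "insert a ?S \<inter> Z = insert a (?S \<inter> Z)" "insert a ?S - Z = ?S - Z"
        using True by auto
      moreover have "a \<notin> ?S \<inter> Z" "finite (?S \<inter> Z)" using a fS by auto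
      ultimately show ?thesis using insert by simp
    next
      case False
      have "{b \<in> insert a ?S. b \<in> Z \<longleftrightarrow> a \<in> Z} = insert a (?S - Z)"
        "insert a ?S \<inter> Z = ?S \<inter> Z" "insert a ?S - Z = insert a (?S - Z)"
        using False by auto
      moreover have "a \<notin> ?S - Z" "finite (?S - Z)" using a fS by auto
      ultimately show ?thesis using insert by simp
    qed
    finally show ?case by simp
  qed
  from this[of "S - T"] show ?thesis
    using assms by (simp add: Un_absorb1 finite_subset Int_commute)
qed

text \<open>This is the case \<open>T = {}\<close> of \<open>stab_sum_eq\<close>, where every
  average is 1.\<close>

lemma card_stab_perms:
  assumes "finite S"
  shows "card (stab_perms S Z) = fact (card (S \<inter> Z)) * fact (card (S - Z))"
proof -
  have "avg S (walsh {}) p = 1" for p :: "'a \<Rightarrow> 'a"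
    using assms card_fixed_sets_pos[OF assms, of p] by (simp add: avg_def walsh_def)
  then have "real (card (stab_perms S Z)) = real (fact (card (S \<inter> Z)) * fact (card (S - Z)))"
    using stab_sum_eq[OF assms, of "{}" Z]
    by (simp add: stab_sum_def even_moment_def)
  then show ?thesis by (simp only: of_nat_eq_iff)
qed

lemma even_moment_odd: "odd k \<Longrightarrow> even_moment k = 0"
  by (induction k rule: even_sum.induct) (auto simp: even_moment_def)

lemma central_binomial_Suc:
  "real ((2 * Suc m) choose Suc m)
    = 2 * (2 * real m + 1) / (real m + 1) * real ((2 * m) choose m)"
proof -
  have 1: "real ((2 * Suc m) choose Suc m) = fact (2 * Suc m) / (fact (Suc m) * fact (Suc m))"
    by (subst binomial_fact) auto
  have 2: "real ((2 * m) choose m) = fact (2 * m) / (fact m * fact m)"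
    by (subst binomial_fact) auto
  have 3: "fact (2 * Suc m) = 2 * (real m + 1) * (2 * real m + 1) * fact (2 * m)"
    by (simp add: algebra_simps)
  have 4: "fact (Suc m) = (real m + 1) * fact m" by simp
  show ?thesis
    unfolding 1 2 3 4 by (simp add: divide_simps) (simp add: algebra_simps)
qed

lemma even_moment_Suc:
  "even_moment (2 * Suc m) = (2 * real m + 1) / (2 * (real m + 1)) * even_moment (2 * m)"
proof -
  have "even_moment (2 * Suc m) = (2 * real m + 1)\<^sup>2 * even_sum (2 * m)
      / ((2 * (real m + 1)) * ((2 * real m + 1) * fact (2 * m)))"
    by (simp add: even_moment_def algebra_simps)
  then show ?thesis
    by (simp add: even_moment_def power2_eq_square divide_simps)
qed

lemma even_moment_even: "even_moment (2 * m) = real ((2 * m) choose m) / 4 ^ m"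
proof (induction m)
  case (Suc m)
  show ?case
    unfolding even_moment_Suc Suc central_binomial_Suc
    by (simp add: divide_simps) (simp add: algebra_simps)
qed (simp add: even_moment_def)

lemma eig_even_moment: "eig m = (even_moment (2 * m))\<^sup>2"
  by (simp add: eig_def even_moment_even power_mult)

section \<open>Walsh functions and the Burnside operator\<close>

lemma sum_Pow_card:
  fixes h :: "nat \<Rightarrow> real"
  assumes "finite S"
  shows "(\<Sum>Z\<in>Pow S. h (card Z)) = (\<Sum>j\<le>card S. real (card S choose j) * h j)"
proof -
  have "(\<Sum>Z\<in>Pow S. h (card Z)) = (\<Sum>j\<le>card S. \<Sum>Z | Z \<in> Pow S \<and> card Z = j. h (card Z))"
    using assms by (intro sum.group[symmetric]) (auto intro: card_mono)
  also have "\<dots> = (\<Sum>j\<le>card S. real (card S choose j) * h j)"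
    using n_subsets[OF assms] by (intro sum.cong) (auto simp: Pow_def)
  finally show ?thesis .
qed

lemma sum_Pow_remove:
  fixes F :: "'a set \<Rightarrow> real"
  assumes "finite N" "i \<in> N"
  shows "(\<Sum>Y\<in>Pow N. F Y) = (\<Sum>Y\<in>Pow (N - {i}). F Y + F (insert i Y))"
proof -
  have "Pow N = Pow (N - {i}) \<union> insert i ` Pow (N - {i})"
    using assms(2) Pow_insert[of i "N - {i}"] by (simp add: insert_absorb)
  moreover have "Pow (N - {i}) \<inter> insert i ` Pow (N - {i}) = {}" by auto
  moreover have "inj_on (insert i) (Pow (N - {i}))" by (intro inj_onI) blast
  ultimately show ?thesis
    using assms(1) by (simp add: sum.union_disjoint sum.reindex sum.distrib)
qed

lemma sum_Pow_Int:
  fixes G :: "'a set \<Rightarrow> real"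
  assumes "finite N" "S \<subseteq> N"
  shows "(\<Sum>Y\<in>Pow N. G (Y \<inter> S)) = 2 ^ (card N - card S) * (\<Sum>Z\<in>Pow S. G Z)"
proof -
  have "(\<Sum>Y\<in>Pow N. G (Y \<inter> S)) = (\<Sum>(Z, R)\<in>Pow S \<times> Pow (N - S). G Z)"
    by (rule sum.reindex_bij_witness[where j = "\<lambda>Y. (Y \<inter> S, Y - S)" and i = "\<lambda>(Z, R). Z \<union> R"])
      (use assms in auto)
  also have "\<dots> = (\<Sum>Z\<in>Pow S. real (card (Pow (N - S))) * G Z)"
    by (simp add: sum.cartesian_product[symmetric])
  also have "card (Pow (N - S)) = 2 ^ (card N - card S)"
    using assms by (simp add: card_Pow card_Diff_subset finite_subset)
  finally show ?thesis by (simp add: sum_distrib_left)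
qed

lemma sum_even_only:
  fixes g :: "nat \<Rightarrow> real"
  assumes "\<And>j. odd j \<Longrightarrow> g j = 0"
  shows "(\<Sum>j\<le>2 * m. g j) = (\<Sum>i\<le>m. g (2 * i))"
  by (induction m) (use assms in auto)

text \<open>Each summand is the central binomial over \<open>4 ^ m\<close> times the square of
  \<open>m choose i\<close>, so Vandermonde's identity produces a second central binomial.\<close>

lemma even_moment_convolution_even:
  "(\<Sum>i\<le>m. real ((2 * m) choose (2 * i)) * even_moment (2 * i) * even_moment (2 * m - 2 * i))
    = 4 ^ m * (even_moment (2 * m))\<^sup>2"
proof -
  have "real ((2 * m) choose (2 * i)) * even_moment (2 * i) * even_moment (2 * m - 2 * i)
      = real ((2 * m) choose m) / 4 ^ m * (real (m choose i))\<^sup>2" if i: "i \<le> m" for i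
  proof -
    have 1: "2 * m - 2 * i = 2 * (m - i)" by simp
    have p: "(4 :: real) ^ i * 4 ^ (m - i) = 4 ^ m"
      using i by (simp flip: power_add)
    have 2: "real ((2 * m) choose (2 * i)) = fact (2 * m) / (fact (2 * i) * fact (2 * (m - i)))"
      using i by (subst binomial_fact) (auto simp: 1)
    have 3: "real ((2 * k) choose k) = fact (2 * k) / (fact k * fact k)" for k
      by (subst binomial_fact) auto
    have 4: "real (m choose i) = fact m / (fact i * fact (m - i))"
      using i by (subst binomial_fact) auto
    show ?thesis
      unfolding 1 even_moment_even 2 3 4 p[symmetric]
      by (simp add: power2_eq_square divide_simps)
  qed
  then have "(\<Sum>i\<le>m. real ((2 * m) choose (2 * i)) * even_moment (2 * i) * even_moment (2 * m - 2 * i))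
      = real ((2 * m) choose m) / 4 ^ m * (\<Sum>i\<le>m. (real (m choose i))\<^sup>2)"
    by (simp add: sum_distrib_left)
  also have "(\<Sum>i\<le>m. (real (m choose i))\<^sup>2) = real ((2 * m) choose m)"
    unfolding choose_square_sum[symmetric] by simp
  finally show ?thesis
    by (simp add: even_moment_even power2_eq_square)
qed

text \<open>The left side will be the diagonal coefficient of \<open>burnside\<close> at a set of
  size \<open>s\<close>, with \<open>(- 1) ^ j\<close> the Walsh sign of a set meeting it in
  \<open>j\<close> points. The sign is harmless, since odd \<open>j\<close> contribute
  nothing.\<close>

lemma even_moment_convolution:
  "(\<Sum>j\<le>s. real (s choose j) * ((- 1) ^ j * even_moment j * even_moment (s - j)))
    = 2 ^ s * (even_moment s)\<^sup>2"
proof (cases "even s")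
  case True
  then obtain m where s: "s = 2 * m" by (auto elim: evenE)
  have "(\<Sum>j\<le>s. real (s choose j) * ((- 1) ^ j * even_moment j * even_moment (s - j)))
    = (\<Sum>i\<le>m. real ((2 * m) choose (2 * i)) * ((- 1) ^ (2 * i) * even_moment (2 * i) * even_moment (2 * m - 2 * i)))"
    unfolding s by (rule sum_even_only) (simp add: even_moment_odd)
  also have "\<dots> = 4 ^ m * (even_moment (2 * m))\<^sup>2"
    using even_moment_convolution_even[of m] by (simp add: mult.assoc)
  finally show ?thesis by (simp add: s power_mult)
next
  case False
  have "even_moment j * even_moment (s - j) = 0" if "j \<le> s" for j
    using False that by (cases "even j") (auto simp: even_moment_odd)
  then show ?thesis using False by (auto simp: even_moment_odd mult.assoc intro!: sum.neutral)
qed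

lemma walsh_power: "finite T \<Longrightarrow> walsh T Y = (- 1) ^ card (T \<inter> Y)"
  by (simp add: walsh_def prod.If_cases Int_def)

lemma walsh_commute: "finite S \<Longrightarrow> finite T \<Longrightarrow> walsh S T = walsh T S"
  by (simp add: walsh_power Int_commute)

lemma walsh_square [simp]: "walsh S Y * walsh S Y = 1"
  unfolding walsh_def prod.distrib[symmetric] by (rule prod.neutral) auto

lemma walsh_insert_member:
  assumes "finite S" "i \<in> S" "i \<notin> Y"
  shows "walsh S (insert i Y) = - walsh S Y"
proof -
  have "S \<inter> insert i Y = insert i (S \<inter> Y)" using assms by auto
  then show ?thesis using assms by (simp add: walsh_power)
qed

locale finite_ground =
  fixes N :: "'a set"
  assumes fin [simp]: "finite N"
begin

text \<open>Coefficients are taken with respect to counting measure, for which Walsh functions are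
  orthogonal, and not with respect to \<open>weight\<close> below.\<close>

definition fourier :: "('a set \<Rightarrow> real) \<Rightarrow> 'a set \<Rightarrow> real" where
  "fourier f S = (\<Sum>Y\<in>Pow N. f Y * walsh S Y) / 2 ^ card N"

lemma finite_sub [simp]: "S \<subseteq> N \<Longrightarrow> finite S"
  using finite_subset fin by blast

text \<open>Pair \<open>Y\<close> with \<open>insert i Y\<close>: the Walsh function changes sign
  and \<open>f\<close> does not. Orthogonality, triangularity and all degree bounds rest on this
  cancellation.\<close>

lemma fourier_local:
  assumes S: "S \<subseteq> N" "i \<in> S" and f: "\<And>Y. Y \<subseteq> N - {i} \<Longrightarrow> f (insert i Y) = f Y"
  shows "fourier f S = 0"
proof -
  have iN: "i \<in> N" using S by auto
  have "f Y * walsh S Y + f (insert i Y) * walsh S (insert i Y) = 0" if Y: "Y \<in> Pow (N - {i})" for Y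
  proof -
    have "walsh S (insert i Y) = - walsh S Y"
      using Y S by (intro walsh_insert_member) auto
    then show ?thesis using f[of Y] Y by simp
  qed
  then have "(\<Sum>Y\<in>Pow N. f Y * walsh S Y) = 0"
    unfolding sum_Pow_remove[OF fin iN] by (intro sum.neutral) blast
  then show ?thesis by (simp add: fourier_def)
qed

lemma walsh_orthogonal:
  assumes S: "S \<subseteq> N" and T: "T \<subseteq> N"
  shows "(\<Sum>Y\<in>Pow N. walsh S Y * walsh T Y) = (if S = T then 2 ^ card N else 0)"
proof (cases "S = T")
  case True
  then show ?thesis by (simp add: card_Pow)
next
  case False
  have *: "(\<Sum>Y\<in>Pow N. walsh S Y * walsh T Y) = 0"
    if "S \<subseteq> N" "T \<subseteq> N" "i \<in> T" "i \<notin> S" for i S T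
    using fourier_local[OF that(2,3), of "walsh S"] walsh_insert_arg[OF that(4)]
    by (simp add: fourier_def)
  from False consider i where "i \<in> T" "i \<notin> S" | i where "i \<in> S" "i \<notin> T" by blast
  then show ?thesis
  proof cases
    case 1
    then show ?thesis using *[OF S T] False by simp
  next
    case 2
    then show ?thesis using *[OF T S] False by (simp add: mult.commute)
  qed
qed

lemma walsh_orthogonal':
  assumes Y: "Y \<subseteq> N" and Z: "Z \<subseteq> N"
  shows "(\<Sum>S\<in>Pow N. walsh S Y * walsh S Z) = (if Y = Z then 2 ^ card N else 0)"
proof -
  have "(\<Sum>S\<in>Pow N. walsh S Y * walsh S Z) = (\<Sum>S\<in>Pow N. walsh Y S * walsh Z S)"
    using assms by (intro sum.cong refl) (simp add: walsh_commute)
  then show ?thesis using walsh_orthogonal[OF assms] by simp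
qed

lemma fourier_inversion:
  assumes Y: "Y \<subseteq> N"
  shows "f Y = (\<Sum>S\<in>Pow N. fourier f S * walsh S Y)"
proof -
  have "(\<Sum>S\<in>Pow N. fourier f S * walsh S Y)
      = (\<Sum>S\<in>Pow N. \<Sum>Z\<in>Pow N. f Z * (walsh S Z * walsh S Y) / 2 ^ card N)"
    unfolding fourier_def by (simp add: sum_distrib_right sum_divide_distrib mult.assoc)
  also have "\<dots> = (\<Sum>Z\<in>Pow N. \<Sum>S\<in>Pow N. f Z * (walsh S Z * walsh S Y) / 2 ^ card N)"
    by (rule sum.swap)
  also have "\<dots> = (\<Sum>Z\<in>Pow N. f Z * (\<Sum>S\<in>Pow N. walsh S Z * walsh S Y) / 2 ^ card N)"
    by (simp add: sum_distrib_left sum_divide_distrib)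
  also have "\<dots> = (\<Sum>Z\<in>Pow N. if Z = Y then f Z else 0)"
    using Y by (intro sum.cong refl) (simp add: walsh_orthogonal')
  also have "\<dots> = f Y" using Y by (simp add: sum.delta)
  finally show ?thesis by simp
qed

lemma fourier_linear: "fourier (\<lambda>Y. a * f Y + b * g Y) S = a * fourier f S + b * fourier g S"
  by (simp add: fourier_def sum.distrib sum_distrib_left algebra_simps add_divide_distrib)

lemma fourier_sum: "fourier (\<lambda>Y. \<Sum>i\<in>I. c i * f i Y) S = (\<Sum>i\<in>I. c i * fourier (f i) S)"
proof -
  have "(\<Sum>Y\<in>Pow N. (\<Sum>i\<in>I. c i * f i Y) * walsh S Y)
    = (\<Sum>i\<in>I. c i * (\<Sum>Y\<in>Pow N. f i Y * walsh S Y))"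
    by (simp add: sum_distrib_right sum_distrib_left mult.assoc) (rule sum.swap)
  then show ?thesis
    unfolding fourier_def by (simp only: sum_divide_distrib[of _ I] times_divide_eq_right)
qed

lemma fourier_cong: "(\<And>Y. Y \<subseteq> N \<Longrightarrow> f Y = g Y) \<Longrightarrow> fourier f S = fourier g S"
  by (simp add: fourier_def)

section \<open>The averaging operators and their composite\<close>

definition stab_avg :: "(('a \<Rightarrow> 'a) \<Rightarrow> real) \<Rightarrow> 'a set \<Rightarrow> real" where
  "stab_avg \<phi> Y = (\<Sum>p\<in>stab_perms N Y. \<phi> p) / card (stab_perms N Y)"

definition burnside :: "('a set \<Rightarrow> real) \<Rightarrow> 'a set \<Rightarrow> real" where
  "burnside f = stab_avg (avg N f)"

lemma card_stab_perms_pos [simp]: "0 < card (stab_perms N Y)"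
  by (simp add: card_stab_perms)

lemma avg_cong: "(\<And>Y. Y \<subseteq> N \<Longrightarrow> f Y = g Y) \<Longrightarrow> avg N f p = avg N g p"
  unfolding avg_def by (simp add: fixed_sets_def)

lemma burnside_cong: "(\<And>Y. Y \<subseteq> N \<Longrightarrow> f Y = g Y) \<Longrightarrow> burnside f = burnside g"
  unfolding burnside_def by (simp add: stab_avg_def avg_cong[of f g] fun_eq_iff)

lemma avg_linear: "avg N (\<lambda>Y. a * f Y + b * g Y) p = a * avg N f p + b * avg N g p"
  by (simp add: avg_def sum.distrib add_divide_distrib flip: sum_distrib_left)

lemma stab_avg_linear: "stab_avg (\<lambda>p. a * \<phi> p + b * \<psi> p) Y = a * stab_avg \<phi> Y + b * stab_avg \<psi> Y"
  by (simp add: stab_avg_def sum.distrib add_divide_distrib flip: sum_distrib_left)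

lemma burnside_linear: "burnside (\<lambda>Y. a * f Y + b * g Y) Y = a * burnside f Y + b * burnside g Y"
  unfolding burnside_def avg_linear[abs_def] by (rule stab_avg_linear)

lemma burnside_const [simp]: "burnside (\<lambda>_. c) Y = c"
  using card_stab_perms_pos[of Y] by (simp add: burnside_def stab_avg_def avg_def card_gt_0_iff)

lemma burnside_sum:
  assumes "finite I"
  shows "burnside (\<lambda>Y. \<Sum>i\<in>I. c i * f i Y) Y = (\<Sum>i\<in>I. c i * burnside (f i) Y)"
  using assms
proof (induction rule: finite_induct)
  case (insert i I)
  then show ?case using burnside_linear[of "c i" "f i" 1 "\<lambda>Y. \<Sum>i\<in>I. c i * f i Y" Y] by simp
qed simp

lemma burnside_walsh:
  assumes "T \<subseteq> N"
  shows "burnside (walsh T) Y = even_moment (card (T \<inter> Y)) * even_moment (card (T - Y))"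
  using stab_sum_eq[OF fin assms, of Y] by (simp add: burnside_def stab_avg_def stab_sum_def card_stab_perms)

definition walsh_eigval :: "nat \<Rightarrow> real" where
  "walsh_eigval k = (even_moment k)\<^sup>2"

lemma fourier_burnside_walsh_zero:
  assumes "S \<subseteq> N" "T \<subseteq> N" "\<not> T \<subseteq> S"
  shows "fourier (burnside (walsh S)) T = 0"
proof -
  obtain i where i: "i \<in> T" "i \<notin> S" using assms by blast
  have "S \<inter> insert i Y = S \<inter> Y" "S - insert i Y = S - Y" for Y using i by auto
  then show ?thesis
    using assms i by (intro fourier_local[of T i]) (simp_all add: burnside_walsh)
qed

text \<open>The product of \<open>walsh S\<close> with its image depends only on the size of
  \<open>Y \<inter> S\<close>, which reduces the coefficient to
  \<open>even_moment_convolution\<close>.\<close>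

lemma fourier_burnside_walsh_self:
  assumes S: "S \<subseteq> N"
  shows "fourier (burnside (walsh S)) S = walsh_eigval (card S)"
proof -
  have fS: "finite S" using S by simp
  have "(\<Sum>Y\<in>Pow N. burnside (walsh S) Y * walsh S Y)
    = (\<Sum>Y\<in>Pow N. (\<lambda>Z. (- 1) ^ card Z * even_moment (card Z) * even_moment (card S - card Z)) (Y \<inter> S))"
  proof (intro sum.cong refl)
    fix Y
    have "card (S - Y) = card S - card (Y \<inter> S)"
      using fS by (simp add: card_Diff_subset_Int Int_commute)
    then show "burnside (walsh S) Y * walsh S Y
      = (\<lambda>Z. (- 1) ^ card Z * even_moment (card Z) * even_moment (card S - card Z)) (Y \<inter> S)"
      using fS S by (simp add: burnside_walsh walsh_power Int_commute)
  qed
  also have "\<dots> = 2 ^ (card N - card S) * (2 ^ card S * walsh_eigval (card S))"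
    unfolding walsh_eigval_def even_moment_convolution[symmetric] sum_Pow_card[OF fS, symmetric]
    by (rule sum_Pow_Int[OF fin S])
  also have "\<dots> = 2 ^ card N * walsh_eigval (card S)"
    using card_mono[OF fin S] by (simp flip: power_add mult.assoc)
  finally show ?thesis by (simp add: fourier_def)
qed

text \<open>The orbits are the levels of constant cardinality; each of the \<open>card N + 1\<close>
  levels receives the same total mass.\<close>

definition weight :: "'a set \<Rightarrow> real" where
  "weight Y = 1 / (real (card N + 1) * real (card N choose card Y))"

definition ip :: "('a set \<Rightarrow> real) \<Rightarrow> ('a set \<Rightarrow> real) \<Rightarrow> real" where
  "ip f g = (\<Sum>Y\<in>Pow N. weight Y * f Y * g Y)"

text \<open>The orbit-stabilizer relation: \<open>weight\<close> is exactly what cancels the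
  denominator of \<open>stab_avg\<close>.\<close>

lemma weight_eq_card_stab_perms:
  assumes "Y \<subseteq> N"
  shows "weight Y = real (card (stab_perms N Y)) / fact (card N + 1)"
proof -
  have 1: "card (N \<inter> Y) = card Y" "card (N - Y) = card N - card Y"
    using assms by (simp_all add: Int_absorb1 card_Diff_subset)
  have "card Y \<le> card N" using assms by (simp add: card_mono)
  then have 2: "real (card N choose card Y) = fact (card N) / (fact (card Y) * fact (card N - card Y))"
    by (simp add: binomial_fact)
  show ?thesis
    unfolding card_stab_perms[OF fin] 1 weight_def 2 by simp
qed

lemma weight_pos: "Y \<subseteq> N \<Longrightarrow> 0 < weight Y"
  by (simp add: weight_def card_mono)

lemma ip_commute: "ip f g = ip g f"
  by (simp add: ip_def mult_ac)

lemma ip_linear: "ip (\<lambda>Y. a * f Y + b * g Y) h = a * ip f h + b * ip g h"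
  by (simp add: ip_def sum.distrib sum_distrib_left algebra_simps)

lemma ip_sum: "ip (\<lambda>Y. \<Sum>i\<in>I. c i * f i Y) h = (\<Sum>i\<in>I. c i * ip (f i) h)"
proof -
  have "ip (\<lambda>Y. \<Sum>i\<in>I. c i * f i Y) h = (\<Sum>Y\<in>Pow N. \<Sum>i\<in>I. c i * (weight Y * f i Y * h Y))"
    unfolding ip_def by (simp add: sum_distrib_left sum_distrib_right mult_ac)
  also have "\<dots> = (\<Sum>i\<in>I. c i * ip (f i) h)"
    unfolding ip_def by (subst sum.swap) (simp add: sum_distrib_left)
  finally show ?thesis .
qed

lemma ip_cong:
  "(\<And>Y. Y \<subseteq> N \<Longrightarrow> f Y = f' Y) \<Longrightarrow> (\<And>Y. Y \<subseteq> N \<Longrightarrow> g Y = g' Y) \<Longrightarrow> ip f g = ip f' g'"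
  by (simp add: ip_def)

lemma ip_nonneg: "0 \<le> ip f f"
  unfolding ip_def using weight_pos by (intro sum_nonneg) (simp add: less_imp_le mult.assoc)

lemma ip_eq_0:
  assumes "ip f f = 0" "Y \<subseteq> N"
  shows "f Y = 0"
proof -
  have "\<forall>Y\<in>Pow N. weight Y * f Y * f Y = 0"
    using assms(1) weight_pos unfolding ip_def
    by (subst (asm) sum_nonneg_eq_0_iff) (auto simp: less_imp_le mult.assoc)
  then show ?thesis using assms(2) weight_pos[of Y] by force
qed

lemma ip_Cauchy_Schwarz: "(ip f g)\<^sup>2 \<le> ip f f * ip g g"
proof (cases "ip g g = 0")
  case True
  then have "ip f g = 0" using ip_eq_0[OF True] by (simp add: ip_def)
  then show ?thesis using True by simp
next
  case False
  define h where "h = (\<lambda>Y. ip g g * f Y + (- ip f g) * g Y)"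
  have h: "ip h k = ip g g * ip f k - ip f g * ip g k" for k
    unfolding h_def ip_linear by simp
  have "ip h h = ip g g * (ip f f * ip g g - (ip f g)\<^sup>2)"
    by (simp add: h ip_commute[of f h] ip_commute[of g h] ip_commute[of g f] power2_eq_square algebra_simps)
  then have "0 \<le> ip g g * (ip f f * ip g g - (ip f g)\<^sup>2)"
    using ip_nonneg[of h] by simp
  moreover have "0 < ip g g" using False ip_nonneg[of g] by simp
  ultimately show ?thesis by (simp add: zero_le_mult_iff)
qed

lemma fixed_sets_subset: "Y \<in> fixed_sets N p \<Longrightarrow> Y \<subseteq> N"
  by (simp add: fixed_sets_def)

lemma fixed_sets_iff_stab_perms: "p permutes N \<Longrightarrow> Y \<subseteq> N \<Longrightarrow> Y \<in> fixed_sets N p \<longleftrightarrow> p \<in> stab_perms N Y"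
  by (auto simp: fixed_sets_def stab_perms_def)

text \<open>Once \<open>weight\<close> has cancelled the stabilizer order, what is left is a sum
  over all pairs of a permutation and a set fixed by it, which may be summed in either order. Both
  self-adjointness and the stationary law come from this identity.\<close>

lemma ip_stab_avg: "ip (stab_avg \<phi>) g = (\<Sum>p | p permutes N. \<phi> p * (\<Sum>Y\<in>fixed_sets N p. g Y)) / fact (card N + 1)"
proof -
  have fp: "finite {p. p permutes N}" by (simp add: finite_permutations)
  have "ip (stab_avg \<phi>) g = (\<Sum>Y\<in>Pow N. (\<Sum>p\<in>stab_perms N Y. \<phi> p * g Y) / fact (card N + 1))"
    unfolding ip_def
  proof (intro sum.cong refl)
    fix Y assume "Y \<in> Pow N"
    then show "weight Y * stab_avg \<phi> Y * g Y = (\<Sum>p\<in>stab_perms N Y. \<phi> p * g Y) / fact (card N + 1)"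
      using card_stab_perms_pos[of Y] by (simp add: weight_eq_card_stab_perms stab_avg_def sum_distrib_right)
  qed
  also have "\<dots> = (\<Sum>Y\<in>Pow N. \<Sum>p | p permutes N. if p \<in> stab_perms N Y then \<phi> p * g Y else 0) / fact (card N + 1)"
    unfolding sum_divide_distrib[symmetric]
    by (intro arg_cong2[where f = "(/)"] sum.cong refl sum.mono_neutral_cong_left)
      (auto simp: fp stab_perms_def)
  also have "\<dots> = (\<Sum>p | p permutes N. \<Sum>Y\<in>Pow N. if p \<in> stab_perms N Y then \<phi> p * g Y else 0) / fact (card N + 1)"
    by (subst sum.swap) simp
  also have "\<dots> = (\<Sum>p | p permutes N. \<Sum>Y\<in>fixed_sets N p. \<phi> p * g Y) / fact (card N + 1)"
  proof (rule arg_cong2[where f = "(/)", OF sum.cong[OF refl] refl])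
    fix p assume "p \<in> {p. p permutes N}"
    then show "(\<Sum>Y\<in>Pow N. if p \<in> stab_perms N Y then \<phi> p * g Y else 0) = (\<Sum>Y\<in>fixed_sets N p. \<phi> p * g Y)"
      by (intro sum.mono_neutral_cong_right) (auto simp: fixed_sets_iff_stab_perms dest: fixed_sets_subset, auto simp: fixed_sets_def stab_perms_def)
  qed
  finally show ?thesis by (simp add: sum_distrib_left)
qed

text \<open>For \<open>avg N f\<close> in place of \<open>\<phi>\<close> the summand of
  \<open>ip_stab_avg\<close> is the product of the sums of \<open>f\<close> and of \<open>g\<close>
  over the fixed sets, divided by their number, hence symmetric.\<close>

lemma burnside_self_adjoint: "ip (burnside f) g = ip f (burnside g)"
proof -
  have "ip (burnside f) g = (\<Sum>p | p permutes N. avg N f p * (\<Sum>Y\<in>fixed_sets N p. g Y)) / fact (card N + 1)" for f g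
    unfolding burnside_def by (rule ip_stab_avg)
  then show ?thesis
    by (simp add: ip_commute[of f] avg_def mult.commute)
qed

end

section \<open>Spectral gap\<close>

lemma eig_Suc: "eig (Suc m) = ((2 * real m + 1) / (2 * (real m + 1)))\<^sup>2 * eig m"
  unfolding eig_even_moment even_moment_Suc by (simp only: power_mult_distrib)

lemma eig_0 [simp]: "eig 0 = 1"
  by (simp add: eig_def)

lemma eig_pos: "0 < eig m"
  by (simp add: eig_def)

lemma eig_Suc_less: "eig (Suc m) < eig m"
proof -
  have "((2 * real m + 1) / (2 * (real m + 1)))\<^sup>2 < 1"
    by (subst power_less_one_iff) (simp_all add: divide_less_eq)
  then show ?thesis unfolding eig_Suc using eig_pos[of m] by simp
qed

lemma eig_strict_antimono: "i < j \<Longrightarrow> eig j < eig i"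
  using lift_Suc_mono_less[of "\<lambda>m. - eig m" i j] eig_Suc_less by simp

lemma eig_inj: "eig i = eig j \<longleftrightarrow> i = j"
  using eig_strict_antimono[of i j] eig_strict_antimono[of j i] by (cases i j rule: linorder_cases) auto

lemma eig_le_quarter: "0 < m \<Longrightarrow> eig m \<le> 1 / 4"
proof (induction m)
  case (Suc m)
  show ?case
  proof (cases "m = 0")
    case True
    then show ?thesis by (simp add: eig_Suc power_divide)
  next
    case False
    then show ?thesis using Suc eig_Suc_less[of m] by simp
  qed
qed simp

context finite_ground
begin

lemma walsh_eigval_even: "walsh_eigval (2 * m) = eig m"
  by (simp add: walsh_eigval_def eig_even_moment)

lemma walsh_eigval_odd: "odd k \<Longrightarrow> walsh_eigval k = 0"
  by (simp add: walsh_eigval_def even_moment_odd)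

lemma walsh_eigval_0 [simp]: "walsh_eigval 0 = 1"
  by (simp add: walsh_eigval_def even_moment_def)

lemma walsh_eigval_nonneg [simp]: "0 \<le> walsh_eigval k"
  by (simp add: walsh_eigval_def)

lemma walsh_eigval_le_quarter:
  assumes "0 < k"
  shows "walsh_eigval k \<le> 1 / 4"
proof (cases "even k")
  case True
  then have "k = 2 * (k div 2)" by simp
  with assms show ?thesis using walsh_eigval_even[of "k div 2"] eig_le_quarter[of "k div 2"] by simp
qed (simp add: walsh_eigval_odd)

text \<open>Degree as a multilinear polynomial in the membership indicators.\<close>

definition deg :: "nat \<Rightarrow> ('a set \<Rightarrow> real) \<Rightarrow> bool" where
  "deg d f \<longleftrightarrow> (\<forall>S\<subseteq>N. d < card S \<longrightarrow> fourier f S = 0)"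

lemma deg_card: "deg (card N) f"
  unfolding deg_def using card_mono[OF fin] by (metis not_less)

lemma fourier_burnside:
  assumes "T \<subseteq> N"
  shows "fourier (burnside f) T = (\<Sum>S\<in>Pow N. fourier f S * fourier (burnside (walsh S)) T)"
proof -
  have "burnside f = burnside (\<lambda>Y. \<Sum>S\<in>Pow N. fourier f S * walsh S Y)"
    by (rule burnside_cong) (rule fourier_inversion)
  also have "\<dots> = (\<lambda>Y. \<Sum>S\<in>Pow N. fourier f S * burnside (walsh S) Y)"
    by (rule ext) (simp add: burnside_sum)
  finally show ?thesis by (simp add: fourier_sum)
qed

lemma deg_burnside:
  assumes "deg d f"
  shows "deg d (burnside f)"
  unfolding deg_def
proof (intro allI impI)
  fix T assume T: "T \<subseteq> N" "d < card T"
  have "fourier f S * fourier (burnside (walsh S)) T = 0" if S: "S \<subseteq> N" for S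
  proof (cases "T \<subseteq> S")
    case True
    then have "d < card S" using T S card_mono[of S T] by simp
    then show ?thesis using assms S by (simp add: deg_def)
  next
    case False
    then show ?thesis using S T by (simp add: fourier_burnside_walsh_zero)
  qed
  then show "fourier (burnside f) T = 0" using T by (subst fourier_burnside) (auto intro!: sum.neutral)
qed

lemma fourier_burnside_top:
  assumes f: "deg (card T) f" and T: "T \<subseteq> N"
  shows "fourier (burnside f) T = walsh_eigval (card T) * fourier f T"
proof -
  have "fourier f S * fourier (burnside (walsh S)) T = (if S = T then walsh_eigval (card T) * fourier f T else 0)"
    if S: "S \<in> Pow N" for S
  proof (cases "T \<subset> S")
    case True
    then have "card T < card S" using S by (simp add: psubset_card_mono)
    then show ?thesis using f S True by (auto simp: deg_def)
  next
    case False
    then show ?thesis using S T by (cases "S = T") (auto simp: fourier_burnside_walsh_zero fourier_burnside_walsh_self)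
  qed
  then show ?thesis using T by (subst fourier_burnside) (simp_all add: sum.delta)
qed

text \<open>On coefficients of the top size \<open>burnside\<close> acts as the scalar
  \<open>walsh_eigval (Suc d)\<close>, because larger sets are absent and triangularity excludes all
  others.\<close>

lemma deg_burnside_step:
  assumes "deg (Suc d) f"
  shows "deg d (\<lambda>Y. burnside f Y - walsh_eigval (Suc d) * f Y)"
  unfolding deg_def
proof (intro allI impI)
  fix T assume T: "T \<subseteq> N" "d < card T"
  have lin: "fourier (\<lambda>Y. burnside f Y - walsh_eigval (Suc d) * f Y) T = fourier (burnside f) T - walsh_eigval (Suc d) * fourier f T"
    using fourier_linear[of 1 "burnside f" "- walsh_eigval (Suc d)" f T] by simp
  show "fourier (\<lambda>Y. burnside f Y - walsh_eigval (Suc d) * f Y) T = 0"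
  proof (cases "card T = Suc d")
    case True
    then show ?thesis using fourier_burnside_top[of T f] assms T lin by simp
  next
    case False
    then have "Suc d < card T" using T by simp
    then show ?thesis using assms deg_burnside[OF assms] T lin by (simp add: deg_def)
  qed
qed

section \<open>Iterates of the operator and the norm bound\<close>

lemma burnside_pow_linear:
  "(burnside ^^ t) (\<lambda>Y. a * f Y + b * g Y) = (\<lambda>Y. a * (burnside ^^ t) f Y + b * (burnside ^^ t) g Y)"
proof (induction t)
  case (Suc t)
  have "burnside (\<lambda>Y. a * (burnside ^^ t) f Y + b * (burnside ^^ t) g Y)
    = (\<lambda>Y. a * burnside ((burnside ^^ t) f) Y + b * burnside ((burnside ^^ t) g) Y)"
    by (rule ext) (rule burnside_linear)
  with Suc show ?case by simp
qed simp

lemma burnside_one: "burnside (\<lambda>_. c) = (\<lambda>_. c)"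
  by (rule ext) (rule burnside_const)

lemma burnside_pow_one: "(burnside ^^ t) (\<lambda>_. 1) = (\<lambda>_. 1)"
  by (induction t) (simp_all add: burnside_one)

lemma burnside_pow_cong:
  assumes "\<And>Y. Y \<subseteq> N \<Longrightarrow> f Y = g Y" and "Y \<subseteq> N"
  shows "(burnside ^^ t) f Y = (burnside ^^ t) g Y"
  using assms(2)
proof (induction t arbitrary: Y)
  case 0
  then show ?case using assms(1) by simp
next
  case (Suc t)
  have "burnside ((burnside ^^ t) f) = burnside ((burnside ^^ t) g)"
    by (rule burnside_cong) (rule Suc.IH)
  then show ?case by simp
qed

lemma burnside_pow_self_adjoint: "ip ((burnside ^^ t) f) g = ip f ((burnside ^^ t) g)"
proof (induction t arbitrary: g)
  case (Suc t)
  have "ip ((burnside ^^ Suc t) f) g = ip ((burnside ^^ t) f) (burnside g)" by (simp add: burnside_self_adjoint)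
  also have "\<dots> = ip f ((burnside ^^ Suc t) g)" using Suc[of "burnside g"] by (simp add: funpow_swap1)
  finally show ?case .
qed simp

lemma sum_weight_card: "(\<Sum>Y\<in>Pow N. weight Y * h (card Y)) = (\<Sum>j\<le>card N. h j) / (real (card N) + 1)"
proof -
  have "(\<Sum>Y\<in>Pow N. weight Y * h (card Y))
      = (\<Sum>j\<le>card N. real (card N choose j) * (1 / (real (card N + 1) * real (card N choose j)) * h j))"
    unfolding weight_def by (rule sum_Pow_card[OF fin])
  also have "\<dots> = (\<Sum>j\<le>card N. h j / (real (card N) + 1))"
    by (intro sum.cong refl) (simp add: divide_simps)
  finally show ?thesis by (simp add: sum_divide_distrib)
qed

lemma sum_weight: "(\<Sum>Y\<in>Pow N. weight Y) = 1"
  using sum_weight_card[of "\<lambda>_. 1"] by simp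

lemma ip_one_one [simp]: "ip (\<lambda>_. 1) (\<lambda>_. 1) = 1"
  by (simp add: ip_def sum_weight)

lemma ip_burnside_one: "ip (burnside f) (\<lambda>_. 1) = ip f (\<lambda>_. 1)"
  by (simp add: burnside_self_adjoint burnside_one)

text \<open>By induction on the degree: subtracting the top eigenvalue lowers the degree and keeps
  the mean 0, and iterates of \<open>f\<close> satisfy a linear recursion driven by those of the
  remainder. At degree 0 the function is constant with mean 0. The rate must exceed 1/4 strictly,
  because \<open>r - l\<close> appears as a denominator.\<close>

lemma burnside_pow_decay:
  assumes r: "1 / 4 < r" and "deg d f" and "ip f (\<lambda>_. 1) = 0"
  shows "\<exists>C\<ge>0. \<forall>t. \<forall>Y\<subseteq>N. \<bar>(burnside ^^ t) f Y\<bar> \<le> C * r ^ t"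
  using assms(2,3)
proof (induction d arbitrary: f)
  case 0
  have c: "f Y = fourier f {}" if Y: "Y \<subseteq> N" for Y
  proof -
    have "f Y = (\<Sum>S\<in>Pow N. fourier f S * walsh S Y)" by (rule fourier_inversion[OF Y])
    also have "\<dots> = (\<Sum>S\<in>Pow N. if S = {} then fourier f {} else 0)"
    proof (intro sum.cong refl)
      fix S assume S: "S \<in> Pow N"
      show "fourier f S * walsh S Y = (if S = {} then fourier f {} else 0)"
      proof (cases "S = {}")
        case False
        then have "0 < card S" using S by (simp add: card_gt_0_iff)
        then show ?thesis using "0.prems"(1) S False by (simp add: deg_def)
      qed (simp add: walsh_def)
    qed
    finally show ?thesis by (simp add: sum.delta)
  qed
  have "ip f (\<lambda>_. 1) = ip (\<lambda>Y. fourier f {} * (\<lambda>_. 1) Y + 0 * (\<lambda>_. 1) Y) (\<lambda>_. 1)"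
    by (rule ip_cong) (simp_all add: c)
  also have "\<dots> = fourier f {}" by (subst ip_linear) simp
  finally have "f Y = 0" if "Y \<subseteq> N" for Y using c[OF that] "0.prems"(2) by simp
  then have "(burnside ^^ t) f Y = (burnside ^^ t) (\<lambda>_. 0) Y" if "Y \<subseteq> N" for t Y
    using that by (intro burnside_pow_cong) auto
  moreover have "(burnside ^^ t) (\<lambda>_. 0) = (\<lambda>_. 0)" for t
    by (induction t) (simp_all add: burnside_one)
  ultimately show ?case by (intro exI[of _ 0]) simp
next
  case (Suc d)
  define l where "l = walsh_eigval (Suc d)"
  have l: "0 \<le> l" "l < r" using walsh_eigval_le_quarter[of "Suc d"] r by (simp_all add: l_def)
  define g where "g = (\<lambda>Y. burnside f Y - l * f Y)"
  have "ip g (\<lambda>_. 1) = 0"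
    using ip_linear[of 1 "burnside f" "- l" f "\<lambda>_. 1"] Suc.prems(2) by (simp add: g_def ip_burnside_one)
  then obtain C where C: "0 \<le> C" "\<And>t Y. Y \<subseteq> N \<Longrightarrow> \<bar>(burnside ^^ t) g Y\<bar> \<le> C * r ^ t"
    using Suc.IH[of g] deg_burnside_step[OF Suc.prems(1)] unfolding g_def l_def by blast
  \<comment> \<open>The first summand bounds \<open>f\<close> itself, for time 0; the second makes
    \<open>C \<le> D * (r - l)\<close>, which is what carries the bound from \<open>t\<close> to
    \<open>Suc t\<close>.\<close>
  define D where "D = (\<Sum>Y\<in>Pow N. \<bar>f Y\<bar>) + C / (r - l)"
  have D1: "\<bar>f Y\<bar> \<le> D" if "Y \<subseteq> N" for Y
    using member_le_sum[of Y "Pow N" "\<lambda>Y. \<bar>f Y\<bar>"] that C(1) l unfolding D_def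
    by (simp add: add_increasing2)
  have "0 \<le> (\<Sum>Y\<in>Pow N. \<bar>f Y\<bar>)" by (simp add: sum_nonneg)
  then have D0: "0 \<le> D" and "C / (r - l) \<le> D"
    using l C(1) by (simp_all add: D_def)
  then have D2: "C \<le> D * (r - l)" using l by (simp add: pos_divide_le_eq)
  have "\<bar>(burnside ^^ t) f Y\<bar> \<le> D * r ^ t" if "Y \<subseteq> N" for t Y
    using that
  proof (induction t arbitrary: Y)
    case 0
    then show ?case using D1 by simp
  next
    case (Suc t)
    have "(burnside ^^ Suc t) f = (burnside ^^ t) (\<lambda>Y. l * f Y + 1 * g Y)"
      by (simp add: g_def funpow_swap1)
    then have "(burnside ^^ Suc t) f Y = l * (burnside ^^ t) f Y + (burnside ^^ t) g Y"
      unfolding burnside_pow_linear by simp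
    then have "\<bar>(burnside ^^ Suc t) f Y\<bar> \<le> l * \<bar>(burnside ^^ t) f Y\<bar> + \<bar>(burnside ^^ t) g Y\<bar>"
      using l(1) abs_triangle_ineq[of "l * (burnside ^^ t) f Y" "(burnside ^^ t) g Y"] by (simp add: abs_mult)
    also have "\<dots> \<le> l * (D * r ^ t) + C * r ^ t"
      using Suc C l(1) by (intro add_mono mult_left_mono) auto
    also have "\<dots> \<le> l * (D * r ^ t) + D * (r - l) * r ^ t"
      using D2 r by (intro add_left_mono mult_right_mono) auto
    also have "\<dots> = D * r ^ Suc t" by (simp add: algebra_simps)
    finally show ?case .
  qed
  with D0 show ?case by blast
qed

lemma burnside_gap:
  assumes f: "ip f (\<lambda>_. 1) = 0"
  shows "ip (burnside f) (burnside f) \<le> 1 / 16 * ip f f"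
proof (rule ccontr)
  define a where "a t = ip ((burnside ^^ t) f) ((burnside ^^ t) f)" for t
  assume "\<not> ?thesis"
  then have a1: "a 1 > a 0 / 16" by (simp add: a_def)
  have "a 0 \<noteq> 0"
  proof
    assume "a 0 = 0"
    then have "f Y = 0" if "Y \<subseteq> N" for Y using ip_eq_0[of f Y] that by (simp add: a_def)
    then have "burnside f = burnside (\<lambda>_. 0)" by (intro burnside_cong) simp
    then have "burnside f = (\<lambda>_. 0)" by (simp only: burnside_one)
    then have "a 1 = 0" by (simp add: a_def ip_def)
    with a1 \<open>a 0 = 0\<close> show False by simp
  qed
  then have a0: "0 < a 0" using ip_nonneg[of f] by (simp add: a_def)
  define \<rho> where "\<rho> = a 1 / a 0"
  have \<rho>: "1 / 16 < \<rho>" using a0 a1 by (simp add: \<rho>_def field_simps)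
  \<comment> \<open>Log-convexity: self-adjointness rewrites \<open>a (Suc t)\<close> as the inner
    product of the iterates at \<open>t\<close> and \<open>t + 2\<close>.\<close>
  have conv: "(a (Suc t))\<^sup>2 \<le> a t * a (Suc (Suc t))" for t
    using ip_Cauchy_Schwarz[of "(burnside ^^ t) f" "(burnside ^^ Suc (Suc t)) f"]
      burnside_self_adjoint[of "(burnside ^^ t) f" "(burnside ^^ Suc t) f"] by (simp add: a_def)
  have grow: "0 < a t \<and> \<rho> * a t \<le> a (Suc t)" for t
  proof (induction t)
    case 0
    then show ?case using a0 by (simp add: \<rho>_def)
  next
    case (Suc t)
    have "0 < \<rho> * a t" using Suc \<rho> by (intro mult_pos_pos) auto
    then have pos: "0 < a (Suc t)" using Suc by linarith
    have "\<rho> * a t * a (Suc t) \<le> a (Suc t) * a (Suc t)" using Suc pos by (intro mult_right_mono) auto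
    also have "\<dots> \<le> a t * a (Suc (Suc t))" using conv[of t] by (simp add: power2_eq_square)
    finally have "a t * (\<rho> * a (Suc t)) \<le> a t * a (Suc (Suc t))" by (simp add: mult_ac)
    then show ?case using Suc pos by (simp add: mult_le_cancel_left)
  qed
  have lower: "\<rho> ^ t * a 0 \<le> a t" for t
  proof (induction t)
    case (Suc t)
    have "\<rho> ^ Suc t * a 0 \<le> \<rho> * a t" using Suc \<rho> by (simp add: mult.assoc)
    then show ?case using grow[of t] by simp
  qed simp
  \<comment> \<open>Any value strictly between 1/16 and \<open>\<rho>\<close> works:
    \<open>sqrt s > 1/4\<close> is then an admissible rate, while the squared norms grow at least
    like \<open>\<rho> ^ t\<close>.\<close>
  define s where "s = (1 / 16 + \<rho>) / 2"
  have s: "1 / 16 < s" "s < \<rho>" using \<rho> by (simp_all add: s_def)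
  have "sqrt (1 / 16) < sqrt s" using s by (subst real_sqrt_less_iff)
  moreover have "sqrt (1 / 16 :: real) = 1 / 4" by (rule real_sqrt_unique) (simp_all add: power2_eq_square)
  ultimately obtain C where C: "0 \<le> C" "\<And>t Y. Y \<subseteq> N \<Longrightarrow> \<bar>(burnside ^^ t) f Y\<bar> \<le> C * sqrt s ^ t"
    using burnside_pow_decay[of "sqrt s" "card N" f] deg_card f by auto
  have upper: "a t \<le> C\<^sup>2 * s ^ t" for t
  proof -
    have "((burnside ^^ t) f Y)\<^sup>2 \<le> C\<^sup>2 * s ^ t" if "Y \<subseteq> N" for Y
    proof -
      have "((burnside ^^ t) f Y)\<^sup>2 \<le> (C * sqrt s ^ t)\<^sup>2"
        using C(2)[OF that, of t] by (metis abs_ge_zero power2_abs power_mono)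
      also have "\<dots> = C\<^sup>2 * s ^ t"
        using s by (simp add: power_mult_distrib real_sqrt_power[symmetric] flip: real_sqrt_power)
      finally show ?thesis .
    qed
    then have "a t \<le> (\<Sum>Y\<in>Pow N. weight Y * (C\<^sup>2 * s ^ t))"
      unfolding a_def ip_def mult.assoc
      using weight_pos by (intro sum_mono mult_left_mono) (auto simp: power2_eq_square less_imp_le)
    then show ?thesis by (simp add: sum_distrib_right[symmetric] sum_weight)
  qed
  have "1 < \<rho> / s" using s by simp
  then obtain t where t: "C\<^sup>2 / a 0 < (\<rho> / s) ^ t" using real_arch_pow by blast
  have "\<rho> ^ t * a 0 \<le> C\<^sup>2 * s ^ t" using lower upper by (rule order_trans)
  moreover have "C\<^sup>2 * s ^ t < \<rho> ^ t * a 0"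
    using t a0 s by (simp add: power_divide field_simps)
  ultimately show False by simp
qed

lemma ip_burnside_pow_one: "ip ((burnside ^^ t) f) (\<lambda>_. 1) = ip f (\<lambda>_. 1)"
  by (simp add: burnside_pow_self_adjoint burnside_pow_one)

lemma burnside_pow_gap:
  assumes "ip f (\<lambda>_. 1) = 0"
  shows "ip ((burnside ^^ t) f) ((burnside ^^ t) f) \<le> (1 / 16) ^ t * ip f f"
proof (induction t)
  case (Suc t)
  have "ip ((burnside ^^ Suc t) f) ((burnside ^^ Suc t) f) \<le> 1 / 16 * ip ((burnside ^^ t) f) ((burnside ^^ t) f)"
    using burnside_gap[of "(burnside ^^ t) f"] assms by (simp add: ip_burnside_pow_one)
  also have "\<dots> \<le> 1 / 16 * ((1 / 16) ^ t * ip f f)" using Suc by simp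
  finally show ?case by simp
qed simp

end

section \<open>Total variation bounds\<close>

context finite_ground
begin

abbreviation perms :: "('a \<Rightarrow> 'a) set" where
  "perms \<equiv> {p. p permutes N}"

definition dual_kernel :: "('a \<Rightarrow> 'a) \<Rightarrow> ('a \<Rightarrow> 'a) \<Rightarrow> real" where
  "dual_kernel g h = 1 / card (fixed_sets N g) * (\<Sum>Y\<in>fixed_sets N g \<inter> fixed_sets N h. 1 / card (stab_perms N Y))"

definition dual_law :: "('a \<Rightarrow> 'a) \<Rightarrow> real" where
  "dual_law h = card (fixed_sets N h) / fact (card N + 1)"

text \<open>The density, relative to \<open>weight\<close>, of the uniform law on the sets fixed by
  \<open>g\<close>; \<open>avg N f g\<close> thereby becomes an inner product.\<close>

definition start_dens :: "('a \<Rightarrow> 'a) \<Rightarrow> 'a set \<Rightarrow> real" where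
  "start_dens g Y = (if Y \<in> fixed_sets N g then 1 / (card (fixed_sets N g) * weight Y) else 0)"

lemma finite_perms: "finite perms"
  by (simp add: finite_permutations)

lemma sum_stab_perms_filter:
  assumes "Y \<subseteq> N"
  shows "(\<Sum>h\<in>perms. if Y \<in> fixed_sets N h then \<phi> h else 0) = (\<Sum>h\<in>stab_perms N Y. \<phi> h :: real)"
  using assms
  by (intro sum.mono_neutral_cong_right)
    (auto simp: finite_perms fixed_sets_iff_stab_perms stab_perms_def)

lemma dual_kernel_apply: "(\<Sum>h\<in>perms. dual_kernel g h * \<phi> h) = avg N (stab_avg \<phi>) g"
proof -
  have "(\<Sum>h\<in>perms. dual_kernel g h * \<phi> h)
    = (\<Sum>h\<in>perms. \<Sum>Y\<in>fixed_sets N g. if Y \<in> fixed_sets N h then \<phi> h / card (stab_perms N Y) / card (fixed_sets N g) else 0)"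
    unfolding dual_kernel_def
    by (intro sum.cong refl) (simp add: sum.inter_restrict sum_distrib_left sum_distrib_right if_distrib if_distribR mult.commute cong: if_cong)
  also have "\<dots> = (\<Sum>Y\<in>fixed_sets N g. \<Sum>h\<in>perms. if Y \<in> fixed_sets N h then \<phi> h / card (stab_perms N Y) / card (fixed_sets N g) else 0)"
    by (rule sum.swap)
  also have "\<dots> = (\<Sum>Y\<in>fixed_sets N g. \<Sum>h\<in>stab_perms N Y. \<phi> h / card (stab_perms N Y) / card (fixed_sets N g))"
    by (intro sum.cong refl sum_stab_perms_filter) (rule fixed_sets_subset)
  also have "\<dots> = avg N (stab_avg \<phi>) g"
    by (simp add: avg_def stab_avg_def sum_divide_distrib)
  finally show ?thesis .
qed

text \<open>One of the \<open>Suc t\<close> steps is spent on passing from permutations to sets and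
  back, which is why the upper bounds carry the exponent \<open>t - 1\<close>.\<close>

lemma kernel_pow_dual_kernel_apply:
  "(\<Sum>h\<in>perms. kernel_pow perms dual_kernel (Suc t) g h * \<phi> h) = avg N ((burnside ^^ t) (stab_avg \<phi>)) g"
proof (induction t arbitrary: g)
  case 0
  have "kernel_pow perms dual_kernel (Suc 0) g h = dual_kernel g h" if "h \<in> perms" for h
  proof -
    have "kernel_pow perms dual_kernel (Suc 0) g h = (\<Sum>s\<in>perms. if s = h then dual_kernel g h else 0)"
      unfolding kernel_pow.simps by (rule sum.cong) simp_all
    then show ?thesis using that by (simp add: sum.delta finite_perms)
  qed
  then show ?case using dual_kernel_apply[of g \<phi>] by simp
next
  case (Suc t)
  have "(\<Sum>h\<in>perms. kernel_pow perms dual_kernel (Suc (Suc t)) g h * \<phi> h)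
    = (\<Sum>h\<in>perms. \<Sum>s\<in>perms. dual_kernel g s * (kernel_pow perms dual_kernel (Suc t) s h * \<phi> h))"
    by (subst kernel_pow.simps) (simp only: sum_distrib_right mult.assoc)
  also have "\<dots> = (\<Sum>s\<in>perms. \<Sum>h\<in>perms. dual_kernel g s * (kernel_pow perms dual_kernel (Suc t) s h * \<phi> h))"
    by (rule sum.swap)
  also have "\<dots> = (\<Sum>s\<in>perms. dual_kernel g s * avg N ((burnside ^^ t) (stab_avg \<phi>)) s)"
    by (simp only: Suc sum_distrib_left[symmetric])
  also have "\<dots> = avg N ((burnside ^^ Suc t) (stab_avg \<phi>)) g"
    unfolding dual_kernel_apply by (simp add: burnside_def)
  finally show ?case .
qed

lemma avg_eq_ip: "avg N f g = ip (start_dens g) f"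
proof -
  have "ip (start_dens g) f = (\<Sum>Y\<in>fixed_sets N g. f Y / card (fixed_sets N g))"
    unfolding ip_def
  proof (rule sum.mono_neutral_cong_right)
    show "fixed_sets N g \<subseteq> Pow N" using fixed_sets_subset by auto
    show "weight Y * start_dens g Y * f Y = f Y / card (fixed_sets N g)" if "Y \<in> fixed_sets N g" for Y
      using that weight_pos[OF fixed_sets_subset[OF that]] by (simp add: start_dens_def)
  qed (auto simp: start_dens_def)
  then show ?thesis by (simp add: avg_def sum_divide_distrib)
qed

lemma dual_law_apply: "(\<Sum>h\<in>perms. dual_law h * \<phi> h) = ip (stab_avg \<phi>) (\<lambda>_. 1)"
  unfolding ip_stab_avg dual_law_def by (simp add: sum_divide_distrib mult.commute)

lemma ip_start_dens_one: "ip (start_dens g) (\<lambda>_. 1) = 1"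
  by (simp add: avg_eq_ip[symmetric] avg_def)

lemma stab_avg_bound:
  assumes "\<And>p. \<bar>\<phi> p\<bar> \<le> 1"
  shows "\<bar>stab_avg \<phi> Y\<bar> \<le> 1"
proof -
  have "\<bar>\<Sum>p\<in>stab_perms N Y. \<phi> p\<bar> \<le> (\<Sum>p\<in>stab_perms N Y. 1)"
    using assms by (intro order_trans[OF sum_abs] sum_mono)
  then show ?thesis using card_stab_perms_pos[of Y] unfolding stab_avg_def
    by (simp add: divide_le_eq)
qed

lemma ip_le_1:
  assumes "\<And>Y. \<bar>f Y\<bar> \<le> 1"
  shows "ip f f \<le> 1"
proof -
  have "ip f f \<le> (\<Sum>Y\<in>Pow N. weight Y * 1)"
    unfolding ip_def mult.assoc
  proof (intro sum_mono mult_left_mono)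
    fix Y assume "Y \<in> Pow N"
    then show "0 \<le> weight Y" using weight_pos[of Y] by simp
    show "f Y * f Y \<le> 1" using abs_square_le_1[of "f Y"] assms[of Y] by (simp add: power2_eq_square)
  qed
  then show ?thesis by (simp add: sum_weight)
qed

text \<open>Total variation is tested against the sign function \<open>\<phi>\<close>. Its average
  over stabilizers is still bounded by 1, hence has norm at most 1, and Cauchy-Schwarz leaves the
  norm of the evolved density.\<close>

lemma tv_dist_dual_kernel_le:
  defines "u t g \<equiv> (burnside ^^ t) (\<lambda>Y. start_dens g Y - 1)"
  shows "tv_dist perms (kernel_pow perms dual_kernel (Suc t) g) dual_law \<le> 1 / 2 * sqrt (ip (u t g) (u t g))"
proof -
  define \<phi> where "\<phi> h = sgn (kernel_pow perms dual_kernel (Suc t) g h - dual_law h)" for h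
  define L where "L = stab_avg \<phi>"
  have "(\<Sum>h\<in>perms. \<bar>kernel_pow perms dual_kernel (Suc t) g h - dual_law h\<bar>)
    = (\<Sum>h\<in>perms. kernel_pow perms dual_kernel (Suc t) g h * \<phi> h) - (\<Sum>h\<in>perms. dual_law h * \<phi> h)"
    unfolding \<phi>_def by (simp only: left_diff_distrib[symmetric] sum_subtractf[symmetric] abs_sgn)
  also have "\<dots> = ip (start_dens g) ((burnside ^^ t) L) - ip L (\<lambda>_. 1)"
    unfolding kernel_pow_dual_kernel_apply dual_law_apply avg_eq_ip L_def ..
  also have "ip (start_dens g) ((burnside ^^ t) L) = ip ((burnside ^^ t) (start_dens g)) L"
    by (simp add: burnside_pow_self_adjoint)
  also have "ip L (\<lambda>_. 1) = ip ((burnside ^^ t) (\<lambda>_. 1)) L"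
    by (simp add: burnside_pow_one ip_commute)
  also have "ip ((burnside ^^ t) (start_dens g)) L - ip ((burnside ^^ t) (\<lambda>_. 1)) L = ip (u t g) L"
    using burnside_pow_linear[of t 1 "start_dens g" "- 1" "\<lambda>_. 1"]
      ip_linear[of 1 "(burnside ^^ t) (start_dens g)" "- 1" "(burnside ^^ t) (\<lambda>_. 1)" L]
    by (simp add: u_def)
  also have "\<dots> \<le> sqrt ((ip (u t g) L)\<^sup>2)" by simp
  also have "\<dots> \<le> sqrt (ip (u t g) (u t g) * 1)"
  proof (rule real_sqrt_le_mono)
    have "ip L L \<le> 1"
      unfolding L_def by (intro ip_le_1 stab_avg_bound) (simp add: \<phi>_def sgn_if)
    then have "ip (u t g) (u t g) * ip L L \<le> ip (u t g) (u t g) * 1"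
      by (intro mult_left_mono ip_nonneg)
    then show "(ip (u t g) L)\<^sup>2 \<le> ip (u t g) (u t g) * 1"
      using ip_Cauchy_Schwarz[of "u t g" L] by simp
  qed
  finally show ?thesis by (simp add: tv_dist_def)
qed

lemma ip_minus_one:
  assumes "ip f (\<lambda>_. 1) = 1"
  shows "ip (\<lambda>Y. f Y - 1) (\<lambda>_. 1) = 0" "ip (\<lambda>Y. f Y - 1) (\<lambda>Y. f Y - 1) = ip f f - 1"
proof -
  have lin: "ip (\<lambda>Y. f Y - 1) h = ip f h - ip (\<lambda>_. 1) h" for h
    using ip_linear[of 1 f "- 1" "\<lambda>_. 1" h] by simp
  show "ip (\<lambda>Y. f Y - 1) (\<lambda>_. 1) = 0" by (simp add: lin assms)
  show "ip (\<lambda>Y. f Y - 1) (\<lambda>Y. f Y - 1) = ip f f - 1"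
    unfolding lin ip_commute[of f "\<lambda>Y. f Y - 1"] ip_commute[of "\<lambda>_. 1" "\<lambda>Y. f Y - 1"]
    by (simp add: ip_commute[of "\<lambda>_. 1" f] assms)
qed

lemma sqrt_16_power: "sqrt ((1 / 16) ^ t * x) = (1 / 4) ^ t * sqrt x"
proof -
  have "sqrt (1 / 16 :: real) = 1 / 4" by (rule real_sqrt_unique) (simp_all add: power2_eq_square)
  then show ?thesis by (simp only: real_sqrt_mult real_sqrt_power)
qed

lemma tv_dist_dual_kernel_L2:
  "tv_dist perms (kernel_pow perms dual_kernel (Suc t) g) dual_law
    \<le> 1 / 2 * sqrt (ip (start_dens g) (start_dens g) - 1) * (1 / 4) ^ t"
proof -
  let ?f = "\<lambda>Y. start_dens g Y - 1"
  have "sqrt (ip ((burnside ^^ t) ?f) ((burnside ^^ t) ?f)) \<le> sqrt ((1 / 16) ^ t * ip ?f ?f)"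
    by (intro real_sqrt_le_mono burnside_pow_gap ip_minus_one(1) ip_start_dens_one)
  also have "\<dots> = (1 / 4) ^ t * sqrt (ip (start_dens g) (start_dens g) - 1)"
    by (simp only: sqrt_16_power ip_minus_one(2)[OF ip_start_dens_one])
  finally show ?thesis using tv_dist_dual_kernel_le[of t g] by (simp add: mult_ac)
qed

lemma ip_start_dens: "ip (start_dens g) (start_dens g) = (\<Sum>Y\<in>fixed_sets N g. 1 / weight Y) / (card (fixed_sets N g))\<^sup>2"
proof -
  have "ip (start_dens g) (start_dens g) = (\<Sum>Y\<in>fixed_sets N g. start_dens g Y) / card (fixed_sets N g)"
    by (simp only: avg_eq_ip[symmetric]) (simp only: avg_def)
  also have "(\<Sum>Y\<in>fixed_sets N g. start_dens g Y) = (\<Sum>Y\<in>fixed_sets N g. 1 / weight Y / card (fixed_sets N g))"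
    by (intro sum.cong) (simp_all add: start_dens_def mult.commute)
  finally show ?thesis by (simp add: sum_divide_distrib power2_eq_square mult.assoc)
qed

text \<open>\<open>1 / weight Y\<close> is largest at the middle level, and the mean of these values
  over the fixed sets is divided once more by the number of fixed sets, which is at least 1.\<close>

lemma ip_start_dens_le:
  "ip (start_dens g) (start_dens g) \<le> real (card N + 1) * real (card N choose (card N div 2))"
proof -
  let ?M = "real (card N + 1) * real (card N choose (card N div 2))"
  have c: "1 \<le> card (fixed_sets N g)" using card_fixed_sets_pos[OF fin, of g] by linarith
  have "(\<Sum>Y\<in>fixed_sets N g. 1 / weight Y) \<le> (\<Sum>Y\<in>fixed_sets N g. ?M)"
    by (intro sum_mono) (simp add: weight_def binomial_maximum mult_left_mono)
  then have "ip (start_dens g) (start_dens g) \<le> card (fixed_sets N g) * ?M / (card (fixed_sets N g))\<^sup>2"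
    unfolding ip_start_dens by (intro divide_right_mono) auto
  also have "\<dots> = ?M / card (fixed_sets N g)" using c by (simp add: power2_eq_square)
  also have "\<dots> \<le> ?M"
  proof -
    have "?M * 1 \<le> ?M * card (fixed_sets N g)" by (rule mult_left_mono) (use c in auto)
    then show ?thesis using c by (simp add: divide_le_eq)
  qed
  finally show ?thesis .
qed

lemma fixed_sets_id: "fixed_sets N id = Pow N"
  by (auto simp: fixed_sets_def)

lemma ip_start_dens_id:
  "ip (start_dens id) (start_dens id) = real (card N + 1) / 4 ^ card N * real ((2 * card N) choose card N)"
proof -
  have "(\<Sum>Y\<in>Pow N. 1 / weight Y) = (\<Sum>j\<le>card N. real (card N choose j) * (real (card N + 1) * real (card N choose j)))"
    unfolding weight_def by (subst sum_Pow_card[OF fin, symmetric]) simp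
  also have "\<dots> = real (card N + 1) * (\<Sum>j\<le>card N. (real (card N choose j))\<^sup>2)"
    by (simp add: sum_distrib_left power2_eq_square mult_ac)
  also have "(\<Sum>j\<le>card N. (real (card N choose j))\<^sup>2) = real ((2 * card N) choose card N)"
    unfolding choose_square_sum[symmetric] by simp
  finally have "(\<Sum>Y\<in>Pow N. 1 / weight Y) = real (card N + 1) * real ((2 * card N) choose card N)" .
  moreover have "((2 :: real) ^ card N)\<^sup>2 = 4 ^ card N"
    by (simp add: power2_eq_square flip: power_mult_distrib)
  ultimately show ?thesis
    unfolding ip_start_dens fixed_sets_id by (simp add: card_Pow)
qed

text \<open>The expectation of an eigenfunction of mean 0 after \<open>t\<close> steps is
  \<open>c ^ t * f g\<close>. Starting where the absolute value of \<open>f\<close> is largest lets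
  that value cancel, and the factor 1/2 is the one in the definition of total variation.\<close>

lemma tv_dist_dual_kernel_lower:
  assumes g: "g \<in> perms" and f: "\<And>g. g \<in> perms \<Longrightarrow> (\<Sum>h\<in>perms. dual_kernel g h * f h) = c * f g"
    and pi: "(\<Sum>h\<in>perms. dual_law h * f h) = 0"
    and max: "\<And>h. h \<in> perms \<Longrightarrow> \<bar>f h\<bar> \<le> \<bar>f g\<bar>" and "f g \<noteq> 0"
  shows "\<bar>c\<bar> ^ t / 2 \<le> tv_dist perms (kernel_pow perms dual_kernel t g) dual_law"
proof -
  have pow: "(\<Sum>h\<in>perms. kernel_pow perms dual_kernel t s h * f h) = c ^ t * f s" if "s \<in> perms" for s
    using that
  proof (induction t arbitrary: s)
    case 0
    have "(\<Sum>h\<in>perms. kernel_pow perms dual_kernel 0 s h * f h) = (\<Sum>h\<in>perms. if h = s then f s else 0)"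
      by (intro sum.cong) auto
    then show ?case using 0 by (simp add: sum.delta finite_perms)
  next
    case (Suc t)
    have "(\<Sum>h\<in>perms. kernel_pow perms dual_kernel (Suc t) s h * f h)
      = (\<Sum>h\<in>perms. \<Sum>s'\<in>perms. dual_kernel s s' * (kernel_pow perms dual_kernel t s' h * f h))"
      by (subst kernel_pow.simps) (simp only: sum_distrib_right mult.assoc)
    also have "\<dots> = (\<Sum>s'\<in>perms. dual_kernel s s' * (\<Sum>h\<in>perms. kernel_pow perms dual_kernel t s' h * f h))"
      by (subst sum.swap) (simp only: sum_distrib_left)
    also have "\<dots> = (\<Sum>s'\<in>perms. c ^ t * (dual_kernel s s' * f s'))"
      by (intro sum.cong refl) (simp add: Suc.IH)
    also have "\<dots> = c ^ Suc t * f s"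
      using f[OF Suc.prems] by (simp flip: sum_distrib_left)
    finally show ?case .
  qed
  have "\<bar>c\<bar> ^ t * \<bar>f g\<bar> = \<bar>\<Sum>h\<in>perms. (kernel_pow perms dual_kernel t g h - dual_law h) * f h\<bar>"
    using pow[OF g] pi by (simp add: left_diff_distrib sum_subtractf abs_mult power_abs)
  also have "\<dots> \<le> (\<Sum>h\<in>perms. \<bar>kernel_pow perms dual_kernel t g h - dual_law h\<bar> * \<bar>f g\<bar>)"
    using max by (intro order_trans[OF sum_abs] sum_mono) (simp add: abs_mult mult_left_mono)
  also have "\<dots> = (2 * tv_dist perms (kernel_pow perms dual_kernel t g) dual_law) * \<bar>f g\<bar>"
    by (simp add: tv_dist_def sum_distrib_right)
  finally show ?thesis using \<open>f g \<noteq> 0\<close> by (simp add: mult_le_cancel_right)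
qed

text \<open>The image of \<open>walsh {i, j}\<close> is 1/2 if \<open>i\<close> and \<open>j\<close>
  lie on the same side of \<open>Y\<close> and 0 otherwise, that is
  \<open>(1 + walsh {i, j} Y) / 4\<close>. The constant 1/3 is the fixed point of
  \<open>x = (1 + x) / 4\<close>.\<close>

lemma burnside_quarter_eigenfunction:
  assumes ij: "i \<in> N" "j \<in> N" "i \<noteq> j"
  shows "burnside (\<lambda>Y. walsh {i, j} Y - 1 / 3) Y = 1 / 4 * (walsh {i, j} Y - 1 / 3)"
proof -
  have m: "even_moment 0 = 1" "even_moment (Suc 0) = 0" "even_moment (Suc (Suc 0)) = 1 / 2"
    by (simp_all add: even_moment_def)
  have "burnside (walsh {i, j}) Y = 1 / 4 * (1 + walsh {i, j} Y)"
    using ij by (cases "i \<in> Y"; cases "j \<in> Y")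
      (simp_all add: burnside_walsh walsh_def m Int_insert_left insert_Diff_if)
  then show ?thesis
    using burnside_linear[of 1 "walsh {i, j}" "- 1 / 3" "\<lambda>_. 1" Y] by (simp add: algebra_simps)
qed

lemma tv_dist_dual_kernel_lower_quarter:
  assumes ij: "i \<in> N" "j \<in> N" "i \<noteq> j"
  shows "\<exists>g\<in>perms. \<forall>t. (1 / 4) ^ t / 2 \<le> tv_dist perms (kernel_pow perms dual_kernel t g) dual_law"
proof -
  define \<phi> where "\<phi> = (\<lambda>Y. walsh {i, j} Y - 1 / 3)"
  define f where "f = avg N \<phi>"
  have ev: "burnside \<phi> = (\<lambda>Y. 1 / 4 * \<phi> Y)"
    unfolding \<phi>_def using burnside_quarter_eigenfunction[OF ij] by (rule ext)
  have stab_avg_f: "stab_avg f = burnside \<phi>" by (simp add: f_def burnside_def)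
  have Qf: "(\<Sum>h\<in>perms. dual_kernel g h * f h) = 1 / 4 * f g" for g
    unfolding dual_kernel_apply stab_avg_f ev using avg_linear[of "1 / 4" \<phi> 0 \<phi> g] by (simp add: f_def)
  have "ip \<phi> (\<lambda>_. 1) = 1 / 4 * ip \<phi> (\<lambda>_. 1)"
    using ip_burnside_one[of \<phi>] ip_linear[of "1 / 4" \<phi> 0 \<phi> "\<lambda>_. 1"] by (simp add: ev)
  then have pif: "(\<Sum>h\<in>perms. dual_law h * f h) = 0"
    unfolding dual_law_apply stab_avg_f ip_burnside_one by simp
  \<comment> \<open>If \<open>f\<close> vanished on every permutation, so would
    \<open>stab_avg f {}\<close>; but that value is a quarter of \<open>\<phi> {}\<close>, which is
    2/3.\<close>
  have ne: "\<exists>h\<in>perms. f h \<noteq> 0"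
  proof (rule ccontr)
    assume "\<not> ?thesis"
    then have "stab_avg f {} = 0" by (simp add: stab_avg_def stab_perms_def)
    then show False using stab_avg_f ev by (simp add: \<phi>_def walsh_def)
  qed
  have "finite ((\<lambda>h. \<bar>f h\<bar>) ` perms)" "(\<lambda>h. \<bar>f h\<bar>) ` perms \<noteq> {}"
    using finite_perms ne by auto
  then obtain g where g: "g \<in> perms" "\<bar>f g\<bar> = Max ((\<lambda>h. \<bar>f h\<bar>) ` perms)"
    using Max_in by (metis (no_types, lifting) imageE)
  then have max: "\<bar>f h\<bar> \<le> \<bar>f g\<bar>" if "h \<in> perms" for h
    using that finite_perms by simp
  with ne have "f g \<noteq> 0" by force
  then have "(1 / 4) ^ t / 2 \<le> tv_dist perms (kernel_pow perms dual_kernel t g) dual_law" for t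
    using tv_dist_dual_kernel_lower[OF g(1), of f "1 / 4" t] Qf pif max by simp
  with g(1) show ?thesis by blast
qed

end

section \<open>Characteristic polynomial of the dual kernel\<close>

lemma char_poly_four_block_upper_right_zero:
  fixes A :: "'a :: idom mat"
  assumes A: "A \<in> carrier_mat n n" and C: "C \<in> carrier_mat m n" and D: "D \<in> carrier_mat m m"
  shows "char_poly (four_block_mat A (0\<^sub>m n m) C D) = char_poly A * char_poly D"
proof -
  let ?cm = "\<lambda>A. [:0, 1:] \<cdot>\<^sub>m 1\<^sub>m (dim_row A) + map_mat (\<lambda>a. [:- a:]) A"
  let ?F = "four_block_mat A (0\<^sub>m n m) C D"
  have "?cm ?F = four_block_mat (?cm A) (0\<^sub>m n m) (map_mat (\<lambda>a. [:- a:]) C) (?cm D)"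
    by (rule eq_matI) (use A C D in \<open>auto simp: one_poly_def\<close>)
  then have "char_poly ?F = det (four_block_mat (?cm A) (0\<^sub>m n m) (map_mat (\<lambda>a. [:- a:]) C) (?cm D))"
    using A D unfolding char_poly_defs by simp
  also have "\<dots> = det (?cm A) * det (?cm D)"
    by (rule det_four_block_mat_upper_right_zero[OF _ refl]) (use A C D in auto)
  finally show ?thesis unfolding char_poly_defs .
qed

lemma char_poly_zero_mat: "char_poly (0\<^sub>m n n :: 'a :: idom mat) = [:0, 1:] ^ n"
proof -
  have "upper_triangular (0\<^sub>m n n :: 'a mat)" by (simp add: upper_triangular_def)
  then have "char_poly (0\<^sub>m n n :: 'a mat) = (\<Prod>a\<leftarrow>diag_mat (0\<^sub>m n n). [:- a, 1:])"
    by (rule char_poly_upper_triangular[OF zero_carrier_mat])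
  also have "diag_mat (0\<^sub>m n n :: 'a mat) = replicate n 0"
    by (rule nth_equalityI) (auto simp: diag_mat_def)
  finally show ?thesis by simp
qed

text \<open>The block matrices \<open>X\<close> and \<open>Y\<close> are conjugate by the unipotent
  \<open>P\<close>. Each is block triangular with a zero diagonal block, and the zero blocks account
  for the two powers of the indeterminate.\<close>

lemma char_poly_mult_swap:
  fixes A :: "'a :: idom mat"
  assumes A: "A \<in> carrier_mat n m" and B: "B \<in> carrier_mat m n"
  shows "char_poly (A * B) * [:0, 1:] ^ m = [:0, 1:] ^ n * char_poly (B * A)"
proof -
  define X where "X = four_block_mat (A * B) (0\<^sub>m n m) B (0\<^sub>m m m)"
  define Y where "Y = four_block_mat (0\<^sub>m n n) (0\<^sub>m n m) B (B * A)"
  define P where "P = four_block_mat (1\<^sub>m n) A (0\<^sub>m m n) (1\<^sub>m m)"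
  define R where "R = four_block_mat (1\<^sub>m n) (- A) (0\<^sub>m m n) (1\<^sub>m m)"
  have AB: "A * B \<in> carrier_mat n n" "B * A \<in> carrier_mat m m" using A B by auto
  have carr: "X \<in> carrier_mat (n + m) (n + m)" "Y \<in> carrier_mat (n + m) (n + m)"
    "P \<in> carrier_mat (n + m) (n + m)" "R \<in> carrier_mat (n + m) (n + m)"
    using A B by (auto simp: X_def Y_def P_def R_def)
  have mz: "- (0\<^sub>m m m :: 'a mat) = 0\<^sub>m m m" by (rule eq_matI) auto
  have AA: "A + - A = 0\<^sub>m n m" using A by (intro eq_matI) auto
  have PR: "P * R = 1\<^sub>m (n + m)"
    unfolding P_def R_def using A
    by (subst mult_four_block_mat[of _ n n _ m _ m]) (auto simp: mz AA)
  have RP: "R * P = 1\<^sub>m (n + m)"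
    unfolding P_def R_def using A
    by (subst mult_four_block_mat[of _ n n _ m _ m]) (auto simp: mz AA)
  have "X * P = four_block_mat (A * B) (A * B * A) B (B * A)"
    unfolding X_def P_def using A B AB
    by (subst mult_four_block_mat[of _ n n _ m _ m]) auto
  moreover have "P * Y = four_block_mat (A * B) (A * B * A) B (B * A)"
    unfolding Y_def P_def using A B AB
    by (subst mult_four_block_mat[of _ n n _ m _ m]) (auto simp: assoc_mult_mat[OF A B A])
  ultimately have XP: "X * P = P * Y" by simp
  have "X = X * (P * R)" using carr by (simp add: PR)
  also have "\<dots> = P * Y * R" using carr XP by (metis assoc_mult_mat)
  finally have "similar_mat_wit X Y P R"
    using carr PR RP by (intro similar_mat_witI)
  then have "char_poly X = char_poly Y"
    by (intro char_poly_similar) (auto simp: similar_mat_def)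
  moreover have "char_poly X = char_poly (A * B) * [:0, 1:] ^ m"
    unfolding X_def using AB B
    by (subst char_poly_four_block_upper_right_zero) (auto simp: char_poly_zero_mat)
  moreover have "char_poly Y = [:0, 1:] ^ n * char_poly (B * A)"
    unfolding Y_def using AB B
    by (subst char_poly_four_block_upper_right_zero) (auto simp: char_poly_zero_mat)
  ultimately show ?thesis by simp
qed

lemma order_linear: "order z [:- a, 1:] = (if a = z then 1 else 0)" for z :: "'a :: idom"
proof (cases "a = z")
  case True
  then show ?thesis using order_linear_power[of z z 1] by simp
next
  case False
  then show ?thesis by (simp add: order_0I)
qed

lemma order_prod_linear:
  fixes z :: "'a :: idom"
  shows "order z (\<Prod>a\<leftarrow>as. [:- a, 1:]) = length (filter (\<lambda>a. a = z) as)"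
proof (induction as)
  case (Cons a as)
  have "(\<Prod>a\<leftarrow>as. [:- a, 1:]) \<noteq> 0" by (auto simp: prod_list_zero_iff)
  then have "[:- a, 1:] * (\<Prod>a\<leftarrow>as. [:- a, 1:]) \<noteq> 0" by (intro no_zero_divisors) simp_all
  then show ?case using Cons by (simp add: order_mult order_linear del: mult_pCons_left)
qed simp

section \<open>Eigenvalue multiplicities of the dual kernel\<close>

context finite_ground
begin

text \<open>The entry at \<open>(Y, h)\<close> of the operator averaging over stabilizers: the
  probability that a uniform element of the stabilizer of \<open>Y\<close> equals
  \<open>h\<close>.\<close>

definition stab_weight :: "('a \<Rightarrow> 'a) \<Rightarrow> 'a set \<Rightarrow> real" where
  "stab_weight h Y = (if Y \<in> fixed_sets N h then 1 / card (stab_perms N Y) else 0)"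

lemma avg_sum: "avg N (\<lambda>Y. \<Sum>i\<in>I. c i * f i Y) g = (\<Sum>i\<in>I. c i * avg N (f i) g)"
  unfolding avg_def by (subst sum.swap) (simp add: sum_distrib_left sum_divide_distrib)

lemma dual_kernel_eq_avg: "dual_kernel g h = avg N (stab_weight h) g"
  by (simp add: dual_kernel_def avg_def stab_weight_def sum.inter_restrict)

lemma dual_kernel_factor: "dual_kernel g h = (\<Sum>S\<in>Pow N. avg N (walsh S) g * fourier (stab_weight h) S)"
proof -
  have "dual_kernel g h = avg N (\<lambda>Y. \<Sum>S\<in>Pow N. fourier (stab_weight h) S * walsh S Y) g"
    unfolding dual_kernel_eq_avg by (rule avg_cong) (rule fourier_inversion)
  then show ?thesis unfolding avg_sum by (simp only: mult.commute)
qed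

lemma fourier_burnside_factor: "fourier (burnside f) T = (\<Sum>h\<in>perms. fourier (stab_weight h) T * avg N f h)"
proof -
  have "fourier (burnside f) T = fourier (\<lambda>Y. \<Sum>h\<in>perms. avg N f h * stab_weight h Y) T"
  proof (rule fourier_cong)
    fix Y assume Y: "Y \<subseteq> N"
    have "(\<Sum>h\<in>perms. avg N f h * stab_weight h Y)
      = (\<Sum>h\<in>perms. if Y \<in> fixed_sets N h then avg N f h / card (stab_perms N Y) else 0)"
      by (intro sum.cong) (auto simp: stab_weight_def)
    also have "\<dots> = (\<Sum>h\<in>stab_perms N Y. avg N f h / card (stab_perms N Y))" by (rule sum_stab_perms_filter[OF Y])
    finally show "burnside f Y = (\<Sum>h\<in>perms. avg N f h * stab_weight h Y)"
      by (simp add: burnside_def stab_avg_def sum_divide_distrib)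
  qed
  then show ?thesis by (simp add: fourier_sum mult.commute)
qed

text \<open>The two factors are rectangular, and swapping them changes only the order at 0. The
  relation is additive because there may be fewer permutations than sets, as for 2 or 3
  points.\<close>

lemma order_char_poly_dual_kernel:
  fixes z :: complex
  assumes e: "bij_betw e {..<card perms} perms"
  shows "order z (char_poly (kernel_mat_enum e perms dual_kernel)) + (if z = 0 then 2 ^ card N else 0)
    = card {S \<in> Pow N. complex_of_real (walsh_eigval (card S)) = z} + (if z = 0 then fact (card N) else 0)"
proof -
  obtain l where l: "set l = Pow N" "distinct l"
    using finite_distinct_list[of "Pow N"] by auto
  \<comment> \<open>Sorting by cardinality places every proper subset before its supersets, so the
    matrix of \<open>burnside\<close> becomes upper triangular.\<close>
  define L where "L = sort_key card l"
  have L: "set L = Pow N" "distinct L" "sorted (map card L)" using l by (simp_all add: L_def)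
  define n m where "n = card perms" and "m = card (Pow N)"
  have n: "n = fact (card N)" by (simp add: n_def card_permutations)
  have m: "m = 2 ^ card N" by (simp add: m_def card_Pow)
  have lenL: "length L = m" using distinct_card[OF L(2)] L(1) by (simp add: m_def)
  have LN: "L ! k \<subseteq> N" if "k < m" for k using nth_mem[of k L] that L(1) lenL by auto
  have bL: "bij_betw (\<lambda>k. L ! k) {0..<m} (Pow N)"
    using bij_betw_nth[OF L(2)] lenL L(1) by (simp add: atLeast0LessThan)
  have be: "bij_betw e {0..<n} perms" using e by (simp add: n_def atLeast0LessThan)
  define A where "A = Matrix.mat n m (\<lambda>(i, k). complex_of_real (avg N (walsh (L ! k)) (e i)))"
  define B where "B = Matrix.mat m n (\<lambda>(k, j). complex_of_real (fourier (stab_weight (e j)) (L ! k)))"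
  have A: "A \<in> carrier_mat n m" and B: "B \<in> carrier_mat m n" by (simp_all add: A_def B_def)
  have AB: "A * B = kernel_mat_enum e perms dual_kernel"
  proof (rule eq_matI)
    fix i j assume "i < dim_row (kernel_mat_enum e perms dual_kernel)" "j < dim_col (kernel_mat_enum e perms dual_kernel)"
    then have ij: "i < n" "j < n" by (simp_all add: kernel_mat_enum_def n_def)
    have "(A * B) $$ (i, j)
        = complex_of_real (\<Sum>k = 0..<m. avg N (walsh (L ! k)) (e i) * fourier (stab_weight (e j)) (L ! k))"
      using ij by (simp add: A_def B_def scalar_prod_def)
    also have "\<dots> = complex_of_real (dual_kernel (e i) (e j))"
      unfolding dual_kernel_factor
      by (subst sum.reindex_bij_betw[OF bL, of "\<lambda>S. avg N (walsh S) (e i) * fourier (stab_weight (e j)) S"]) simp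
    finally show "(A * B) $$ (i, j) = kernel_mat_enum e perms dual_kernel $$ (i, j)"
      using ij by (simp add: kernel_mat_enum_def n_def)
  qed (simp_all add: A_def B_def kernel_mat_enum_def n_def)
  have BA: "(B * A) $$ (k, k') = complex_of_real (fourier (burnside (walsh (L ! k'))) (L ! k))"
    if k: "k < m" "k' < m" for k k'
  proof -
    have "(B * A) $$ (k, k')
        = complex_of_real (\<Sum>j = 0..<n. fourier (stab_weight (e j)) (L ! k) * avg N (walsh (L ! k')) (e j))"
      using k by (simp add: A_def B_def scalar_prod_def)
    also have "\<dots> = complex_of_real (fourier (burnside (walsh (L ! k'))) (L ! k))"
      unfolding fourier_burnside_factor
      by (subst sum.reindex_bij_betw[OF be, of "\<lambda>h. fourier (stab_weight h) (L ! k) * avg N (walsh (L ! k')) h"]) simp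
    finally show ?thesis .
  qed
  have cBA: "B * A \<in> carrier_mat m m" using A B by simp
  have "upper_triangular (B * A)"
  proof (rule upper_triangularI)
    fix k k' assume k: "k' < k" "k < dim_row (B * A)"
    then have km: "k < m" "k' < m" using cBA by auto
    have "\<not> L ! k \<subseteq> L ! k'"
    proof
      assume sub: "L ! k \<subseteq> L ! k'"
      have "card (L ! k') \<le> card (L ! k)"
        using sorted_nth_mono[OF L(3), of k' k] k km lenL by simp
      then have "L ! k = L ! k'"
        using sub LN[OF km(2)] by (meson card_seteq finite_sub)
      then show False using nth_eq_iff_index_eq[OF L(2)] km lenL k by simp
    qed
    then show "(B * A) $$ (k, k') = 0"
      using km LN by (simp add: BA fourier_burnside_walsh_zero)
  qed
  then have cp: "char_poly (B * A) = (\<Prod>a\<leftarrow>diag_mat (B * A). [:- a, 1:])"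
    by (rule char_poly_upper_triangular[OF cBA])
  have dg: "diag_mat (B * A) = map (\<lambda>S. complex_of_real (walsh_eigval (card S))) L"
    by (rule nth_equalityI) (use cBA lenL LN in \<open>simp_all add: diag_mat_def BA fourier_burnside_walsh_self del: index_mult_mat\<close>)
  have ord: "order z (char_poly (B * A)) = card {S \<in> Pow N. complex_of_real (walsh_eigval (card S)) = z}"
  proof -
    have "order z (char_poly (B * A)) = length (filter (\<lambda>S. complex_of_real (walsh_eigval (card S)) = z) L)"
      unfolding cp order_prod_linear dg by (simp add: filter_map o_def)
    also have "\<dots> = card (set (filter (\<lambda>S. complex_of_real (walsh_eigval (card S)) = z) L))"
      using distinct_card[OF distinct_filter[OF L(2)]] by simp
    finally show ?thesis using L(1) by simp
  qed
  have nz: "char_poly M \<noteq> 0" if "M \<in> carrier_mat r r" for M :: "complex mat" and r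
    using degree_monic_char_poly[OF that] by auto
  have mono: "order z ([:0, 1:] ^ k) = (if z = 0 then k else 0)" for k
    using order_prod_linear[of z "replicate k 0"] by simp
  have nzX: "[:0, 1:] ^ k \<noteq> (0 :: complex poly)" for k by simp
  have "order z (char_poly (A * B) * [:0, 1:] ^ m) = order z ([:0, 1:] ^ n * char_poly (B * A))"
    using char_poly_mult_swap[OF A B] by simp
  moreover have "char_poly (A * B) * [:0, 1:] ^ m \<noteq> 0" "[:0, 1:] ^ n * char_poly (B * A) \<noteq> 0"
    using nz[OF mult_carrier_mat[OF A B]] nz[OF cBA] nzX by simp_all
  ultimately have "order z (char_poly (A * B)) + order z ([:0, 1:] ^ m)
      = order z ([:0, 1:] ^ n) + order z (char_poly (B * A))"
    by (metis order_mult)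
  then show ?thesis
    unfolding AB ord mono using n m by auto
qed

lemma walsh_eigval_eq_eig_iff: "walsh_eigval k = eig m \<longleftrightarrow> k = 2 * m"
proof
  assume "walsh_eigval k = eig m"
  then show "k = 2 * m"
    using eig_pos[of m] walsh_eigval_even[of "k div 2"] eig_inj by (cases "even k") (auto simp: walsh_eigval_odd)
qed (simp add: walsh_eigval_even)

lemma walsh_eigval_eq_0_iff: "walsh_eigval k = 0 \<longleftrightarrow> odd k"
  using eig_pos[of "k div 2"] walsh_eigval_even[of "k div 2"] by (cases "even k") (auto simp: walsh_eigval_odd)

text \<open>The alternating sum over all subsets vanishes by orthogonality of \<open>walsh N\<close>
  and \<open>walsh {}\<close>. Odd sizes are exactly those of eigenvalue 0.\<close>

lemma card_odd_subsets:
  assumes "N \<noteq> {}"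
  shows "card {S \<in> Pow N. odd (card S)} = 2 ^ (card N - 1)"
proof -
  have "(\<Sum>S\<in>Pow N. (- 1) ^ card S) = (0 :: real)"
  proof -
    have "(\<Sum>S\<in>Pow N. (- 1) ^ card S) = (\<Sum>S\<in>Pow N. walsh N S * walsh {} S)"
      by (intro sum.cong refl) (auto simp: walsh_power Int_absorb1)
    also have "\<dots> = 0" using walsh_orthogonal[of N "{}"] assms by simp
    finally show ?thesis .
  qed
  moreover have "(\<Sum>S\<in>Pow N. (- 1) ^ card S)
      = (\<Sum>S\<in>Pow N. 1 - 2 * (if odd (card S) then 1 else 0 :: real))"
    by (intro sum.cong) auto
  moreover have "(\<Sum>S\<in>Pow N. if odd (card S) then 1 else 0 :: real) = card {S \<in> Pow N. odd (card S)}"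
    by (subst sum.inter_filter[symmetric]) auto
  ultimately have "2 * real (card {S \<in> Pow N. odd (card S)}) = 2 ^ card N"
    by (simp add: sum_subtractf card_Pow flip: sum_distrib_left)
  moreover have "(2 :: real) ^ card N = 2 * 2 ^ (card N - 1)"
    using assms by (simp add: card_gt_0_iff flip: power_Suc)
  ultimately have "real (card {S \<in> Pow N. odd (card S)}) = real (2 ^ (card N - 1))" by simp
  then show ?thesis by (simp only: of_nat_eq_iff)
qed

lemma order_eig:
  assumes "bij_betw e {..<card perms} perms"
  shows "order (complex_of_real (eig m)) (char_poly (kernel_mat_enum e perms dual_kernel)) = card N choose (2 * m)"
  using order_char_poly_dual_kernel[OF assms, of "complex_of_real (eig m)"] eig_pos[of m] n_subsets[OF fin, of "2 * m"]
  by (simp add: walsh_eigval_eq_eig_iff)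

lemma order_zero:
  assumes "bij_betw e {..<card perms} perms" "N \<noteq> {}"
  shows "order 0 (char_poly (kernel_mat_enum e perms dual_kernel)) + 2 ^ (card N - 1) = fact (card N)"
proof -
  have "(2 :: nat) ^ card N = 2 ^ (card N - 1) + 2 ^ (card N - 1)"
    using assms(2) by (cases "card N") auto
  then show ?thesis
    using order_char_poly_dual_kernel[OF assms(1), of 0] card_odd_subsets[OF assms(2)] by (simp add: walsh_eigval_eq_0_iff)
qed

lemma order_other:
  assumes "bij_betw e {..<card perms} perms" "z \<noteq> 0"
    and "\<And>m. m \<le> card N div 2 \<Longrightarrow> z \<noteq> complex_of_real (eig m)"
  shows "order z (char_poly (kernel_mat_enum e perms dual_kernel)) = 0"
proof -
  have "complex_of_real (walsh_eigval (card S)) \<noteq> z" if "S \<subseteq> N" for S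
  proof (cases "even (card S)")
    case True
    then have "walsh_eigval (card S) = eig (card S div 2)" using walsh_eigval_even[of "card S div 2"] by simp
    then show ?thesis using assms(3)[of "card S div 2"] div_le_mono[OF card_mono[OF fin that], of 2] by auto
  qed (use assms(2) in \<open>simp add: walsh_eigval_odd\<close>)
  then have "{S \<in> Pow N. complex_of_real (walsh_eigval (card S)) = z} = {}" by auto
  then show ?thesis using order_char_poly_dual_kernel[OF assms(1), of z] assms(2) by simp
qed

end

section \<open>Discrete Chebyshev polynomials\<close>

lemma alternating_binomial_sum_Suc:
  fixes f :: "nat \<Rightarrow> real"
  shows "(\<Sum>k\<le>Suc d. (- 1) ^ k * real (Suc d choose k) * f k)
    = (\<Sum>k\<le>d. (- 1) ^ k * real (d choose k) * (f k - f (Suc k)))"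
proof -
  have "(\<Sum>k\<le>Suc d. (- 1) ^ k * real (Suc d choose k) * f k)
    = f 0 + (\<Sum>k\<le>d. (- 1) ^ Suc k * real (d choose Suc k) * f (Suc k))
      - (\<Sum>k\<le>d. (- 1) ^ k * real (d choose k) * f (Suc k))"
    by (subst sum.atMost_Suc_shift) (simp add: algebra_simps sum.distrib sum_negf sum_subtractf)
  also have "f 0 + (\<Sum>k\<le>d. (- 1) ^ Suc k * real (d choose Suc k) * f (Suc k))
    = (\<Sum>k\<le>Suc d. (- 1) ^ k * real (d choose k) * f k)"
    by (subst sum.atMost_Suc_shift) simp
  also have "\<dots> = (\<Sum>k\<le>d. (- 1) ^ k * real (d choose k) * f k)"
    by (simp add: binomial_eq_0)
  finally show ?thesis by (simp add: right_diff_distrib sum_subtractf)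
qed

text \<open>A difference of order \<open>d\<close> annihilates polynomials of degree below
  \<open>d\<close>. The zero polynomial is listed separately because its degree is 0, which matters
  for \<open>d = 0\<close>.\<close>

lemma alternating_binomial_sum_poly:
  fixes p :: "real poly"
  assumes "p = 0 \<or> degree p < d"
  shows "(\<Sum>k\<le>d. (- 1) ^ k * real (d choose k) * poly p (real k)) = 0"
  using assms
proof (induction d arbitrary: p)
  case (Suc d)
  define q where "q = p - pcompose p [:1, 1:]"
  have q: "q = 0 \<or> degree q < d"
  proof (cases "degree p = 0")
    case True
    then obtain c where "p = [:c:]" by (auto elim: degree_eq_zeroE)
    then show ?thesis by (simp add: q_def)
  next
    case False
    have "degree (pcompose p [:1, 1:]) = degree p" by simp
    moreover have "lead_coeff (pcompose p [:1, 1:]) = lead_coeff p"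
      by (subst lead_coeff_comp) simp_all
    ultimately have "degree q \<le> degree p" "coeff q (degree p) = 0"
      unfolding q_def using degree_diff_le_max[of p "pcompose p [:1, 1:]"] by simp_all
    then have "q = 0 \<or> degree q < degree p"
      by (metis degree_less_if_less_eqI)
    then show ?thesis using Suc.prems by auto
  qed
  have "poly q (real k) = poly p (real k) - poly p (real (Suc k))" for k
    by (simp add: q_def poly_pcompose)
  then show ?case
    using Suc.IH[OF q] by (simp only: alternating_binomial_sum_Suc)
qed auto

text \<open>The partial fraction expansion of the reciprocal of \<open>pochhammer a (Suc d)\<close>,
  or equivalently an iterated difference of a reciprocal.\<close>

lemma alternating_binomial_sum_inverse:
  fixes a :: real
  assumes "0 < a"
  shows "(\<Sum>k\<le>d. (- 1) ^ k * real (d choose k) * (1 / (real k + a))) = fact d / pochhammer a (Suc d)"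
  using assms
proof (induction d arbitrary: a)
  case (Suc d)
  have "(\<Sum>k\<le>Suc d. (- 1) ^ k * real (Suc d choose k) * (1 / (real k + a)))
    = (\<Sum>k\<le>d. (- 1) ^ k * real (d choose k) * (1 / (real k + a)))
      - (\<Sum>k\<le>d. (- 1) ^ k * real (d choose k) * (1 / (real k + (a + 1))))"
    unfolding alternating_binomial_sum_Suc by (simp add: right_diff_distrib sum_subtractf add_ac)
  also have "\<dots> = fact d / pochhammer a (Suc d) - fact d / pochhammer (a + 1) (Suc d)"
    using Suc.prems by (simp only: Suc.IH)
  also have "\<dots> = fact (Suc d) / pochhammer a (Suc (Suc d))"
  proof -
    define w where "w = pochhammer (a + 1) d"
    have w: "w > 0" unfolding w_def using Suc.prems by (intro pochhammer_pos) simp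
    have 1: "pochhammer a (Suc d) = a * w" by (simp add: w_def pochhammer_rec)
    have 2: "pochhammer (a + 1) (Suc d) = w * (a + 1 + real d)" by (simp add: w_def pochhammer_Suc)
    have 3: "pochhammer a (Suc (Suc d)) = a * (w * (a + 1 + real d))"
      by (subst pochhammer_rec) (simp add: 2)
    have 4: "f / (a * w) - f / (w * s) = (s - a) * f / (a * (w * s))"
      if "s > 0" for s f :: real
      using w Suc.prems that by (simp add: field_simps)
    have "a + 1 + real d > 0" using Suc.prems by simp
    from 4[OF this] show ?thesis unfolding 1 2 3 by simp
  qed
  finally show ?case .
qed simp

text \<open>Combinatorially, a \<open>(k + j + 1)\<close>-subset of \<open>{0..n}\<close> is
  classified by its \<open>(k + 1)\<close>-st smallest element \<open>x\<close>.\<close>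

lemma sum_choose_mult_choose:
  "(\<Sum>x\<le>n. (x choose k) * ((n - x) choose j)) = Suc n choose (k + j + 1)"
proof (induction n arbitrary: j)
  case 0
  then show ?case by (cases k; cases j) auto
next
  case (Suc n)
  show ?case
  proof (cases j)
    case 0
    then show ?thesis using sum_choose_upper[of k "Suc n"] by (simp del: sum.atMost_Suc)
  next
    case (Suc i)
    have "(\<Sum>x\<le>Suc n. (x choose k) * ((Suc n - x) choose j))
      = (\<Sum>x\<le>n. (x choose k) * ((n - x) choose i)) + (\<Sum>x\<le>n. (x choose k) * ((n - x) choose Suc i))"
      unfolding Suc by (simp add: Suc_diff_le distrib_left sum.distrib)
    then show ?thesis unfolding Suc.IH by (simp add: Suc)
  qed
qed

text \<open>As a polynomial in \<open>t\<close>, the falling factorial of \<open>x - t\<close>; it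
  makes \<open>(n - k) choose j\<close> polynomial in \<open>k\<close>.\<close>

definition falling_poly :: "real \<Rightarrow> nat \<Rightarrow> real poly" where
  "falling_poly x j = (\<Prod>i<j. [:x - real i, - 1:])"

lemma poly_falling_poly: "poly (falling_poly x j) t = (\<Prod>i<j. x - real i - t)"
  by (simp add: falling_poly_def poly_prod)

lemma degree_falling_poly: "degree (falling_poly x j) = j"
  unfolding falling_poly_def by (subst degree_prod_eq_sum_degree) auto

lemma poly_falling_poly_choose:
  assumes "k \<le> n"
  shows "poly (falling_poly (real n) j) (real k) = fact j * real ((n - k) choose j)"
proof -
  have "fact j * real ((n - k) choose j) = (\<Prod>i = 0..<j. real (n - k) - real i)"
    by (simp add: binomial_gbinomial gbinomial_prod_rev)
  then show ?thesis
    using assms by (simp add: poly_falling_poly of_nat_diff algebra_simps atLeast0LessThan)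
qed

definition rising_poly :: "real \<Rightarrow> nat \<Rightarrow> real poly" where
  "rising_poly a m = (\<Prod>i<m. [:a + real i, 1:])"

lemma poly_rising_poly: "poly (rising_poly a m) t = pochhammer (a + t) m"
  by (simp add: rising_poly_def poly_prod pochhammer_prod algebra_simps atLeast0LessThan)

lemma degree_rising_poly: "degree (rising_poly a m) = m"
  unfolding rising_poly_def by (subst degree_prod_eq_sum_degree) auto

lemma fact_eq_pochhammer: "(fact (a + m) :: real) = fact a * pochhammer (real a + 1) m"
  by (induction m) (simp_all add: pochhammer_Suc algebra_simps)

lemma pochhammer_eq_fact_div: "pochhammer (real a + 1) m = fact (a + m) / fact a"
  unfolding fact_eq_pochhammer by (rule nonzero_mult_div_cancel_left[symmetric]) (rule fact_nonzero)

text \<open>Both sides are the proportion of \<open>x\<close>-subsets of \<open>n\<close> points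
  that avoid a given \<open>j\<close>-subset, and the proportion is symmetric in \<open>j\<close>
  and \<open>x\<close>.\<close>

lemma choose_ratio:
  assumes "j \<le> n" "x \<le> n"
  shows "real ((n - j) choose x) / real (n choose x) = real ((n - x) choose j) / real (n choose j)"
proof (cases "j + x \<le> n")
  case True
  have 1: "real ((n - j) choose x) = fact (n - j) / (fact x * fact (n - j - x))"
    using True by (subst binomial_fact) auto
  have 2: "real ((n - x) choose j) = fact (n - x) / (fact j * fact (n - j - x))"
    using True by (subst binomial_fact) (auto simp: add.commute)
  have 3: "real (n choose x) = fact n / (fact x * fact (n - x))"
    "real (n choose j) = fact n / (fact j * fact (n - j))"
    using assms by (simp_all add: binomial_fact)
  show ?thesis unfolding 1 2 3 by simp
next
  case False
  then have "n - x < j" "n - j < x" using assms by linarith+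
  then show ?thesis by (simp add: binomial_eq_0)
qed

text \<open>Coefficients, in the basis \<open>x choose k\<close>, of the discrete Chebyshev
  polynomial on \<open>{0..n}\<close>, the Hahn polynomial
  \<open>3F2(-d, -x, d + 1; 1, -n; 1)\<close>, normalized to be 1 at \<open>x = 0\<close>.\<close>

definition cheb_coeff :: "nat \<Rightarrow> nat \<Rightarrow> nat \<Rightarrow> real" where
  "cheb_coeff n d k = (- 1) ^ k * real (d choose k) * real ((d + k) choose k) / real (n choose k)"

text \<open>The inner product of the Chebyshev function of degree \<open>d\<close> with the
  indicator of avoiding a fixed set of \<open>j\<close> points; see
  \<open>ip_cheb_psi\<close>.\<close>

definition cheb_moment :: "nat \<Rightarrow> nat \<Rightarrow> nat \<Rightarrow> real" where
  "cheb_moment n d j = (\<Sum>k\<le>d. cheb_coeff n d k * (real (Suc n choose (k + j + 1)) / ((real n + 1) * real (n choose j))))"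

text \<open>This isolates the dependence on \<open>k\<close>: \<open>(n - k) choose j\<close> is a
  polynomial of degree \<open>j\<close>, and the quotient of factorials is a polynomial of degree
  \<open>d - j - 1\<close> for \<open>j < d\<close> and \<open>1 / (k + d + 1)\<close> for
  \<open>j = d\<close>. The moment is thus a difference of order \<open>d\<close>.\<close>

lemma cheb_moment_term:
  assumes "d \<le> n" "j \<le> n" "k \<le> d"
  shows "cheb_coeff n d k * (real (Suc n choose (k + j + 1)) / ((real n + 1) * real (n choose j)))
    = (- 1) ^ k * real (d choose k) * (fact (d + k) / fact (k + j + 1) * real ((n - k) choose j))
      * (fact j / (fact d * real (n choose j)))"
proof (cases "k + j \<le> n")
  case True
  have 1: "real (Suc n choose (k + j + 1)) = (real n + 1) * fact n / (fact (k + j + 1) * fact (n - k - j))"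
    using True by (subst binomial_fact) (auto simp: add_ac)
  have 2: "real ((d + k) choose k) = fact (d + k) / (fact k * fact d)"
    by (subst binomial_fact) auto
  have 3: "real (n choose k) = fact n / (fact k * fact (n - k))"
    using assms by (simp add: binomial_fact)
  have 4: "real ((n - k) choose j) = fact (n - k) / (fact j * fact (n - k - j))"
    using True by (subst binomial_fact) auto
  have nz: "real n + 1 \<noteq> 0" by linarith
  define F where "F = (fact (k + j + 1) :: real)"
  have F: "F \<noteq> 0" by (simp add: F_def)
  define C where "C = real (n choose j)"
  have C: "C \<noteq> 0" using assms by (simp add: C_def)
  show ?thesis
    unfolding cheb_coeff_def 1 2 3 4 F_def[symmetric] C_def[symmetric]
    using nz F C by simp
next
  case False
  then have "n - k < j" "n < k + j" using assms by linarith+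
  then show ?thesis by (simp add: binomial_eq_0)
qed

text \<open>The polynomial under the difference has degree at most \<open>j + (d - j - 1)\<close>,
  which is below \<open>d\<close>.\<close>

lemma cheb_moment_eq_0:
  assumes "d \<le> n" "j < d"
  shows "cheb_moment n d j = 0"
proof -
  define p where "p = falling_poly (real n) j * rising_poly (real j + 2) (d - Suc j)"
  have "degree p \<le> j + (d - Suc j)"
    using degree_mult_le[of "falling_poly (real n) j" "rising_poly (real j + 2) (d - Suc j)"]
    by (simp add: p_def degree_falling_poly degree_rising_poly)
  then have "degree p < d" using assms by simp
  then have p0: "(\<Sum>k\<le>d. (- 1) ^ k * real (d choose k) * poly p (real k)) = 0"
    by (intro alternating_binomial_sum_poly) simp
  have "cheb_coeff n d k * (real (Suc n choose (k + j + 1)) / ((real n + 1) * real (n choose j)))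
      = (- 1) ^ k * real (d choose k) * poly p (real k) * (1 / (fact d * real (n choose j)))"
    if k: "k \<le> d" for k
  proof -
    have e: "d + k = (k + j + 1) + (d - Suc j)" using assms by simp
    have "(fact (d + k) :: real) = fact (k + j + 1) * pochhammer (real (k + j + 1) + 1) (d - Suc j)"
      unfolding e by (rule fact_eq_pochhammer)
    then have f: "fact (d + k) / fact (k + j + 1) = pochhammer (real j + 2 + real k) (d - Suc j)"
      by (simp add: add_ac)
    have c: "real ((n - k) choose j) = poly (falling_poly (real n) j) (real k) / fact j"
      using k assms by (simp add: poly_falling_poly_choose)
    have "j \<le> n" using assms by simp
    show ?thesis
      unfolding cheb_moment_term[OF assms(1) \<open>j \<le> n\<close> k] f c p_def poly_mult poly_rising_poly
      by (simp add: mult_ac)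
  qed
  then have "cheb_moment n d j
      = (\<Sum>k\<le>d. (- 1) ^ k * real (d choose k) * poly p (real k) * (1 / (fact d * real (n choose j))))"
    unfolding cheb_moment_def by (intro sum.cong) auto
  then show ?thesis using p0 by (simp only: sum_distrib_right[symmetric])
qed

text \<open>The difference is applied to \<open>q(k) / (k + d + 1)\<close>. Division of
  \<open>q\<close> by the linear factor with root \<open>b\<close> leaves a quotient of degree below
  \<open>d\<close>, which is annihilated, and a remainder handled by
  \<open>alternating_binomial_sum_inverse\<close>.\<close>

lemma cheb_moment_self:
  assumes "d \<le> n"
  shows "cheb_moment n d d = fact d * fact (n + d + 1) / (real (n choose d) * fact (n + 1) * fact (2 * d + 1))"
proof -
  define q where "q = falling_poly (real n) d"
  define b where "b = - (real d + 1)"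
  define r where "r = synthetic_div q b"
  have qr: "poly q t = poly q b + (t - b) * poly r t" for t
  proof -
    have "poly q t = poly ([:- b, 1:] * r + [:poly q b:]) t"
      unfolding r_def synthetic_div_correct' ..
    then show ?thesis by (simp add: algebra_simps)
  qed
  have "degree r = d - 1" by (simp add: r_def degree_synthetic_div q_def degree_falling_poly)
  moreover have "r = 0" if "d = 0"
    using that by (simp add: r_def q_def falling_poly_def synthetic_div_eq_0_iff)
  ultimately have "r = 0 \<or> degree r < d" by (cases d) auto
  then have r0: "(\<Sum>k\<le>d. (- 1) ^ k * real (d choose k) * poly r (real k)) = 0"
    by (rule alternating_binomial_sum_poly)
  have "cheb_coeff n d k * (real (Suc n choose (k + d + 1)) / ((real n + 1) * real (n choose d)))
      = (1 / (fact d * real (n choose d))) * (poly q b * ((- 1) ^ k * real (d choose k) * (1 / (real k + (real d + 1))))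
        + (- 1) ^ k * real (d choose k) * poly r (real k))"
    if k: "k \<le> d" for k
  proof -
    have pos: "real k + (real d + 1) > 0" by simp
    have f: "fact (d + k) / fact (k + d + 1) = 1 / (real k + (real d + 1))"
      by (simp add: add_ac)
    have c: "real ((n - k) choose d) = poly q (real k) / fact d"
      using k assms by (simp add: q_def poly_falling_poly_choose)
    have "poly q (real k) = poly q b + (real k + (real d + 1)) * poly r (real k)"
      using qr[of "real k"] by (simp add: b_def)
    then have q1: "1 / (real k + (real d + 1)) * poly q (real k)
        = poly q b * (1 / (real k + (real d + 1))) + poly r (real k)"
      using pos by (simp add: field_simps)
    have "cheb_coeff n d k * (real (Suc n choose (k + d + 1)) / ((real n + 1) * real (n choose d)))
      = (1 / (fact d * real (n choose d))) * ((- 1) ^ k * real (d choose k) * (1 / (real k + (real d + 1)) * poly q (real k)))"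
      unfolding cheb_moment_term[OF assms assms k] f c by simp
    also have "\<dots> = (1 / (fact d * real (n choose d))) * (poly q b * ((- 1) ^ k * real (d choose k) * (1 / (real k + (real d + 1))))
        + (- 1) ^ k * real (d choose k) * poly r (real k))"
      unfolding q1 by (simp add: algebra_simps)
    finally show ?thesis .
  qed
  then have "cheb_moment n d d = (\<Sum>k\<le>d. (1 / (fact d * real (n choose d)))
      * (poly q b * ((- 1) ^ k * real (d choose k) * (1 / (real k + (real d + 1))))
        + (- 1) ^ k * real (d choose k) * poly r (real k)))"
    unfolding cheb_moment_def by (intro sum.cong) auto
  also have "\<dots> = (1 / (fact d * real (n choose d)))
      * (poly q b * (\<Sum>k\<le>d. (- 1) ^ k * real (d choose k) * (1 / (real k + (real d + 1)))))"
    by (simp only: sum_distrib_left[symmetric] sum.distrib r0 add_0_right)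
  also have "(\<Sum>k\<le>d. (- 1) ^ k * real (d choose k) * (1 / (real k + (real d + 1))))
      = fact d / pochhammer (real d + 1) (Suc d)"
    by (rule alternating_binomial_sum_inverse) simp
  also have "pochhammer (real d + 1) (Suc d) = fact (2 * d + 1) / fact d"
  proof -
    have e: "2 * d + 1 = d + Suc d" by simp
    show ?thesis unfolding e by (rule pochhammer_eq_fact_div)
  qed
  also have "poly q b = fact (n + d + 1) / fact (n + 1)"
  proof -
    have "poly q b = (\<Prod>i<d. real (n + 2) + real (d - Suc i))"
      unfolding q_def poly_falling_poly b_def by (intro prod.cong) (auto simp: of_nat_diff)
    also have "\<dots> = (\<Prod>i<d. real (n + 2) + real i)"
      by (rule prod.nat_diff_reindex)
    also have "\<dots> = pochhammer (real (n + 1) + 1) d"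
      by (simp add: pochhammer_prod atLeast0LessThan add_ac)
    also have "\<dots> = fact (n + d + 1) / fact (n + 1)"
    proof -
      have e: "n + d + 1 = (n + 1) + d" by simp
      show ?thesis unfolding e by (rule pochhammer_eq_fact_div)
    qed
    finally show ?thesis .
  qed
  finally have eq: "cheb_moment n d d = 1 / (fact d * real (n choose d))
      * (fact (n + d + 1) / fact (n + 1) * (fact d / (fact (2 * d + 1) / fact d)))" .
  have "1 / (f * C) * (A / B * (f / (E / f))) = f * A / (C * B * E)" if "f \<noteq> 0"
    for f A B C E :: real
    using that by (simp add: mult_ac)
  from this[OF fact_nonzero] show ?thesis unfolding eq .
qed

text \<open>The induction step amounts to \<open>(2m + 1)(2m + 3) \<le> (2m + 2)^2\<close>.\<close>

lemma eig_le_inverse: "eig m \<le> 1 / (2 * real m + 1)"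
proof (induction m)
  case (Suc m)
  have "eig (Suc m) \<le> ((2 * real m + 1) / (2 * (real m + 1)))\<^sup>2 * (1 / (2 * real m + 1))"
    unfolding eig_Suc using Suc by (intro mult_left_mono) auto
  also have "\<dots> = (2 * real m + 1) / (2 * (real m + 1))\<^sup>2"
    by (simp add: power_divide power2_eq_square)
  also have "\<dots> \<le> 1 / (2 * real (Suc m) + 1)"
    by (simp add: divide_simps power2_eq_square) (simp add: algebra_simps)
  finally show ?case .
qed simp

text \<open>Built to telescope. The factor \<open>4m + 1\<close> is \<open>2d + 1\<close> at
  \<open>d = 2m\<close>, the bound on a reciprocal squared norm; the fourth power arises from
  squaring the effect of two steps.\<close>

lemma eig_power4_bound:
  assumes "0 < m"
  shows "(4 * real m + 1) * eig m ^ 4 \<le> 1 / 8 * (1 / (real m)\<^sup>2 - 1 / (real m + 1)\<^sup>2)"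
proof -
  define x where "x = real m"
  have x: "x > 0" using assms by (simp add: x_def)
  have "eig m ^ 4 \<le> (1 / (2 * x + 1)) ^ 4"
    using eig_le_inverse[of m] eig_pos[of m] by (intro power_mono) (auto simp: x_def)
  then have "(4 * x + 1) * eig m ^ 4 \<le> (4 * x + 1) * (1 / (2 * x + 1)) ^ 4"
    using x by (intro mult_left_mono) auto
  also have "\<dots> = (4 * x + 1) / (2 * x + 1) ^ 4" by (simp add: power_divide)
  also have "\<dots> \<le> (4 * x + 1) / (16 * (x\<^sup>2 * (x + 1)\<^sup>2))"
  proof (rule divide_left_mono)
    have "(4 * (x * (x + 1)))\<^sup>2 \<le> ((2 * x + 1)\<^sup>2)\<^sup>2"
      using x by (intro power_mono) (auto simp: power2_eq_square algebra_simps)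
    then show "16 * (x\<^sup>2 * (x + 1)\<^sup>2) \<le> (2 * x + 1) ^ 4"
      by (simp add: power_mult_distrib flip: power_mult)
  qed (use x in auto)
  also have "\<dots> \<le> (4 * x + 2) / (16 * (x\<^sup>2 * (x + 1)\<^sup>2))"
    using x by (intro divide_right_mono) auto
  also have "\<dots> = 1 / 8 * (1 / x\<^sup>2 - 1 / (x + 1)\<^sup>2)"
    using x by (simp add: divide_simps) (simp add: power2_eq_square algebra_simps)
  finally show ?thesis by (simp add: x_def)
qed

section \<open>Chebyshev polynomials as functions of sets\<close>

context finite_ground
begin

lemma sum_walsh_eigval_power4: "(\<Sum>d = 1..2 * M + 1. walsh_eigval d ^ 4 * (2 * real d + 1)) \<le> 1 / 8 * (1 - 1 / (real M + 1)\<^sup>2)"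
proof (induction M)
  case (Suc M)
  have "(\<Sum>d = 1..2 * Suc M + 1. walsh_eigval d ^ 4 * (2 * real d + 1))
    = (\<Sum>d = 1..2 * M + 1. walsh_eigval d ^ 4 * (2 * real d + 1)) + (4 * real (Suc M) + 1) * eig (Suc M) ^ 4"
    using walsh_eigval_even[of "Suc M"] walsh_eigval_odd[of "2 * Suc M + 1"] by (simp add: algebra_simps)
  also have "\<dots> \<le> 1 / 8 * (1 - 1 / (real M + 1)\<^sup>2)
      + 1 / 8 * (1 / (real (Suc M))\<^sup>2 - 1 / (real (Suc M) + 1)\<^sup>2)"
    by (intro add_mono Suc eig_power4_bound) simp
  also have "\<dots> = 1 / 8 * (1 - 1 / (real (Suc M) + 1)\<^sup>2)"
    by (simp add: add_ac diff_divide_distrib)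
  finally show ?case .
qed (simp add: walsh_eigval_odd)

text \<open>Avoidance indicators are the convenient test functions: an inner product with
  \<open>psi A\<close> is a sum over all subsets of \<open>N - A\<close>, with no further
  constraint.\<close>

definition psi :: "'a set \<Rightarrow> 'a set \<Rightarrow> real" where
  "psi A Y = (if A \<inter> Y = {} then 1 else 0)"

definition cheb :: "nat \<Rightarrow> 'a set \<Rightarrow> real" where
  "cheb d Y = (\<Sum>k\<le>d. cheb_coeff (card N) d k * real (card Y choose k))"

lemma psi_prod:
  assumes "finite A"
  shows "psi A Y = (\<Prod>i\<in>A. if i \<in> Y then 0 else 1)"
proof (cases "A \<inter> Y = {}")
  case True
  then show ?thesis unfolding psi_def by (subst prod.neutral) auto
next
  case False
  then show ?thesis using assms unfolding psi_def by (subst prod_zero) auto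
qed

text \<open>Each sign is \<open>2 * [i \<notin> Y] - 1\<close>; expand the product.\<close>

lemma walsh_psi:
  assumes "finite T"
  shows "walsh T Y = (\<Sum>X\<in>Pow T. (2 ^ card X * (- 1) ^ card (T - X)) * psi X Y)"
proof -
  have "walsh T Y = (\<Prod>i\<in>T. 2 * (if i \<in> Y then 0 else 1) + - 1)"
    unfolding walsh_def by (intro prod.cong) auto
  also have "\<dots> = (\<Sum>X\<in>Pow T. (\<Prod>i\<in>X. 2 * (if i \<in> Y then 0 else 1)) * (\<Prod>i\<in>T - X. - 1))"
    using assms by (rule prod_add)
  also have "\<dots> = (\<Sum>X\<in>Pow T. (2 ^ card X * (- 1) ^ card (T - X)) * psi X Y)"
    using assms by (intro sum.cong refl) (simp add: psi_prod prod.distrib finite_subset)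
  finally show ?thesis .
qed

lemma subset_psi:
  assumes "finite A"
  shows "(if A \<subseteq> Y then 1 else 0) = (\<Sum>X\<in>Pow A. (- 1) ^ card X * psi X Y)"
proof -
  have "(if A \<subseteq> Y then 1 else 0) = (\<Prod>i\<in>A. - (if i \<in> Y then 0 else 1) + 1 :: real)"
  proof (cases "A \<subseteq> Y")
    case True
    then show ?thesis by (subst prod.neutral) auto
  next
    case False
    then show ?thesis using assms by (subst prod_zero) auto
  qed
  also have "\<dots> = (\<Sum>X\<in>Pow A. (\<Prod>i\<in>X. - (if i \<in> Y then 0 else 1)) * (\<Prod>i\<in>A - X. 1))"
    using assms by (rule prod_add)
  also have "\<dots> = (\<Sum>X\<in>Pow A. (- 1) ^ card X * psi X Y)"
    using assms by (intro sum.cong refl) (simp add: psi_prod prod_uminus finite_subset)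
  finally show ?thesis .
qed

lemma choose_card_eq_sum:
  assumes "Y \<subseteq> N"
  shows "real (card Y choose k) = (\<Sum>A | A \<subseteq> N \<and> card A = k. if A \<subseteq> Y then 1 else 0)"
proof -
  have "real (card Y choose k) = real (card {A. A \<subseteq> Y \<and> card A = k})"
    using n_subsets[OF finite_sub[OF assms], of k] by simp
  also have "\<dots> = (\<Sum>A | A \<subseteq> N \<and> card A = k. if A \<subseteq> Y then 1 else 0)"
  proof -
    have "{A. A \<subseteq> Y \<and> card A = k} = {A \<in> {A. A \<subseteq> N \<and> card A = k}. A \<subseteq> Y}" using assms by auto
    moreover have "finite {A. A \<subseteq> N \<and> card A = k}" by simp
    ultimately show ?thesis by (simp add: sum.inter_filter[symmetric])
  qed
  finally show ?thesis .
qed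

lemma ip_sum_right: "ip h (\<lambda>Y. \<Sum>i\<in>I. c i * f i Y) = (\<Sum>i\<in>I. c i * ip h (f i))"
  using ip_sum[of c f I h] by (simp add: ip_commute[of h])

text \<open>By \<open>choose_ratio\<close>, the number of sets of size \<open>x\<close> avoiding
  \<open>A\<close>, divided by the size of the level, becomes \<open>(n - x) choose card A\<close>
  up to a constant; then \<open>sum_choose_mult_choose\<close> applies.\<close>

lemma ip_choose_psi:
  assumes A: "A \<subseteq> N"
  shows "ip (\<lambda>Y. real (card Y choose k)) (psi A)
    = real (Suc (card N) choose (k + card A + 1)) / ((real (card N) + 1) * real (card N choose card A))"
proof -
  let ?n = "card N" and ?j = "card A"
  have j: "?j \<le> ?n" using A by (simp add: card_mono)
  have cNA: "card (N - A) = ?n - ?j" using A by (simp add: card_Diff_subset)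
  have "ip (\<lambda>Y. real (card Y choose k)) (psi A)
    = (\<Sum>Y\<in>Pow (N - A). 1 / ((real ?n + 1) * real (?n choose card Y)) * real (card Y choose k))"
    unfolding ip_def
    by (rule sum.mono_neutral_cong_right) (auto simp: psi_def weight_def)
  also have "\<dots> = (\<Sum>x\<le>?n - ?j. real ((?n - ?j) choose x) * (1 / ((real ?n + 1) * real (?n choose x)) * real (x choose k)))"
    using sum_Pow_card[of "N - A" "\<lambda>x. 1 / ((real ?n + 1) * real (?n choose x)) * real (x choose k)"]
    by (simp add: cNA)
  also have "\<dots> = (\<Sum>x\<le>?n. real ((?n - ?j) choose x) * (1 / ((real ?n + 1) * real (?n choose x)) * real (x choose k)))"
    by (rule sum.mono_neutral_left) (auto simp: binomial_eq_0)
  also have "\<dots> = (\<Sum>x\<le>?n. real ((x choose k) * ((?n - x) choose ?j)) / ((real ?n + 1) * real (?n choose ?j)))"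
  proof (rule sum.cong[OF refl])
    fix x assume "x \<in> {..?n}"
    then have "real ((?n - ?j) choose x) / real (?n choose x) = real ((?n - x) choose ?j) / real (?n choose ?j)"
      using j by (intro choose_ratio) auto
    moreover have "real ((?n - ?j) choose x) * (1 / ((real ?n + 1) * real (?n choose x)) * real (x choose k))
      = real ((?n - ?j) choose x) / real (?n choose x) * (real (x choose k) / (real ?n + 1))" by simp
    ultimately show "real ((?n - ?j) choose x) * (1 / ((real ?n + 1) * real (?n choose x)) * real (x choose k))
      = real ((x choose k) * ((?n - x) choose ?j)) / ((real ?n + 1) * real (?n choose ?j))"
      by (simp add: mult_ac)
  qed
  also have "\<dots> = real (\<Sum>x\<le>?n. (x choose k) * ((?n - x) choose ?j)) / ((real ?n + 1) * real (?n choose ?j))"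
    by (simp add: sum_divide_distrib)
  finally show ?thesis by (simp only: sum_choose_mult_choose)
qed

lemma ip_cheb_psi:
  assumes "A \<subseteq> N"
  shows "ip (cheb d) (psi A) = cheb_moment (card N) d (card A)"
  unfolding cheb_def cheb_moment_def
  by (subst ip_sum) (simp add: ip_choose_psi[OF assms])

lemma ip_cheb_walsh:
  assumes "d \<le> card N" "T \<subseteq> N" "card T < d"
  shows "ip (cheb d) (walsh T) = 0"
proof -
  have fT: "finite T" using assms by simp
  have "ip (cheb d) (walsh T) = ip (cheb d) (\<lambda>Y. \<Sum>X\<in>Pow T. (2 ^ card X * (- 1) ^ card (T - X)) * psi X Y)"
    by (simp only: walsh_psi[OF fT, abs_def])
  also have "\<dots> = (\<Sum>X\<in>Pow T. (2 ^ card X * (- 1) ^ card (T - X)) * ip (cheb d) (psi X))"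
    by (rule ip_sum_right)
  also have "\<dots> = 0"
  proof (intro sum.neutral ballI)
    fix X assume X: "X \<in> Pow T"
    then have "card X < d" "X \<subseteq> N" using assms card_mono[OF fT, of X] by auto
    then show "2 ^ card X * (- 1) ^ card (T - X) * ip (cheb d) (psi X) = 0"
      using assms by (simp add: ip_cheb_psi cheb_moment_eq_0)
  qed
  finally show ?thesis .
qed

text \<open>Orthogonality holds against all functions of lower degree, not only against those
  depending on the cardinality; \<open>burnside_cheb\<close> relies on this.\<close>

lemma ip_cheb_deg:
  assumes "d \<le> card N" "deg e f" "e < d"
  shows "ip (cheb d) f = 0"
proof -
  have "ip (cheb d) f = ip (cheb d) (\<lambda>Y. \<Sum>S\<in>Pow N. fourier f S * walsh S Y)"
    by (rule ip_cong[OF refl]) (rule fourier_inversion)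
  also have "\<dots> = (\<Sum>S\<in>Pow N. fourier f S * ip (cheb d) (walsh S))"
    by (rule ip_sum_right)
  also have "\<dots> = 0"
  proof (intro sum.neutral ballI)
    fix S assume S: "S \<in> Pow N"
    show "fourier f S * ip (cheb d) (walsh S) = 0"
      using assms S ip_cheb_walsh[of d S] by (cases "card S < d") (auto simp: deg_def)
  qed
  finally show ?thesis .
qed

lemma deg_subset_indicator: "deg (card A) (\<lambda>Y. if A \<subseteq> Y then 1 else 0)" if "A \<subseteq> N"
  unfolding deg_def
proof (intro allI impI)
  fix S assume S: "S \<subseteq> N" "card A < card S"
  then have "\<not> S \<subseteq> A" using that card_mono[of A S] by auto
  then obtain i where i: "i \<in> S" "i \<notin> A" by blast
  then have "A \<subseteq> insert i Y \<longleftrightarrow> A \<subseteq> Y" for Y by auto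
  then show "fourier (\<lambda>Y. if A \<subseteq> Y then 1 else 0) S = 0"
    by (intro fourier_local[OF S(1) i(1)]) simp
qed

lemma deg_choose:
  assumes "k \<le> d"
  shows "deg d (\<lambda>Y. real (card Y choose k))"
  unfolding deg_def
proof (intro allI impI)
  fix S assume S: "S \<subseteq> N" "d < card S"
  have "fourier (\<lambda>Y. real (card Y choose k)) S
    = fourier (\<lambda>Y. \<Sum>A | A \<subseteq> N \<and> card A = k. 1 * (if A \<subseteq> Y then 1 else 0)) S"
    by (rule fourier_cong) (simp add: choose_card_eq_sum)
  also have "\<dots> = (\<Sum>A | A \<subseteq> N \<and> card A = k. 1 * fourier (\<lambda>Y. if A \<subseteq> Y then 1 else 0) S)"
    by (rule fourier_sum)
  also have "\<dots> = 0"
    using deg_subset_indicator assms S by (intro sum.neutral) (auto simp: deg_def)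
  finally show "fourier (\<lambda>Y. real (card Y choose k)) S = 0" .
qed

lemma deg_cheb: "deg d (cheb d)"
  unfolding deg_def cheb_def fourier_sum using deg_choose[of _ d]
  by (auto simp: deg_def intro!: sum.neutral)

lemma cheb_0: "cheb 0 Y = 1"
  by (simp add: cheb_def cheb_coeff_def)

lemma cheb_empty: "cheb d {} = 1"
proof -
  have "cheb d {} = (\<Sum>k\<le>d. if k = 0 then 1 else 0)"
    unfolding cheb_def by (intro sum.cong) (auto simp: cheb_coeff_def)
  then show ?thesis by simp
qed

lemma ip_cheb_cheb_neq:
  assumes "d \<le> card N" "e \<le> card N" "d \<noteq> e"
  shows "ip (cheb d) (cheb e) = 0"
  using assms ip_cheb_deg[OF _ deg_cheb, of d e] ip_cheb_deg[OF _ deg_cheb, of e d]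
  by (cases d e rule: linorder_cases) (auto simp: ip_commute[of "cheb d"])

text \<open>Only the leading term \<open>card Y choose d\<close> survives on one side. It is a sum
  of indicators of containing a \<open>d\<close>-set \<open>A\<close>, and in the expansion of each
  by avoidance indicators only \<open>X = A\<close> has a nonzero moment.\<close>

lemma ip_cheb_cheb_self:
  assumes d: "d \<le> card N"
  shows "ip (cheb d) (cheb d)
    = fact (card N - d) * fact (card N + d + 1) / ((2 * real d + 1) * fact (card N) * fact (card N + 1))"
proof -
  let ?n = "card N"
  have "ip (cheb d) (cheb d) = (\<Sum>k\<le>d. cheb_coeff ?n d k * ip (cheb d) (\<lambda>Y. real (card Y choose k)))"
    by (subst (2) cheb_def[abs_def]) (rule ip_sum_right)
  also have "\<dots> = (\<Sum>k\<le>d. if k = d then cheb_coeff ?n d d * ip (cheb d) (\<lambda>Y. real (card Y choose d)) else 0)"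
  proof (rule sum.cong[OF refl])
    fix k assume k: "k \<in> {..d}"
    show "cheb_coeff ?n d k * ip (cheb d) (\<lambda>Y. real (card Y choose k))
      = (if k = d then cheb_coeff ?n d d * ip (cheb d) (\<lambda>Y. real (card Y choose d)) else 0)"
    proof (cases "k = d")
      case False
      then have "ip (cheb d) (\<lambda>Y. real (card Y choose k)) = 0"
        using k d by (intro ip_cheb_deg[OF d deg_choose[OF order_refl]]) auto
      then show ?thesis using False by simp
    qed simp
  qed
  also have "\<dots> = cheb_coeff ?n d d * ip (cheb d) (\<lambda>Y. real (card Y choose d))" by simp
  also have "ip (cheb d) (\<lambda>Y. real (card Y choose d))
    = ip (cheb d) (\<lambda>Y. \<Sum>A | A \<subseteq> N \<and> card A = d. 1 * (if A \<subseteq> Y then 1 else 0))"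
    by (rule ip_cong[OF refl]) (simp add: choose_card_eq_sum)
  also have "\<dots> = (\<Sum>A | A \<subseteq> N \<and> card A = d. 1 * ip (cheb d) (\<lambda>Y. if A \<subseteq> Y then 1 else 0))"
    by (rule ip_sum_right)
  also have "\<dots> = (\<Sum>A | A \<subseteq> N \<and> card A = d. (- 1) ^ d * cheb_moment ?n d d)"
  proof (rule sum.cong[OF refl])
    fix A assume "A \<in> {A. A \<subseteq> N \<and> card A = d}"
    then have A: "A \<subseteq> N" "card A = d" "finite A" by auto
    have "ip (cheb d) (\<lambda>Y. if A \<subseteq> Y then 1 else 0) = ip (cheb d) (\<lambda>Y. \<Sum>X\<in>Pow A. (- 1) ^ card X * psi X Y)"
      by (simp only: subset_psi[OF A(3)])
    also have "\<dots> = (\<Sum>X\<in>Pow A. (- 1) ^ card X * ip (cheb d) (psi X))" by (rule ip_sum_right)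
    also have "\<dots> = (\<Sum>X\<in>Pow A. if X = A then (- 1) ^ d * cheb_moment ?n d d else 0)"
    proof (rule sum.cong[OF refl])
      fix X assume X: "X \<in> Pow A"
      show "(- 1) ^ card X * ip (cheb d) (psi X) = (if X = A then (- 1) ^ d * cheb_moment ?n d d else 0)"
      proof (cases "X = A")
        case True
        then show ?thesis using A by (simp add: ip_cheb_psi)
      next
        case False
        then have "card X < d" "X \<subseteq> N" using X A psubset_card_mono[OF A(3), of X] by auto
        then show ?thesis using False d by (simp add: ip_cheb_psi cheb_moment_eq_0)
      qed
    qed
    also have "\<dots> = (- 1) ^ d * cheb_moment ?n d d" using A(3) by (simp add: sum.delta)
    finally show "1 * ip (cheb d) (\<lambda>Y. if A \<subseteq> Y then 1 else 0) = (- 1) ^ d * cheb_moment ?n d d" by simp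
  qed
  also have "\<dots> = real (?n choose d) * ((- 1) ^ d * cheb_moment ?n d d)"
    using n_subsets[OF fin, of d] by simp
  finally have eq: "ip (cheb d) (cheb d)
    = cheb_coeff ?n d d * (real (?n choose d) * ((- 1) ^ d * cheb_moment ?n d d))" .
  have nd: "real (?n choose d) = fact ?n / (fact d * fact (?n - d))" using d by (simp add: binomial_fact)
  have dd: "real ((d + d) choose d) = fact (2 * d) / (fact d * fact d)"
    by (subst binomial_fact) (auto simp: mult_2)
  have f: "(fact (2 * d + 1) :: real) = (2 * real d + 1) * fact (2 * d)" by simp
  have s: "(- 1) ^ d * (- 1) ^ d = (1 :: real)" by (simp flip: power_add)
  have nz: "2 * real d + 1 \<noteq> 0" by linarith
  define Q where "Q = 2 * real d + 1"
  define E where "E = (fact (2 * d) :: real)"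
  define F where "F = (fact (?n + d + 1) :: real)"
  define G where "G = (fact (?n + 1) :: real)"
  have "ip (cheb d) (cheb d) = ((- 1) ^ d * (- 1) ^ d) * (real ((d + d) choose d) * cheb_moment ?n d d)"
    unfolding eq cheb_coeff_def using d by simp
  also have "\<dots> = E / (fact d * fact d) * (fact d * F / (fact ?n / (fact d * fact (?n - d)) * G * (Q * E)))"
    unfolding s cheb_moment_self[OF d] dd f nd E_def F_def G_def Q_def by simp
  also have "\<dots> = fact (?n - d) * F / (Q * fact ?n * G)"
    using nz by (simp add: E_def G_def Q_def divide_simps)
  finally show ?thesis by (simp only: F_def Q_def G_def)
qed

text \<open>The defect \<open>g\<close> has degree below \<open>d\<close> by triangularity, and it
  is orthogonal to every function of degree below \<open>d\<close>, since \<open>burnside\<close> is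
  self-adjoint and preserves the degree. Hence it is orthogonal to itself.\<close>

lemma burnside_cheb:
  assumes d: "d \<le> card N" and Y: "Y \<subseteq> N"
  shows "burnside (cheb d) Y = walsh_eigval d * cheb d Y"
proof (cases d)
  case 0
  have "cheb 0 = (\<lambda>_. 1)" by (rule ext) (rule cheb_0)
  then show ?thesis using 0 by simp
next
  case (Suc e)
  define g where "g = (\<lambda>Y. burnside (cheb d) Y - walsh_eigval d * cheb d Y)"
  have g: "deg e g" unfolding g_def Suc by (rule deg_burnside_step[OF deg_cheb])
  have "ip g h = ip (burnside (cheb d)) h - walsh_eigval d * ip (cheb d) h" for h
    using ip_linear[of 1 "burnside (cheb d)" "- walsh_eigval d" "cheb d" h] by (simp add: g_def)
  moreover have "ip (burnside (cheb d)) g = 0"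
    unfolding burnside_self_adjoint by (rule ip_cheb_deg[OF d deg_burnside[OF g]]) (simp add: Suc)
  moreover have "ip (cheb d) g = 0" by (rule ip_cheb_deg[OF d g]) (simp add: Suc)
  ultimately have "ip g g = 0" by simp
  then have "g Y = 0" using Y by (rule ip_eq_0)
  then show ?thesis by (simp add: g_def)
qed

end

section \<open>Starting from a long cycle\<close>

context finite_ground
begin

definition cheb_norm :: "nat \<Rightarrow> real" where
  "cheb_norm d = ip (cheb d) (cheb d)"

lemma cheb_norm_pos: "d \<le> card N \<Longrightarrow> 0 < cheb_norm d"
  by (simp add: cheb_norm_def ip_cheb_cheb_self del: fact_Suc)

lemma inverse_cheb_norm:
  assumes "d \<le> card N"
  shows "1 / cheb_norm d = (2 * real d + 1) *
    (fact (card N) * fact (card N + 1) / (fact (card N - d) * fact (card N + d + 1)))"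
  unfolding cheb_norm_def ip_cheb_cheb_self[OF assms] by (simp add: mult_ac del: fact_Suc)

text \<open>Raising \<open>d\<close> by one trades a factor \<open>n - d\<close> of the denominator
  for the larger factor \<open>n + d + 2\<close>.\<close>

lemma inverse_cheb_norm_le:
  assumes "d \<le> card N"
  shows "1 / cheb_norm d \<le> 2 * real d + 1"
proof -
  let ?n = "card N"
  have "(fact ?n * fact (?n + 1) :: real) \<le> fact (?n - d) * fact (?n + d + 1)"
    using assms
  proof (induction d)
    case (Suc d)
    have 1: "(fact (?n - d) :: real) = real (?n - d) * fact (?n - Suc d)"
      using Suc.prems by (metis Suc_diff_Suc Suc_le_lessD fact_Suc of_nat_fact of_nat_mult)
    have 2: "(fact (?n + Suc d + 1) :: real) = real (?n + d + 2) * fact (?n + d + 1)"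
      by (metis add_2_eq_Suc' add_Suc_right fact_Suc of_nat_fact of_nat_mult Suc_eq_plus1)
    have "fact ?n * fact (?n + 1) \<le> real (?n - d) * (fact (?n - Suc d) * fact (?n + d + 1))"
      using Suc by (simp add: 1 mult.assoc del: fact_Suc)
    also have "\<dots> \<le> real (?n + d + 2) * (fact (?n - Suc d) * fact (?n + d + 1))"
      by (intro mult_right_mono) auto
    finally show ?case unfolding 2 by (simp add: mult_ac del: fact_Suc)
  qed (simp del: fact_Suc)
  then have "fact ?n * fact (?n + 1) / (fact (?n - d) * fact (?n + d + 1)) \<le> (1 :: real)"
    by (subst divide_le_eq_1) (simp add: not_le del: fact_Suc)
  then have "(2 * real d + 1) * (fact ?n * fact (?n + 1) / (fact (?n - d) * fact (?n + d + 1)))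
      \<le> (2 * real d + 1) * 1"
    by (intro mult_left_mono) auto
  then show ?thesis unfolding inverse_cheb_norm[OF assms] by simp
qed

text \<open>This is the value at \<open>{}\<close> of the expansion of \<open>empty_dens\<close>. It
  telescopes because \<open>2d + 1\<close> is the difference of \<open>n + d + 1\<close> and
  \<open>n - d\<close>.\<close>

lemma sum_inverse_cheb_norm: "(\<Sum>d\<le>card N. 1 / cheb_norm d) = real (card N) + 1"
proof -
  let ?n = "card N"
  define r :: "nat \<Rightarrow> real" where "r d = fact ?n * fact (?n + 1) / (fact (?n - d) * fact (?n + d))" for d
  have step: "1 / cheb_norm d = r d - r (Suc d)" if "d < ?n" for d
  proof -
    define A B :: real where "A = fact (?n - Suc d)" and "B = fact (?n + d)"
    define K :: real where "K = fact ?n * fact (?n + 1)"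
    define a b where "a = real (?n - d)" and "b = real (?n + d + 1)"
    have pos: "a > 0" "b > 0" "A > 0" "B > 0" using that by (simp_all add: a_def b_def A_def B_def)
    have 1: "fact (?n - d) = a * A" unfolding a_def A_def
      using that by (metis Suc_diff_Suc fact_Suc of_nat_fact of_nat_mult)
    have 2: "fact (?n + d + 1) = b * B" unfolding b_def B_def by simp
    have ba: "2 * real d + 1 = b - a" using that by (simp add: a_def b_def)
    have "1 / cheb_norm d = (b - a) * (K / (a * A * (b * B)))"
      using that by (simp only: inverse_cheb_norm less_imp_le 1 2 ba K_def)
    also have "\<dots> = K / (a * A * B) - K / (A * (b * B))"
      using pos by (simp add: field_simps)
    also have "\<dots> = r d - r (Suc d)"
      unfolding r_def K_def[symmetric] 1 A_def[symmetric] B_def[symmetric]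
      using 2 by (simp add: A_def[symmetric] mult_ac del: fact_Suc)
    finally show ?thesis .
  qed
  have "(\<Sum>d<M. 1 / cheb_norm d) = r 0 - r M" if "M \<le> ?n" for M
    using that by (induction M) (simp_all add: step)
  then have 1: "(\<Sum>d<?n. 1 / cheb_norm d) = r 0 - r ?n" by simp
  \<comment> \<open>At \<open>d = n\<close> the telescoping breaks off, since \<open>n - d\<close>
    is 0 there; the last term is exactly the remaining \<open>r n\<close>.\<close>
  have "1 / cheb_norm ?n = r ?n"
  proof -
    have "(fact (?n + ?n + 1) :: real) = (2 * real ?n + 1) * fact (?n + ?n)" by simp
    moreover have "2 * real ?n + 1 \<noteq> 0" by linarith
    ultimately show ?thesis by (simp add: inverse_cheb_norm r_def del: fact_Suc)
  qed
  moreover have "r 0 = real ?n + 1" by (simp add: r_def)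
  ultimately show ?thesis using 1 by (simp flip: lessThan_Suc_atMost)
qed

text \<open>The density, relative to \<open>weight\<close>, of the point mass at the empty
  set.\<close>

definition empty_dens :: "'a set \<Rightarrow> real" where
  "empty_dens Y = (if Y = {} then real (card N) + 1 else 0)"

lemma ip_empty_dens: "ip empty_dens f = f {}"
proof -
  have "ip empty_dens f = (\<Sum>Y\<in>Pow N. if Y = {} then f {} else 0)"
    unfolding ip_def by (intro sum.cong) (auto simp: empty_dens_def weight_def add.commute[of _ 1])
  then show ?thesis by (simp add: sum.delta)
qed

lemma ip_cheb_sum:
  assumes "I \<subseteq> {..card N}"
  shows "ip (\<lambda>Y. \<Sum>d\<in>I. c d * cheb d Y) (\<lambda>Y. \<Sum>d\<in>I. c d * cheb d Y) = (\<Sum>d\<in>I. (c d)\<^sup>2 * cheb_norm d)"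
proof -
  have fI: "finite I" using assms finite_subset by blast
  have "c d * (\<Sum>e\<in>I. c e * ip (cheb d) (cheb e)) = (c d)\<^sup>2 * cheb_norm d" if d: "d \<in> I" for d
  proof -
    have "(\<Sum>e\<in>I. c e * ip (cheb d) (cheb e)) = (\<Sum>e\<in>I. if e = d then c d * cheb_norm d else 0)"
    proof (rule sum.cong[OF refl])
      fix e assume "e \<in> I"
      then have "d \<le> card N" "e \<le> card N" using assms d by auto
      then show "c e * ip (cheb d) (cheb e) = (if e = d then c d * cheb_norm d else 0)"
        by (simp add: cheb_norm_def ip_cheb_cheb_neq)
    qed
    then show ?thesis using d fI by (simp add: sum.delta power2_eq_square)
  qed
  then show ?thesis by (simp add: ip_sum ip_sum_right)
qed

text \<open>No completeness argument is made: the sum of reciprocal norms shows that the squared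
  norm of \<open>S\<close> and its value at \<open>{}\<close> both equal \<open>card N + 1\<close>,
  so the error \<open>E\<close> has norm 0.\<close>

lemma empty_dens_expansion:
  assumes "Y \<subseteq> N"
  shows "empty_dens Y = (\<Sum>d\<le>card N. (1 / cheb_norm d) * cheb d Y)"
proof -
  define S where "S = (\<lambda>Y. \<Sum>d\<le>card N. (1 / cheb_norm d) * cheb d Y)"
  define E where "E = (\<lambda>Y. empty_dens Y - S Y)"
  have E: "ip E h = ip empty_dens h - ip S h" for h
    using ip_linear[of 1 empty_dens "- 1" S h] by (simp add: E_def)
  have S0: "S {} = real (card N) + 1"
    by (simp add: S_def cheb_empty sum_inverse_cheb_norm)
  have "ip S S = (\<Sum>d\<le>card N. (1 / cheb_norm d)\<^sup>2 * cheb_norm d)"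
    unfolding S_def by (rule ip_cheb_sum) simp
  also have "\<dots> = (\<Sum>d\<le>card N. 1 / cheb_norm d)"
    using cheb_norm_pos by (intro sum.cong) (auto simp: power2_eq_square dest!: cheb_norm_pos)
  finally have SS: "ip S S = real (card N) + 1" by (simp add: sum_inverse_cheb_norm)
  have "ip empty_dens E = 0" unfolding ip_empty_dens by (simp add: E_def S0) (simp add: empty_dens_def)
  moreover have "ip S E = 0" unfolding ip_commute[of S E] E ip_empty_dens SS S0 by simp
  ultimately have "ip E E = 0" using E[of E] by simp
  then have "E Y = 0" using assms by (rule ip_eq_0)
  then show ?thesis by (simp add: E_def S_def)
qed

lemma burnside_cheb_sum:
  assumes "Y \<subseteq> N" "I \<subseteq> {..card N}"
  shows "burnside (\<lambda>Y. \<Sum>d\<in>I. c d * cheb d Y) Y = (\<Sum>d\<in>I. (c d * walsh_eigval d) * cheb d Y)"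
proof -
  have "finite I" using assms finite_subset by blast
  then have "burnside (\<lambda>Y. \<Sum>d\<in>I. c d * cheb d Y) Y = (\<Sum>d\<in>I. c d * burnside (cheb d) Y)"
    by (rule burnside_sum)
  also have "\<dots> = (\<Sum>d\<in>I. (c d * walsh_eigval d) * cheb d Y)"
    using assms by (intro sum.cong) (auto simp: burnside_cheb)
  finally show ?thesis .
qed

text \<open>The squared norm is the sum over \<open>d \<ge> 1\<close> of
  \<open>walsh_eigval d ^ 4 / cheb_norm d\<close>, and \<open>2 * d + 1\<close> bounds the
  reciprocal norm uniformly in \<open>card N\<close>. After a single application of
  \<open>burnside\<close> the same estimate would only yield a logarithmically growing sum.\<close>

lemma burnside_burnside_empty_dens_norm:
  "ip (\<lambda>Y. burnside (burnside empty_dens) Y - 1) (\<lambda>Y. burnside (burnside empty_dens) Y - 1) \<le> 1 / 8"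
proof -
  let ?n = "card N"
  have b1: "burnside empty_dens = burnside (\<lambda>Y. \<Sum>d\<le>?n. (1 / cheb_norm d) * cheb d Y)"
    by (rule burnside_cong) (rule empty_dens_expansion)
  have b2: "burnside (burnside empty_dens) = burnside (\<lambda>Y. \<Sum>d\<le>?n. (1 / cheb_norm d * walsh_eigval d) * cheb d Y)"
    unfolding b1 by (rule burnside_cong) (rule burnside_cheb_sum, simp_all)
  have "burnside (burnside empty_dens) Y - 1 = (\<Sum>d\<in>{1..?n}. (1 / cheb_norm d * walsh_eigval d * walsh_eigval d) * cheb d Y)"
    if "Y \<subseteq> N" for Y
  proof -
    have "cheb_norm 0 = 1" by (simp add: cheb_norm_def cheb_0[abs_def])
    moreover have "{..?n} = insert 0 {1..?n}" by auto
    ultimately show ?thesis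
      unfolding b2 using that by (subst burnside_cheb_sum) (simp_all add: cheb_0)
  qed
  then have "ip (\<lambda>Y. burnside (burnside empty_dens) Y - 1) (\<lambda>Y. burnside (burnside empty_dens) Y - 1)
    = ip (\<lambda>Y. \<Sum>d\<in>{1..?n}. (1 / cheb_norm d * walsh_eigval d * walsh_eigval d) * cheb d Y)
         (\<lambda>Y. \<Sum>d\<in>{1..?n}. (1 / cheb_norm d * walsh_eigval d * walsh_eigval d) * cheb d Y)"
    by (intro ip_cong) auto
  also have "\<dots> = (\<Sum>d\<in>{1..?n}. (1 / cheb_norm d * walsh_eigval d * walsh_eigval d)\<^sup>2 * cheb_norm d)"
    by (rule ip_cheb_sum) auto
  also have "\<dots> \<le> (\<Sum>d\<in>{1..?n}. walsh_eigval d ^ 4 * (2 * real d + 1))"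
  proof (rule sum_mono)
    fix d assume d: "d \<in> {1..?n}"
    then have h: "0 < cheb_norm d" "1 / cheb_norm d \<le> 2 * real d + 1"
      using cheb_norm_pos[of d] inverse_cheb_norm_le[of d] by auto
    have "(1 / cheb_norm d * walsh_eigval d * walsh_eigval d)\<^sup>2 * cheb_norm d = walsh_eigval d ^ 4 * (1 / cheb_norm d)"
      using h(1) by (simp add: power2_eq_square power4_eq_xxxx)
    also have "\<dots> \<le> walsh_eigval d ^ 4 * (2 * real d + 1)"
      using h(2) by (intro mult_left_mono) auto
    finally show "(1 / cheb_norm d * walsh_eigval d * walsh_eigval d)\<^sup>2 * cheb_norm d \<le> walsh_eigval d ^ 4 * (2 * real d + 1)" .
  qed
  \<comment> \<open>Nonnegative terms are added to reach the range of
    \<open>sum_walsh_eigval_power4\<close>.\<close>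
  also have "\<dots> \<le> (\<Sum>d\<in>{1..2 * ?n + 1}. walsh_eigval d ^ 4 * (2 * real d + 1))"
    by (rule sum_mono2) auto
  also have "\<dots> \<le> 1 / 8 * (1 - 1 / (real ?n + 1)\<^sup>2)" by (rule sum_walsh_eigval_power4)
  also have "\<dots> \<le> 1 / 8" by simp
  finally show ?thesis .
qed

text \<open>Every permutation fixes both \<open>{}\<close> and \<open>N\<close>, so a mass at \<open>N\<close> may be moved to \<open>{}\<close> without changing its image.\<close>

lemma burnside_start_dens_cycle:
  assumes X: "fixed_sets N g = {{}, N}" and N: "N \<noteq> {}"
  shows "burnside (start_dens g) = burnside empty_dens"
proof -
  have start_dens: "start_dens g {} + start_dens g N = real (card N) + 1" "\<And>Y. Y \<noteq> {} \<Longrightarrow> Y \<noteq> N \<Longrightarrow> start_dens g Y = 0"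
    using N by (auto simp: start_dens_def X weight_def)
  have "avg N (start_dens g) p = avg N empty_dens p" if p: "p permutes N" for p
  proof -
    have N_in: "N \<in> fixed_sets N p" using p by (simp add: fixed_sets_def permutes_in_image)
    have "(\<Sum>Y\<in>fixed_sets N p. start_dens g Y) = (\<Sum>Y\<in>{{}, N}. start_dens g Y)"
      by (rule sum.mono_neutral_right) (use N_in start_dens(2) in auto)
    moreover have "(\<Sum>Y\<in>fixed_sets N p. empty_dens Y) = (\<Sum>Y\<in>{{}, N}. empty_dens Y)"
      by (rule sum.mono_neutral_right) (use N_in in \<open>auto simp: empty_dens_def\<close>)
    ultimately show ?thesis using N start_dens(1) by (simp add: avg_def empty_dens_def)
  qed
  then show ?thesis
    unfolding burnside_def stab_avg_def by (intro ext arg_cong2[where f = "(/)"] sum.cong) (auto simp: stab_perms_def)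
qed

lemma dual_kernel_nonneg: "0 \<le> dual_kernel g h"
  by (simp add: dual_kernel_def sum_nonneg)

lemma kernel_pow_dual_kernel_nonneg: "0 \<le> kernel_pow perms dual_kernel t g h"
  by (induction t arbitrary: g) (auto intro!: sum_nonneg mult_nonneg_nonneg dual_kernel_nonneg)

lemma tv_dist_dual_kernel_le_1: "tv_dist perms (kernel_pow perms dual_kernel (Suc t) g) dual_law \<le> 1"
proof -
  have lift1: "stab_avg (\<lambda>_. 1) = (\<lambda>_. 1)"
    using card_stab_perms_pos by (auto simp: stab_avg_def fun_eq_iff card_gt_0_iff)
  have "(\<Sum>h\<in>perms. kernel_pow perms dual_kernel (Suc t) g h) = 1"
    using kernel_pow_dual_kernel_apply[of t g "\<lambda>_. 1"] by (simp add: lift1 burnside_pow_one avg_def)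
  moreover have "(\<Sum>h\<in>perms. dual_law h) = 1"
    using dual_law_apply[of "\<lambda>_. 1"] by (simp add: lift1)
  moreover have "(\<Sum>h\<in>perms. \<bar>kernel_pow perms dual_kernel (Suc t) g h - dual_law h\<bar>)
    \<le> (\<Sum>h\<in>perms. kernel_pow perms dual_kernel (Suc t) g h + dual_law h)"
  proof (rule sum_mono)
    fix h
    have "0 \<le> dual_law h" by (simp add: dual_law_def)
    then show "\<bar>kernel_pow perms dual_kernel (Suc t) g h - dual_law h\<bar> \<le> kernel_pow perms dual_kernel (Suc t) g h + dual_law h"
      using kernel_pow_dual_kernel_nonneg[of "Suc t" g h] by linarith
  qed
  ultimately show ?thesis unfolding tv_dist_def sum.distrib by linarith
qed

lemma tv_dist_dual_kernel_cycle:
  assumes X: "fixed_sets N g = {{}, N}" and N: "N \<noteq> {}"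
  shows "tv_dist perms (kernel_pow perms dual_kernel (Suc t) g) dual_law \<le> 4 * (1 / 4) ^ t"
proof (cases "t \<le> 1")
  case True
  \<comment> \<open>In these two cases the claimed bound is at least 1, hence trivial.\<close>
  then have "t = 0 \<or> t = 1" by auto
  then have "1 \<le> 4 * (1 / 4 :: real) ^ t" by auto
  then show ?thesis using tv_dist_dual_kernel_le_1[of t g] by linarith
next
  case False
  then obtain s where t: "t = Suc (Suc s)" by (cases t; cases "t - 1") auto
  define v where "v = (\<lambda>Y. burnside (burnside empty_dens) Y - 1)"
  have "burnside (burnside (\<lambda>Y. start_dens g Y - 1)) Y = v Y" for Y
  proof -
    have "burnside (\<lambda>Y. start_dens g Y - 1) = (\<lambda>Y. burnside empty_dens Y - 1)"
      using burnside_linear[of 1 "start_dens g" "- 1" "\<lambda>_. 1"] by (simp add: fun_eq_iff burnside_start_dens_cycle[OF X N])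
    then show ?thesis using burnside_linear[of 1 "burnside empty_dens" "- 1" "\<lambda>_. 1" Y] by (simp add: v_def)
  qed
  then have "burnside (burnside (\<lambda>Y. start_dens g Y - 1)) = v" by (rule ext)
  then have u: "(burnside ^^ t) (\<lambda>Y. start_dens g Y - 1) = (burnside ^^ s) v"
    unfolding t by (simp add: funpow_swap1)
  have "ip v (\<lambda>_. 1) = 0"
    unfolding v_def by (rule ip_minus_one(1)) (simp add: ip_burnside_one ip_empty_dens)
  then have "ip ((burnside ^^ s) v) ((burnside ^^ s) v) \<le> (1 / 16) ^ s * ip v v" by (rule burnside_pow_gap)
  \<comment> \<open>The bound 1/8 is relaxed to 1/4 for its rational root: with the factor 1/2 of
    \<open>tv_dist_dual_kernel_le\<close> the result is \<open>(1 / 4) ^ s / 4\<close>, which is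
    exactly \<open>4 * (1 / 4) ^ t\<close> for \<open>t = s + 2\<close>.\<close>
  also have "\<dots> \<le> (1 / 16) ^ s * (1 / 4)"
    using burnside_burnside_empty_dens_norm by (intro mult_left_mono) (auto simp: v_def)
  finally have "sqrt (ip ((burnside ^^ s) v) ((burnside ^^ s) v)) \<le> sqrt ((1 / 16) ^ s * (1 / 4))"
    by (rule real_sqrt_le_mono)
  also have "\<dots> = (1 / 4) ^ s * (1 / 2)"
  proof -
    have "sqrt (1 / 4 :: real) = 1 / 2" by (rule real_sqrt_unique) (simp_all add: power2_eq_square)
    then show ?thesis by (simp only: sqrt_16_power)
  qed
  finally show ?thesis using tv_dist_dual_kernel_le[of t g, unfolded u] by (simp add: t)
qed

end

section \<open>The symmetric group acting on binary words\<close>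

text \<open>Identifies the partial products of Wallis, which makes the limit involving
  \<open>pi\<close> available for \<open>eig\<close>.\<close>

lemma wallis_eig: "(\<Prod>k = 1..n. (4 * real k ^ 2) / (4 * real k ^ 2 - 1)) = 1 / ((2 * real n + 1) * eig n)"
proof (induction n)
  case (Suc n)
  have nz: "2 * real n + 1 \<noteq> 0" "2 * real n + 3 \<noteq> 0" "real n + 1 \<noteq> 0" by linarith+
  have e: "eig n \<noteq> 0" using eig_pos[of n] by simp
  have 1: "4 * real (Suc n) ^ 2 - 1 = (2 * real n + 1) * (2 * real n + 3)"
    by (simp add: power2_eq_square algebra_simps)
  have 2: "4 * real (Suc n) ^ 2 = (2 * (real n + 1))\<^sup>2"
    by (simp add: power2_eq_square algebra_simps)
  have "(\<Prod>k = 1..Suc n. (4 * real k ^ 2) / (4 * real k ^ 2 - 1))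
    = 1 / ((2 * real n + 1) * eig n) * ((2 * (real n + 1))\<^sup>2 / ((2 * real n + 1) * (2 * real n + 3)))"
  proof -
    have "(\<Prod>k = 1..Suc n. (4 * real k ^ 2) / (4 * real k ^ 2 - 1))
      = (\<Prod>k = 1..n. (4 * real k ^ 2) / (4 * real k ^ 2 - 1))
        * ((4 * real (Suc n) ^ 2) / (4 * real (Suc n) ^ 2 - 1))"
      by (subst prod.nat_ivl_Suc') (simp_all add: mult.commute)
    then show ?thesis unfolding Suc 1 unfolding 2 .
  qed
  also have "\<dots> = 1 / ((2 * real n + 3) * (((2 * real n + 1) / (2 * (real n + 1)))\<^sup>2 * eig n))"
    using nz e by (simp add: power_divide power2_eq_square)
  also have "\<dots> = 1 / ((2 * real (Suc n) + 1) * eig (Suc n))"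
    unfolding eig_Suc by (simp add: add_ac)
  finally show ?case .
qed simp

text \<open>The sequence increases and tends to \<open>1 / pi\<close>, so its limit bounds every
  term. The limit follows from Wallis after subtracting \<open>eig n\<close>, which tends to
  0.\<close>

lemma eig_le_inverse_pi: "real n * eig n \<le> 1 / pi"
proof -
  have "(\<lambda>n. 1 / ((2 * real n + 1) * eig n)) \<longlonglongrightarrow> pi / 2"
    using wallis unfolding wallis_eig .
  then have "(\<lambda>n. inverse (1 / ((2 * real n + 1) * eig n))) \<longlonglongrightarrow> inverse (pi / 2)"
    by (rule tendsto_inverse) simp
  then have "(\<lambda>n. (2 * real n + 1) * eig n) \<longlonglongrightarrow> 2 / pi" by simp
  moreover have "eig \<longlonglongrightarrow> 0"
  proof (rule tendsto_sandwich[OF _ _ tendsto_const LIMSEQ_inverse_real_of_nat])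
    have "eig n \<le> inverse (real (Suc n))" for n
    proof -
      have "1 / (2 * real n + 1) \<le> 1 / real (Suc n)" by (intro divide_left_mono) auto
      then show ?thesis using eig_le_inverse[of n] by (simp add: inverse_eq_divide)
    qed
    then show "\<forall>\<^sub>F n in sequentially. eig n \<le> inverse (real (Suc n))" by simp
    show "\<forall>\<^sub>F n in sequentially. 0 \<le> eig n" using eig_pos by (simp add: less_imp_le)
  qed
  ultimately have "(\<lambda>n. ((2 * real n + 1) * eig n - eig n) / 2) \<longlonglongrightarrow> (2 / pi - 0) / 2"
    by (intro tendsto_diff tendsto_divide tendsto_const) auto
  then have lim: "(\<lambda>n. real n * eig n) \<longlonglongrightarrow> 1 / pi" by (simp add: algebra_simps)
  have "incseq (\<lambda>n. real n * eig n)"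
  proof (rule incseq_SucI)
    fix n
    have "real n \<le> (2 * real n + 1)\<^sup>2 / (4 * (real n + 1))"
      by (simp add: pos_le_divide_eq power2_eq_square algebra_simps)
    also have "\<dots> = real (Suc n) * ((2 * real n + 1) / (2 * (real n + 1)))\<^sup>2"
    proof -
      have "x\<^sup>2 / (4 * a) = a * (x / (2 * a))\<^sup>2" if "a \<noteq> 0" for x a :: real
        using that by (simp add: power_divide power2_eq_square)
      moreover have "real (Suc n) = real n + 1" "real n + 1 \<noteq> 0" by simp linarith
      ultimately show ?thesis by (simp only:)
    qed
    finally have "real n * eig n \<le> real (Suc n) * ((2 * real n + 1) / (2 * (real n + 1)))\<^sup>2 * eig n"
      using eig_pos[of n] by (intro mult_right_mono) auto
    then show "real n * eig n \<le> real (Suc n) * eig (Suc n)" unfolding eig_Suc by (simp add: mult.assoc)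
  qed
  then show ?thesis using lim by (rule incseq_le)
qed

lemma central_binomial_le:
  assumes "0 < n"
  shows "real ((2 * n) choose n) / 4 ^ n \<le> 1 / sqrt (pi * real n)"
proof -
  have "eig n \<le> 1 / (pi * real n)"
    using eig_le_inverse_pi[of n] assms by (simp add: field_simps)
  then have "sqrt (eig n) \<le> sqrt (1 / (pi * real n))" by (rule real_sqrt_le_mono)
  then show ?thesis by (simp add: eig_def power_mult real_sqrt_divide)
qed

text \<open>With \<open>s = sqrt (pi * n)\<close> the radicand is at most
  \<open>n / s + 1 / s - 1\<close>. Since \<open>s \<ge> 1\<close>, the subtracted 1 absorbs
  \<open>1 / s\<close>, and \<open>n / s\<close> is \<open>sqrt (n / pi)\<close>.\<close>

lemma sqrt_central_binomial_le:
  assumes "0 < n"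
  shows "sqrt (real (n + 1) / 4 ^ n * real ((2 * n) choose n) - 1) \<le> (real n / pi) powr (1 / 4)"
proof -
  define s where "s = sqrt (pi * real n)"
  have "1 * 1 \<le> pi * real n" using assms pi_gt3 by (intro mult_mono) auto
  then have s: "1 \<le> s" by (simp add: s_def)
  have "real (n + 1) * (real ((2 * n) choose n) / 4 ^ n) \<le> real (n + 1) * (1 / s)"
    unfolding s_def using assms by (intro mult_left_mono central_binomial_le) auto
  also have "\<dots> = real n / s + 1 / s" by (simp add: add_divide_distrib)
  also have "real n / s = sqrt (real n / pi)"
  proof -
    have "real n / s = real n / sqrt (real n) / sqrt pi"
      by (simp add: s_def real_sqrt_mult)
    also have "real n / sqrt (real n) = sqrt (real n)" by (rule real_div_sqrt) simp
    finally show ?thesis by (simp add: real_sqrt_divide)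
  qed
  also have "sqrt (real n / pi) + 1 / s \<le> sqrt (real n / pi) + 1" using s by simp
  finally have "real (n + 1) / 4 ^ n * real ((2 * n) choose n) - 1 \<le> sqrt (real n / pi)" by simp
  then have "sqrt (real (n + 1) / 4 ^ n * real ((2 * n) choose n) - 1) \<le> sqrt (sqrt (real n / pi))"
    by (rule real_sqrt_le_mono)
  also have "\<dots> = (real n / pi) powr (1 / 4)"
    by (simp add: powr_powr flip: powr_half_sqrt)
  finally show ?thesis .
qed

declare One_nat_def [simp del]

section \<open>Binary words as sets of positions\<close>

definition word_set :: "nat \<Rightarrow> (nat \<Rightarrow> nat) \<Rightarrow> nat set" where
  "word_set n x = {i \<in> {1..n}. x i = 1}"

lemma bij_betw_word_set: "bij_betw (word_set n) (binary_cube n) (Pow {1..n})"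
proof (rule bij_betw_byWitness[where f' = "\<lambda>Y. \<lambda>i\<in>{1..n}. if i \<in> Y then 1 else 0"])
  show "\<forall>x\<in>binary_cube n. (\<lambda>i\<in>{1..n}. if i \<in> word_set n x then 1 else 0) = x"
    by (fastforce simp: word_set_def binary_cube_def fun_eq_iff PiE_iff extensional_def)
qed (auto simp: word_set_def binary_cube_def split: if_splits)

text \<open>A word invariant under the inverse of \<open>g\<close> is invariant under
  \<open>g\<close>, so the inverse in the action disappears.\<close>

lemma perm_act_fixed_iff:
  assumes g: "g permutes {1..n}" and x: "x \<in> binary_cube n"
  shows "perm_act n g x = x \<longleftrightarrow> word_set n x \<in> fixed_sets {1..n} g"
proof -
  have gc: "g \<in> carrier (sym_group n)" using g by (simp add: sym_group_carrier)
  have gi: "g i \<in> {1..n} \<longleftrightarrow> i \<in> {1..n}" for i using g by (rule permutes_in_image)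
  have "perm_act n g x = x \<longleftrightarrow> (\<forall>i\<in>{1..n}. x (inv' g i) = x i)"
    using x unfolding perm_act_def sym_group_inv_equality[OF gc] binary_cube_def
    by (auto simp: fun_eq_iff PiE_iff extensional_def)
  also have "\<dots> \<longleftrightarrow> (\<forall>i\<in>{1..n}. x i = x (g i))"
  proof
    assume *: "\<forall>i\<in>{1..n}. x (inv' g i) = x i"
    show "\<forall>i\<in>{1..n}. x i = x (g i)"
      using * gi permutes_inverses(2)[OF g] by metis
  next
    assume *: "\<forall>i\<in>{1..n}. x i = x (g i)"
    show "\<forall>i\<in>{1..n}. x (inv' g i) = x i"
      using * gi permutes_inverses(1)[OF g] by metis
  qed
  also have "\<dots> \<longleftrightarrow> (\<forall>i\<in>{1..n}. x i = 1 \<longleftrightarrow> x (g i) = 1)"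
  proof -
    have "x i = 0 \<or> x i = 1" if "i \<in> {1..n}" for i
      using x that unfolding binary_cube_def PiE_iff by auto
    then show ?thesis using gi by (metis zero_neq_one)
  qed
  also have "\<dots> \<longleftrightarrow> word_set n x \<in> fixed_sets {1..n} g"
  proof -
    have "g i \<in> word_set n x \<longleftrightarrow> x (g i) = 1" "i \<in> word_set n x \<longleftrightarrow> x i = 1"
      if "i \<in> {1..n}" for i
      unfolding word_set_def mem_Collect_eq using gi[of i] that by blast+
    moreover have "word_set n x \<in> Pow {1..n}" unfolding word_set_def by blast
    ultimately show ?thesis unfolding fixed_sets_def mem_Collect_eq by metis
  qed
  finally show ?thesis .
qed

text \<open>Stated for a family \<open>H\<close> so that \<open>{g}\<close> gives the denominator of
  the kernel and \<open>{g, h}\<close> the range of its sum.\<close>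

lemma bij_betw_invariants:
  assumes "\<And>g. g \<in> H \<Longrightarrow> g permutes {1..n}" "H \<noteq> {}"
  shows "bij_betw (word_set n) (\<Inter>g\<in>H. invariants (binary_cube n) (perm_act n) g) (\<Inter>g\<in>H. fixed_sets {1..n} g)"
proof (rule bij_betw_imageI)
  show "inj_on (word_set n) (\<Inter>g\<in>H. invariants (binary_cube n) (perm_act n) g)"
    by (rule inj_on_subset[OF bij_betw_imp_inj_on[OF bij_betw_word_set]])
      (use assms(2) in \<open>auto simp: invariants_def\<close>)
  have iff: "x \<in> invariants (binary_cube n) (perm_act n) g \<longleftrightarrow> word_set n x \<in> fixed_sets {1..n} g"
    if "g \<in> H" "x \<in> binary_cube n" for g x
    using perm_act_fixed_iff[OF assms(1)[OF that(1)] that(2)] that(2) by (simp add: invariants_def)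
  have cube: "x \<in> binary_cube n" if "x \<in> (\<Inter>g\<in>H. invariants (binary_cube n) (perm_act n) g)" for x
    using that assms(2) by (auto simp: invariants_def)
  show "word_set n ` (\<Inter>g\<in>H. invariants (binary_cube n) (perm_act n) g) = (\<Inter>g\<in>H. fixed_sets {1..n} g)"
  proof (intro subset_antisym image_subsetI INT_I subsetI)
    fix x g assume x: "x \<in> (\<Inter>g\<in>H. invariants (binary_cube n) (perm_act n) g)" and g: "g \<in> H"
    show "word_set n x \<in> fixed_sets {1..n} g" using iff[OF g cube[OF x]] INT_D[OF x g] by blast
  next
    fix Y assume Y: "Y \<in> (\<Inter>g\<in>H. fixed_sets {1..n} g)"
    obtain g where "g \<in> H" using assms(2) by blast
    from INT_D[OF Y this] have "Y \<in> Pow {1..n}" unfolding fixed_sets_def by blast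
    then obtain x where x: "x \<in> binary_cube n" "Y = word_set n x"
      using bij_betw_imp_surj_on[OF bij_betw_word_set] by blast
    have "x \<in> (\<Inter>g\<in>H. invariants (binary_cube n) (perm_act n) g)"
      using iff[OF _ x(1)] INT_D[OF Y] x(2) by (intro INT_I) blast
    then show "Y \<in> word_set n ` (\<Inter>g\<in>H. invariants (binary_cube n) (perm_act n) g)"
      using x(2) by blast
  qed
qed

lemma stabilizer_eq_stab_perms:
  assumes "x \<in> binary_cube n"
  shows "stabilizer (sym_group n) (perm_act n) x = stab_perms {1..n} (word_set n x)"
proof -
  have "word_set n x \<subseteq> {1..n}" by (auto simp: word_set_def)
  then have "word_set n x \<in> fixed_sets {1..n} g \<longleftrightarrow> g \<in> stab_perms {1..n} (word_set n x)" if "g permutes {1..n}" for g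
    using that by (auto simp: fixed_sets_def stab_perms_def)
  then show ?thesis
    using assms by (auto simp: stabilizer_def sym_group_carrier perm_act_fixed_iff stab_perms_def)
qed

section \<open>Orbits and fixed sets\<close>

lemma orbit_eq_of_member:
  assumes "g permutes S" "finite S" "y \<in> Orbits.orbit g x"
  shows "Orbits.orbit g y = Orbits.orbit g x"
  using cyclic_on_orbit[OF assms(1,2), of x] assms(3) by (auto simp: cyclic_on_alldef)

lemma permutes_self_in_orbit: "g permutes S \<Longrightarrow> finite S \<Longrightarrow> x \<in> Orbits.orbit g x"
  by (meson permutation_permutes permutation_self_in_orbit)

lemma orbit_subset_fixed_sets:
  assumes "Y \<in> fixed_sets S g" "x \<in> Y"
  shows "Orbits.orbit g x \<subseteq> Y"
proof
  fix y assume "y \<in> Orbits.orbit g x"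
  then show "y \<in> Y" by induction (use assms in \<open>auto simp: fixed_sets_def\<close>)
qed

text \<open>Fixed sets are the unions of families of orbits, and a family is determined by its union
  because orbits are disjoint and nonempty.\<close>

lemma card_fixed_sets_eq_power:
  assumes g: "g permutes S" and S: "finite S"
  shows "card (fixed_sets S g) = 2 ^ card (Orbits.orbit g ` S)"
proof -
  have "inj_on \<Union> (Pow (Orbits.orbit g ` S))"
  proof (rule inj_onI)
    have *: "P \<subseteq> R"
      if PR: "P \<in> Pow (Orbits.orbit g ` S)" "R \<in> Pow (Orbits.orbit g ` S)" "\<Union> P = \<Union> R" for P R
    proof
      fix C assume C: "C \<in> P"
      then obtain x where x: "C = Orbits.orbit g x" using PR by auto
      then have "x \<in> \<Union> R" using C PR permutes_self_in_orbit[OF g S, of x] by auto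
      then obtain D where D: "D \<in> R" "x \<in> D" by auto
      then obtain y where "D = Orbits.orbit g y" using PR by auto
      then show "C \<in> R" using D x orbit_eq_of_member[OF g S, of x y] by simp
    qed
    show "P = R" if "P \<in> Pow (Orbits.orbit g ` S)" "R \<in> Pow (Orbits.orbit g ` S)" "\<Union> P = \<Union> R" for P R
      using *[of P R] *[of R P] that by auto
  qed
  moreover have "\<Union> ` Pow (Orbits.orbit g ` S) = fixed_sets S g"
  proof
    show "\<Union> ` Pow (Orbits.orbit g ` S) \<subseteq> fixed_sets S g"
    proof
      fix Y assume "Y \<in> \<Union> ` Pow (Orbits.orbit g ` S)"
      then obtain P where P: "P \<subseteq> Orbits.orbit g ` S" "Y = \<Union> P" by auto
      have "Y \<subseteq> S"
        using P permutes_orbit_subset[OF g] by auto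
      moreover have "g i \<in> C \<longleftrightarrow> i \<in> C" if C: "C \<in> P" for i C
      proof -
        obtain x where x: "C = Orbits.orbit g x" using C P by auto
        have "Orbits.orbit g (g i) = Orbits.orbit g i"
          by (rule orbit_eq_of_member[OF g S]) (rule Orbits.orbit.base)
        then show ?thesis
          unfolding x using orbit_eq_of_member[OF g S] permutes_self_in_orbit[OF g S] by metis
      qed
      ultimately show "Y \<in> fixed_sets S g" using P by (auto simp: fixed_sets_def)
    qed
    show "fixed_sets S g \<subseteq> \<Union> ` Pow (Orbits.orbit g ` S)"
    proof
      fix Y assume Y: "Y \<in> fixed_sets S g"
      have "Y = \<Union> (Orbits.orbit g ` Y)"
        using orbit_subset_fixed_sets[OF Y] permutes_self_in_orbit[OF g S] by auto
      moreover have "Orbits.orbit g ` Y \<in> Pow (Orbits.orbit g ` S)" using Y by (auto simp: fixed_sets_def)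
      ultimately show "Y \<in> \<Union> ` Pow (Orbits.orbit g ` S)" by blast
    qed
  qed
  ultimately have "card (fixed_sets S g) = card (Pow (Orbits.orbit g ` S))"
    by (metis card_image)
  then show ?thesis using S by (simp add: card_Pow)
qed

lemma fixed_sets_cyclic:
  assumes "g permutes S" "cyclic_on g S"
  shows "fixed_sets S g = {{}, S}"
proof -
  have "Y = S" if Y: "Y \<in> fixed_sets S g" "Y \<noteq> {}" for Y
  proof -
    obtain y where y: "y \<in> Y" using Y by auto
    then have "y \<in> S" using Y by (auto simp: fixed_sets_def)
    then have "S = Orbits.orbit g y" using assms(2) by (auto simp: cyclic_on_alldef)
    then show ?thesis using orbit_subset_fixed_sets[OF Y(1) y] Y(1) by (auto simp: fixed_sets_def)
  qed
  moreover have "S \<in> fixed_sets S g" using assms by (simp add: fixed_sets_def permutes_in_image)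
  ultimately show ?thesis by auto
qed

lemma kernel_pow_cong:
  assumes "\<And>g h. g \<in> S \<Longrightarrow> h \<in> S \<Longrightarrow> K g h = K' g h" and "g \<in> S"
  shows "kernel_pow S K t g h = kernel_pow S K' t g h"
  using assms(2) by (induction t arbitrary: g) (auto simp: assms(1) intro!: sum.cong)

lemma carrier_sym_group: "carrier (sym_group n) = {p. p permutes {1..n}}"
  by (auto simp: sym_group_carrier)

section \<open>Transfer to the kernel on the symmetric group\<close>

locale binary_ground =
  fixes n :: nat
begin

sublocale finite_ground "{1..n}" by unfold_locales simp

lemma Q_kernel_eq_dual_kernel:
  assumes g: "g permutes {1..n}" and h: "h permutes {1..n}"
  shows "Q_kernel n g h = dual_kernel g h"
proof -
  have bg: "bij_betw (word_set n) (invariants (binary_cube n) (perm_act n) g) (fixed_sets {1..n} g)"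
    using bij_betw_invariants[of "{g}" n] g by simp
  have bgh: "bij_betw (word_set n)
      (invariants (binary_cube n) (perm_act n) g \<inter> invariants (binary_cube n) (perm_act n) h)
      (fixed_sets {1..n} g \<inter> fixed_sets {1..n} h)"
    using bij_betw_invariants[of "{g, h}" n] g h by auto
  have "(\<Sum>x\<in>invariants (binary_cube n) (perm_act n) g \<inter> invariants (binary_cube n) (perm_act n) h.
      1 / real (card (stabilizer (sym_group n) (perm_act n) x)))
    = (\<Sum>x\<in>invariants (binary_cube n) (perm_act n) g \<inter> invariants (binary_cube n) (perm_act n) h.
      1 / real (card (stab_perms {1..n} (word_set n x))))"
    by (intro sum.cong refl) (auto simp: invariants_def stabilizer_eq_stab_perms)
  also have "\<dots> = (\<Sum>Y\<in>fixed_sets {1..n} g \<inter> fixed_sets {1..n} h. 1 / real (card (stab_perms {1..n} Y)))"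
    by (rule sum.reindex_bij_betw[OF bgh])
  finally show ?thesis
    unfolding Q_kernel_def dual_burnside_def dual_kernel_def by (simp add: bij_betw_same_card[OF bg])
qed

lemma pi_Q_eq_dual_law: "g permutes {1..n} \<Longrightarrow> pi_Q n g = dual_law g"
  by (simp add: pi_Q_def dual_law_def num_cycles_def card_fixed_sets_eq_power del: fact_Suc)

lemma d_Q_from_eq:
  assumes "g permutes {1..n}"
  shows "d_Q_from n g t = tv_dist perms (kernel_pow perms dual_kernel t g) dual_law"
proof -
  have "kernel_pow perms (Q_kernel n) t g h = kernel_pow perms dual_kernel t g h" for h
    by (rule kernel_pow_cong) (use assms Q_kernel_eq_dual_kernel in auto)
  then show ?thesis
    unfolding d_Q_from_def carrier_sym_group tv_dist_def by (simp add: pi_Q_eq_dual_law)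
qed

lemma char_poly_Q_mat:
  "\<exists>e. bij_betw e {..<card perms} perms
    \<and> char_poly (Q_mat n) = char_poly (kernel_mat_enum e perms dual_kernel)"
proof -
  obtain e where e: "bij_betw e {..<card perms} perms"
    using ex_bij_betw_nat_finite[OF finite_perms] by (auto simp: atLeast0LessThan)
  have "e i \<in> perms" if "i < card perms" for i using bij_betwE[OF e] that by auto
  then have "kernel_mat_enum e perms (Q_kernel n) = kernel_mat_enum e perms dual_kernel"
    unfolding kernel_mat_enum_def by (intro cong_mat) (auto simp: Q_kernel_eq_dual_kernel)
  then show ?thesis
    using e char_poly_kernel_mat_enum[OF finite_perms e, of "Q_kernel n"]
    unfolding Q_mat_def carrier_sym_group by auto
qed

lemma alg_mult_eig: "alg_mult (Q_mat n) (complex_of_real (eig m)) = n choose (2 * m)"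
  using char_poly_Q_mat order_eig by (auto simp: alg_mult_def)

lemma alg_mult_zero:
  assumes "0 < n"
  shows "alg_mult (Q_mat n) 0 + 2 ^ (n - 1) = fact n"
  using char_poly_Q_mat order_zero assms by (auto simp: alg_mult_def)

lemma alg_mult_other:
  assumes "z \<noteq> 0" "\<And>m. m \<le> n div 2 \<Longrightarrow> z \<noteq> complex_of_real (eig m)"
  shows "alg_mult (Q_mat n) z = 0"
  using char_poly_Q_mat order_other[of _ z] assms by (auto simp: alg_mult_def)

lemma spectrum_iff_alg_mult: "z \<in> spectrum (Q_mat n) \<longleftrightarrow> alg_mult (Q_mat n) z \<noteq> 0"
proof -
  have c: "Q_mat n \<in> carrier_mat (card perms) (card perms)"
    unfolding Q_mat_def kernel_mat_def carrier_sym_group by (rule kernel_mat_enum_carrier)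
  then have "char_poly (Q_mat n) \<noteq> 0" using degree_monic_char_poly[OF c] by auto
  then show ?thesis
    unfolding spectrum_root_char_poly[OF c] alg_mult_def by (simp add: order_root)
qed

lemma spectrum_nonzero: "spectrum (Q_mat n) - {0} = {complex_of_real (eig m) | m. m \<le> n div 2}"
proof -
  have "z \<in> spectrum (Q_mat n) \<and> z \<noteq> 0 \<longleftrightarrow> (\<exists>m. z = complex_of_real (eig m) \<and> m \<le> n div 2)" for z
  proof
    assume "z \<in> spectrum (Q_mat n) \<and> z \<noteq> 0"
    then show "\<exists>m. z = complex_of_real (eig m) \<and> m \<le> n div 2"
      using alg_mult_other[of z] by (auto simp: spectrum_iff_alg_mult)
  next
    assume "\<exists>m. z = complex_of_real (eig m) \<and> m \<le> n div 2"
    then obtain m where m: "z = complex_of_real (eig m)" "m \<le> n div 2" by blast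
    moreover have "n choose (2 * m) \<noteq> 0" using m(2) by simp
    ultimately show "z \<in> spectrum (Q_mat n) \<and> z \<noteq> 0"
      using eig_pos[of m] by (simp add: spectrum_iff_alg_mult alg_mult_eig)
  qed
  then show ?thesis by auto
qed

lemma two_power_less_fact: "3 \<le> k \<Longrightarrow> 2 ^ (k - 1) < (fact k :: nat)"
proof (induction k rule: dec_induct)
  case base
  then show ?case by (simp add: fact_numeral)
next
  case (step k)
  have "(2 :: nat) ^ (Suc k - 1) = 2 * 2 ^ (k - 1)" using step by (cases k) auto
  also have "\<dots> < 2 * fact k" using step by simp
  also have "\<dots> \<le> Suc k * fact k" using step by (intro mult_right_mono) auto
  finally show ?case by simp
qed

lemma zero_in_spectrum_iff:
  assumes "2 \<le> n"
  shows "0 \<in> spectrum (Q_mat n) \<longleftrightarrow> 3 \<le> n"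
proof (cases "n = 2")
  case True
  \<comment> \<open>For two points \<open>fact 2 = 2 ^ (2 - 1)\<close>, so no multiplicity is left
    for 0.\<close>
  then show ?thesis unfolding spectrum_iff_alg_mult using alg_mult_zero by simp
next
  case False
  then have "3 \<le> n" using assms by simp
  then show ?thesis using alg_mult_zero two_power_less_fact[of n] by (auto simp: spectrum_iff_alg_mult)
qed

lemma id_perm: "id \<in> perms"
  by (simp add: permutes_id)

lemma d_Q_ge: "g \<in> perms \<Longrightarrow> d_Q_from n g t \<le> d_Q n t"
  unfolding d_Q_def carrier_sym_group using finite_perms by (intro Max_ge) auto

lemma d_Q_le:
  assumes "\<And>g. g \<in> perms \<Longrightarrow> d_Q_from n g t \<le> c"
  shows "d_Q n t \<le> c"
proof -
  have "perms \<noteq> {}" using id_perm by blast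
  then show ?thesis
    unfolding d_Q_def carrier_sym_group using finite_perms assms by (intro Max.boundedI) auto
qed

lemma d_Q_upper:
  "d_Q n (Suc t) \<le> 1 / 2 * sqrt (real (n + 1) * real (n choose (n div 2))) * (1 / 4) ^ t"
proof (rule d_Q_le)
  fix g assume g: "g \<in> perms"
  have "sqrt (ip (start_dens g) (start_dens g) - 1) \<le> sqrt (real (n + 1) * real (n choose (n div 2)))"
    using ip_start_dens_le[of g] by (intro real_sqrt_le_mono) simp
  then have "1 / 2 * sqrt (ip (start_dens g) (start_dens g) - 1) * (1 / 4) ^ t
      \<le> 1 / 2 * sqrt (real (n + 1) * real (n choose (n div 2))) * (1 / 4) ^ t"
    by (intro mult_right_mono mult_left_mono) auto
  moreover have "d_Q_from n g (Suc t) \<le> 1 / 2 * sqrt (ip (start_dens g) (start_dens g) - 1) * (1 / 4) ^ t"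
    using tv_dist_dual_kernel_L2[of t g] g by (simp only: d_Q_from_eq mem_Collect_eq)
  ultimately show "d_Q_from n g (Suc t) \<le> 1 / 2 * sqrt (real (n + 1) * real (n choose (n div 2))) * (1 / 4) ^ t"
    by (rule order_trans[rotated])
qed

lemma d_Q_from_cycle:
  assumes "g \<in> perms" "cyclic_on g {1..n}" "0 < n"
  shows "d_Q_from n g (Suc t) \<le> 4 * (1 / 4) ^ t"
  using tv_dist_dual_kernel_cycle[OF fixed_sets_cyclic[of g "{1..n}"], of t] assms by (simp add: d_Q_from_eq)

lemma d_Q_lower:
  assumes "2 \<le> n"
  shows "1 / 4 ^ (t + 2) \<le> d_Q n t"
proof -
  obtain g where g: "g \<in> perms" "(1 / 4) ^ t / 2 \<le> tv_dist perms (kernel_pow perms dual_kernel t g) dual_law"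
    using tv_dist_dual_kernel_lower_quarter[of 1 2] assms by auto
  \<comment> \<open>The eigenfunction gives a lower bound \<open>(1 / 4) ^ t / 2\<close>, which is
    weakened to a sixteenth.\<close>
  have "1 / 4 ^ (t + 2) = (1 / 4 :: real) ^ t * (1 / 16)" by (simp add: power_add power_divide)
  also have "\<dots> \<le> (1 / 4) ^ t * (1 / 2)" by (intro mult_left_mono) auto
  also have "\<dots> = (1 / 4) ^ t / 2" by simp
  also have "\<dots> \<le> d_Q_from n g t" using g by (simp add: d_Q_from_eq)
  also have "\<dots> \<le> d_Q n t" by (rule d_Q_ge[OF g(1)])
  finally show ?thesis .
qed

lemma d_Q_from_id:
  "d_Q_from n id (Suc t)
    \<le> 1 / 2 * sqrt (real (n + 1) / 4 ^ n * real ((2 * n) choose n) - 1) * (1 / 4) ^ t"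
  using tv_dist_dual_kernel_L2[of t id] ip_start_dens_id by (simp add: d_Q_from_eq permutes_id)

lemma t_mix_from_cycle:
  assumes "g \<in> perms" "cyclic_on g {1..n}" "0 < n" and \<epsilon>: "0 < \<epsilon>" "\<epsilon> < 1"
  shows "int (t_mix_from n g \<epsilon>) \<le> 2 + \<lceil>log 4 (1 / \<epsilon>)\<rceil>"
proof -
  define L where "L = \<lceil>log 4 (1 / \<epsilon>)\<rceil>"
  have "0 \<le> log 4 (1 / \<epsilon>)" using \<epsilon> by simp
  then have L: "0 \<le> L" "log 4 (1 / \<epsilon>) \<le> real (nat L)" by (simp_all add: L_def)
  have "1 / \<epsilon> = 4 powr log 4 (1 / \<epsilon>)" using \<epsilon> by simp
  also have "\<dots> \<le> 4 powr real (nat L)" using L by (intro powr_mono) auto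
  also have "\<dots> = 4 ^ nat L" by (simp add: powr_realpow)
  finally have "(1 / 4) ^ nat L \<le> \<epsilon>" using \<epsilon> by (simp add: power_divide field_simps)
  \<comment> \<open>At time \<open>nat L + 2\<close> the bound is exactly
    \<open>(1 / 4) ^ nat L\<close>: one extra step pays for the leading factor 4, the other for the
    shift between time and exponent.\<close>
  then have "d_Q_from n g (Suc (Suc (nat L))) \<le> \<epsilon>"
    using d_Q_from_cycle[OF assms(1-3), of "Suc (nat L)"] by simp
  then have "t_mix_from n g \<epsilon> \<le> Suc (Suc (nat L))"
    unfolding t_mix_from_def by (rule Least_le)
  then show ?thesis using L(1) by (simp add: L_def[symmetric])
qed

text \<open>Guarantees that the minimum defining \<open>t_mix\<close> is attained, so that the lower
  bound on \<open>d_Q\<close> can be evaluated at \<open>t_mix\<close> itself.\<close>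

lemma d_Q_tendsto: "\<exists>t. d_Q n t \<le> \<epsilon>" if "0 < \<epsilon>"
proof -
  define c where "c = 1 / 2 * sqrt (real (n + 1) * real (n choose (n div 2)))"
  have c: "0 < c" by (simp add: c_def)
  have "0 < \<epsilon> / c" using that c by simp
  then obtain t where "(1 / 4) ^ t < \<epsilon> / c"
    using real_arch_pow_inv[of "\<epsilon> / c" "1 / 4"] by auto
  then have "c * (1 / 4) ^ t \<le> \<epsilon>" using c by (simp add: field_simps)
  then show ?thesis using d_Q_upper[of t] unfolding c_def by (intro exI[of _ "Suc t"]) linarith
qed

lemma t_mix_lower:
  assumes "2 \<le> n" and \<epsilon>: "0 < \<epsilon>"
  shows "\<lceil>log 4 (1 / \<epsilon>)\<rceil> - 2 \<le> int (t_mix n \<epsilon>)"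
proof -
  let ?t = "t_mix n \<epsilon>"
  have "d_Q n ?t \<le> \<epsilon>"
    unfolding t_mix_def using d_Q_tendsto[OF \<epsilon>] by (rule LeastI_ex)
  then have "1 / 4 ^ (?t + 2) \<le> \<epsilon>" using d_Q_lower[OF assms(1), of ?t] by linarith
  then have "1 / \<epsilon> \<le> 4 ^ (?t + 2)" using \<epsilon> by (simp add: field_simps)
  then have "log 4 (1 / \<epsilon>) \<le> log 4 (4 ^ (?t + 2))" using \<epsilon> by (subst log_le_cancel_iff) auto
  also have "\<dots> = real (?t + 2)" by (rule log_pow_cancel) auto
  finally show ?thesis by linarith
qed

end

theorem theorem5p18:
  fixes n :: nat and \<epsilon> :: real
  assumes "n \<ge> 2" and "0 < \<epsilon>" and "\<epsilon> < 1"
  shows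
    "(spectrum (Q_mat n) - {0} = {complex_of_real (eig m) | m. m \<le> n div 2}
      \<and> (\<forall>m \<le> n div 2. alg_mult (Q_mat n) (complex_of_real (eig m)) = n choose (2 * m))
      \<and> int (alg_mult (Q_mat n) 0) = fact n - 2 ^ (n - 1)
      \<and> (0 \<in> spectrum (Q_mat n) \<longleftrightarrow> n \<ge> 3))

     \<and> (\<forall>t \<ge> 1. d_Q n t
          \<le> 1 / 2 * sqrt (real (n + 1) * real (n choose (n div 2))) * (1 / 4) ^ (t - 1))

     \<and> (\<forall>g \<in> carrier (sym_group n). cyclic_on g {1..n} \<longrightarrow>
          (\<forall>t \<ge> 1. d_Q_from n g t \<le> 4 * (1 / 4) ^ (t - 1))
          \<and> int (t_mix_from n g \<epsilon>) \<le> 2 + \<lceil>log 4 (1 / \<epsilon>)\<rceil>)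

     \<and> ((\<forall>t. d_Q n t \<ge> 1 / 4 ^ (t + 2))
          \<and> int (t_mix n \<epsilon>) \<ge> \<lceil>log 4 (1 / \<epsilon>)\<rceil> - 2)

     \<and> (\<forall>t \<ge> 1.
          d_Q_from n id t
            \<le> 1 / 2 * sqrt (real (n + 1) / 4 ^ n * real ((2 * n) choose n) - 1) * (1 / 4) ^ (t - 1)
          \<and> 1 / 2 * sqrt (real (n + 1) / 4 ^ n * real ((2 * n) choose n) - 1) * (1 / 4) ^ (t - 1)
            \<le> 1 / 2 * (real n / pi) powr (1 / 4) * (1 / 4) ^ (t - 1))"
proof -
  interpret binary_ground n .
  have n: "0 < n" using assms(1) by simp
  have shift: "(\<forall>t\<ge>1. P t) \<longleftrightarrow> (\<forall>t. P (Suc t))" for P :: "nat \<Rightarrow> bool"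
    by (metis One_nat_def Suc_le_D Suc_le_mono le0)
  have zero: "int (alg_mult (Q_mat n) 0) = fact n - 2 ^ (n - 1)"
  proof -
    have "int (alg_mult (Q_mat n) 0 + 2 ^ (n - 1)) = int (fact n)" unfolding alg_mult_zero[OF n] ..
    then show ?thesis by simp
  qed
  have id2: "1 / 2 * sqrt (real (n + 1) / 4 ^ n * real ((2 * n) choose n) - 1) * (1 / 4) ^ t
      \<le> 1 / 2 * (real n / pi) powr (1 / 4) * (1 / 4) ^ t" for t
    by (intro mult_right_mono mult_left_mono sqrt_central_binomial_le n) auto
  show ?thesis
    unfolding shift carrier_sym_group diff_Suc_1
    using spectrum_nonzero alg_mult_eig zero zero_in_spectrum_iff[OF assms(1)] d_Q_upper
      d_Q_from_cycle[OF _ _ n] t_mix_from_cycle[OF _ _ n assms(2,3)] d_Q_lower[OF assms(1)]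
      t_mix_lower[OF assms(1,2)] d_Q_from_id id2
    by (intro conjI ballI allI impI) assumption+
qed

end
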